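(* Let $L$ be a complete atomistic ortholattice with the following properties: (H1) $L$ has the finite covering property; (H2) for any distinct atoms $p$ and $q$ of $L$ there is an atom $r \perp p$ such that $p \vee q = p \vee r$; (H3) for any orthogonal atoms $p$ and $q$ of $L$ there is a third atom (i.e. an atom distinct from $p$ and $q$) below $p \vee q$; (H4) $L$ is of height $\geq 4$. Then there is a $\star$-sfield $K$ and a Hermitian space $H$ over $K$ such that $L$ is isomorphic, as an ortholattice, to $\mathcal C(H)$.
   Context: An ortholattice is a bounded lattice $L$ with an order-reversing involutive unary operation $^\perp$ sending each $a$ to a complement of $a$; $a \perp b$ means $a \leq b^\perp$. A lattice is atomistic if every element is a join of atoms. An element is finite if it is the bottom element or a join of finitely many atoms. $L$ has the finite covering property if for every finite $a \in L$ and every atom $p \nleq a$, $a \vee p$ covers $a$. Height $\geq 4$ means that $L$ contains a chain with at least five elements. A $\star$-sfield is a division ring $K$ equipped with an involutorial antiautomorphism $^\star$. A Hermitian space over $K$ is a left linear space $H$ over $K$ (of dimension at least 3, possibly infinite) with a map $(\cdot,\cdot)\colon H\times H \to K$ that is linear in the first argument, satisfies $(w,\alpha u+\beta v) = (w,u)\alpha^\star + (w,v)\beta^\star$ and $(u,v) = (v,u)^\star$, and is anisotropic: $(u,u)=0$ implies $u=0$. For $u,v\in H$, $u \perp v$ means $(u,v)=0$; for $E \subseteq H$, $E^\perp = \{v \in H : v \perp u \text{ for all } u \in E\}$. $\mathcal C(H)$ is the ortholattice of all subspaces $E$ of $H$ with $E^{\perp\perp} = E$, ordered by inclusion, with orthocomplementation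 $^\perp$. *)

theory Defs
  imports "HOL-Library.Complemented_Lattices" "HOL-Algebra.Module"
begin

section \<open>Ortholattices\<close>

text \<open>
  An ortholattice is a type of class \<^class>\<open>orthocomplemented_lattice\<close>; the orthocomplement of
  \<open>a\<close> is written \<open>- a\<close>.
\<close>

definition covers :: "'a::order \<Rightarrow> 'a \<Rightarrow> bool"
  where "covers b a \<longleftrightarrow> a < b \<and> \<not> (\<exists>c. a < c \<and> c < b)"

definition atom :: "'a::order_bot \<Rightarrow> bool"
  where "atom p \<longleftrightarrow> covers p bot"

definition orthogonal :: "'a::orthocomplemented_lattice \<Rightarrow> 'a \<Rightarrow> bool"
  where "orthogonal a b \<longleftrightarrow> a \<le> - b"

definition atomistic :: "'a::complete_lattice itself \<Rightarrow> bool"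
  where "atomistic _ \<longleftrightarrow> (\<forall>a::'a. \<exists>S. (\<forall>p\<in>S. atom p) \<and> a = Sup S)"

definition finite_element :: "'a::complete_lattice \<Rightarrow> bool"
  where "finite_element a \<longleftrightarrow> a = bot \<or> (\<exists>S. finite S \<and> (\<forall>p\<in>S. atom p) \<and> a = Sup S)"

definition finite_covering_property :: "'a::complete_lattice itself \<Rightarrow> bool"
  where "finite_covering_property _ \<longleftrightarrow>
    (\<forall>(a::'a) p. finite_element a \<and> atom p \<and> \<not> p \<le> a \<longrightarrow> covers (sup a p) a)"

definition height_at_least :: "nat \<Rightarrow> 'a::order itself \<Rightarrow> bool"
  where "height_at_least n _ \<longleftrightarrow>
    (\<exists>C :: 'a set. Complete_Partial_Order.chain (\<le>) C \<and> (infinite C \<or> n + 1 \<le> card C))"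

section \<open>Hermitian spaces\<close>

text \<open>
  The locale \<^locale>\<open>module\<close> requires a commutative ring of scalars, so left linear spaces over
  division rings are introduced separately. The record type of modules is reused; the fields
  \<open>mult\<close> and \<open>one\<close> that it inherits play no role.
\<close>

locale star_sfield = ring K for K (structure) +
  fixes star :: "'k \<Rightarrow> 'k"
  assumes one_not_zero: "\<one> \<noteq> \<zero>"
    and sfield_Units: "Units K = carrier K - {\<zero>}"
    and star_closed: "a \<in> carrier K \<Longrightarrow> star a \<in> carrier K"
    and star_add: "\<lbrakk>a \<in> carrier K; b \<in> carrier K\<rbrakk> \<Longrightarrow> star (a \<oplus> b) = star a \<oplus> star b"
    and star_mult: "\<lbrakk>a \<in> carrier K; b \<in> carrier K\<rbrakk> \<Longrightarrow> star (a \<otimes> b) = star b \<otimes> star a"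
    and star_star: "a \<in> carrier K \<Longrightarrow> star (star a) = a"

locale left_linear_space = K?: ring K + H?: abelian_group H
  for K :: "'k ring" (structure) and H :: "('k, 'v) module" (structure) +
  assumes smult_closed:
      "\<lbrakk>a \<in> carrier K; u \<in> carrier H\<rbrakk> \<Longrightarrow> a \<odot>\<^bsub>H\<^esub> u \<in> carrier H"
    and smult_l_distr:
      "\<lbrakk>a \<in> carrier K; b \<in> carrier K; u \<in> carrier H\<rbrakk> \<Longrightarrow>
        (a \<oplus>\<^bsub>K\<^esub> b) \<odot>\<^bsub>H\<^esub> u = a \<odot>\<^bsub>H\<^esub> u \<oplus>\<^bsub>H\<^esub> b \<odot>\<^bsub>H\<^esub> u"
    and smult_r_distr:
      "\<lbrakk>a \<in> carrier K; u \<in> carrier H; v \<in> carrier H\<rbrakk> \<Longrightarrow>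
        a \<odot>\<^bsub>H\<^esub> (u \<oplus>\<^bsub>H\<^esub> v) = a \<odot>\<^bsub>H\<^esub> u \<oplus>\<^bsub>H\<^esub> a \<odot>\<^bsub>H\<^esub> v"
    and smult_assoc:
      "\<lbrakk>a \<in> carrier K; b \<in> carrier K; u \<in> carrier H\<rbrakk> \<Longrightarrow>
        (a \<otimes>\<^bsub>K\<^esub> b) \<odot>\<^bsub>H\<^esub> u = a \<odot>\<^bsub>H\<^esub> (b \<odot>\<^bsub>H\<^esub> u)"
    and smult_one: "u \<in> carrier H \<Longrightarrow> \<one>\<^bsub>K\<^esub> \<odot>\<^bsub>H\<^esub> u = u"

definition lin_indep :: "'k ring \<Rightarrow> ('k, 'v) module \<Rightarrow> 'v set \<Rightarrow> bool"
  where "lin_indep K H B \<longleftrightarrow> B \<subseteq> carrier H \<and>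
    (\<forall>F c. finite F \<and> F \<subseteq> B \<and> c \<in> F \<rightarrow> carrier K \<and>
       finsum H (\<lambda>b. c b \<odot>\<^bsub>H\<^esub> b) F = \<zero>\<^bsub>H\<^esub> \<longrightarrow> (\<forall>b\<in>F. c b = \<zero>\<^bsub>K\<^esub>))"

definition dim_at_least :: "nat \<Rightarrow> 'k ring \<Rightarrow> ('k, 'v) module \<Rightarrow> bool"
  where "dim_at_least n K H \<longleftrightarrow> (\<exists>B. lin_indep K H B \<and> finite B \<and> card B = n)"

locale hermitian_space = star_sfield K star + left_linear_space K H
  for K :: "'k ring" (structure) and star :: "'k \<Rightarrow> 'k"
    and H :: "('k, 'v) module" (structure) +
  fixes form :: "'v \<Rightarrow> 'v \<Rightarrow> 'k"
  assumes dim_ge_3: "dim_at_least 3 K H"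
    and form_closed: "\<lbrakk>u \<in> carrier H; v \<in> carrier H\<rbrakk> \<Longrightarrow> form u v \<in> carrier K"
    and form_left:
      "\<lbrakk>a \<in> carrier K; b \<in> carrier K; u \<in> carrier H; v \<in> carrier H; w \<in> carrier H\<rbrakk> \<Longrightarrow>
        form (a \<odot>\<^bsub>H\<^esub> u \<oplus>\<^bsub>H\<^esub> b \<odot>\<^bsub>H\<^esub> v) w =
          a \<otimes>\<^bsub>K\<^esub> form u w \<oplus>\<^bsub>K\<^esub> b \<otimes>\<^bsub>K\<^esub> form v w"
    and form_right:
      "\<lbrakk>a \<in> carrier K; b \<in> carrier K; u \<in> carrier H; v \<in> carrier H; w \<in> carrier H\<rbrakk> \<Longrightarrow>
        form w (a \<odot>\<^bsub>H\<^esub> u \<oplus>\<^bsub>H\<^esub> b \<odot>\<^bsub>H\<^esub> v) =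
          form w u \<otimes>\<^bsub>K\<^esub> star a \<oplus>\<^bsub>K\<^esub> form w v \<otimes>\<^bsub>K\<^esub> star b"
    and form_hermitian: "\<lbrakk>u \<in> carrier H; v \<in> carrier H\<rbrakk> \<Longrightarrow> form u v = star (form v u)"
    and anisotropic: "\<lbrakk>u \<in> carrier H; form u u = \<zero>\<^bsub>K\<^esub>\<rbrakk> \<Longrightarrow> u = \<zero>\<^bsub>H\<^esub>"

definition perp :: "'k ring \<Rightarrow> ('k, 'v) module \<Rightarrow> ('v \<Rightarrow> 'v \<Rightarrow> 'k) \<Rightarrow> 'v set \<Rightarrow> 'v set"
  where "perp K H form E = {v \<in> carrier H. \<forall>u\<in>E. form v u = \<zero>\<^bsub>K\<^esub>}"

definition closed_subspaces :: "'k ring \<Rightarrow> ('k, 'v) module \<Rightarrow> ('v \<Rightarrow> 'v \<Rightarrow> 'k) \<Rightarrow> 'v set set"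
  where "closed_subspaces K H form =
    {E. submodule E K H \<and> perp K H form (perp K H form E) = E}"

text \<open>
  A map \<open>f\<close> from an ortholattice onto a family \<open>\<C>\<close> of sets that is an ortholattice with respect to
  inclusion and the orthocomplementation \<open>c\<close>. Joins, meets and bounds are determined by the
  order, so they are preserved as well.
\<close>

definition ortholattice_iso ::
    "('a::orthocomplemented_lattice \<Rightarrow> 'v set) \<Rightarrow> 'v set set \<Rightarrow> ('v set \<Rightarrow> 'v set) \<Rightarrow> bool"
  where "ortholattice_iso f \<C> c \<longleftrightarrow>
    bij_betw f UNIV \<C> \<and> (\<forall>x y. x \<le> y \<longleftrightarrow> f x \<subseteq> f y) \<and> (\<forall>x. f (- x) = c (f x))"

text \<open>
  Types cannot be quantified existentially, so an existence claim for a Hermitian space must name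
  the types of scalars and vectors. When the closed subspaces form a lattice \<open>'a\<close>, these can
  be \<open>'a\<close> and \<open>'a \<times> 'a\<close>, with arbitrary carriers inside them. Indeed, fix a vector \<open>e \<noteq> 0\<close>.
  For a vector \<open>v\<close> independent of \<open>e\<close>, \<open>a\<close> is mapped injectively to the atom spanned by
  \<open>e + a v\<close>. Every vector is uniquely \<open>u + a e\<close> with \<open>u\<close> orthogonal to \<open>e\<close>, and
  \<open>u\<close> is mapped injectively to the atom spanned by \<open>e + u\<close>.
\<close>

end

theory Submission
  imports Defs
begin

text \<open>
  The atoms of the lattice are the points of a projective space. Two lines of a plane meet because,
  by (H2), a line of a plane is the orthocomplement of a point relative to that plane; likewise
  \<open>- p\<close> is a hyperplane for every atom \<open>p\<close>. Fix an atom \<open>e\<close> and regard \<open>- e\<close> as the hyperplane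
  at infinity. By (H4) Desargues' theorem holds, so there are enough central collineations with axis
  \<open>- e\<close>: the translations make the affine points an abelian group \<open>V\<close> with origin \<open>e\<close>, and the
  homotheties with center \<open>e\<close>, together with zero, are the elements of a division ring \<open>K\<close> acting
  on \<open>V\<close>.

  For an affine point \<open>y \<noteq> e\<close>, the affine points of \<open>- y\<close> form a hyperplane that misses the
  origin, hence the set where a unique linear functional \<open>g _ y\<close> takes the value \<open>- 1\<close>. This
  normalization makes \<open>g\<close> additive in \<open>y\<close>, so \<open>g x (a y) = g x y * \<sigma> a\<close> for some \<open>\<sigma>\<close>; the symmetry
  of orthogonality then forces \<open>\<sigma>\<close> to be an involution and \<open>g\<close> to be Hermitian. On \<open>V \<times> K\<close> the form
  \<open>g x y + a * \<sigma> b\<close> induces the given orthogonality of atoms, and the lattice is determined by that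
  relation.
\<close>

text \<open>Desargues' theorem is proved for triangles that span a space with the center and is
  carried to a plane through an auxiliary point outside it.

  Working with affine points replaces coordinate calculations by composition: addition is
  composition of translations, multiplication is composition of additive maps, so the ring laws are
  nearly free. It also avoids extracting the antiautomorphism from a general duality by the
  fundamental theorem of projective geometry. With \<open>e = (0, 1)\<close> and
  \<open>(e, e) = 1\<close> the affine points are the vectors \<open>(x, 1)\<close>; two of them are
  orthogonal iff \<open>g x y + 1 = 0\<close>. This is the origin of the value \<open>- 1\<close>,
  and it leaves no freedom in \<open>g\<close>.

  Incidence arguments degenerate for collinear vectors. Identities are therefore proved for
  independent vectors first and reach the collinear case by way of a third vector off the
  line.\<close>

no_notation Lattice.join (infixl "\<squnion>\<index>" 65)
no_notation Lattice.meet (infixl "\<sqinter>\<index>" 70)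
notation sup (infixl "\<squnion>" 65)
notation inf (infixl "\<sqinter>" 70)

section \<open>The projective geometry of atoms\<close>

lemma atom_le_atom_eq: "\<lbrakk>atom p; atom q; p \<le> q\<rbrakk> \<Longrightarrow> p = q"
  unfolding atom_def covers_def by (metis order.strict_iff_order)

lemma atom_not_le_bot: "atom p \<Longrightarrow> \<not> p \<le> bot"
  unfolding atom_def covers_def by (simp add: less_le_not_le)

lemma orthogonal_sym: "(p::'a::orthocomplemented_lattice) \<le> - q \<Longrightarrow> q \<le> - p"
  by (rule compl_le_swap1)

lemma atom_not_le_compl: "atom (p::'a::orthocomplemented_lattice) \<Longrightarrow> \<not> p \<le> - p"
  by (metis atom_not_le_bot inf.absorb1 inf_compl_bot order_refl)

lemma finite_element_bot: "finite_element bot"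
  by (simp add: finite_element_def)

lemma finite_element_sup_atom:
  assumes "finite_element a" "atom p" shows "finite_element (a \<squnion> p)"
proof -
  obtain S where S: "finite S" "\<forall>q\<in>S. atom q" "a = Sup S"
    using assms(1) unfolding finite_element_def by (metis Sup_empty empty_iff finite.emptyI)
  then have "finite (insert p S)" "\<forall>q\<in>insert p S. atom q" "a \<squnion> p = Sup (insert p S)"
    using assms(2) by (auto simp: sup_commute)
  then show ?thesis unfolding finite_element_def by blast
qed

lemma finite_element_atom: "atom p \<Longrightarrow> finite_element p"
  using finite_element_sup_atom[OF finite_element_bot] by simp

lemma finite_chain_greatest:
  fixes C :: "'b::order set"
  assumes "Complete_Partial_Order.chain (\<le>) C" "finite C" "C \<noteq> {}"
  shows "\<exists>m\<in>C. \<forall>x\<in>C - {m}. x < m"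
proof -
  obtain m where "m \<in> C" "\<forall>b\<in>C. m \<le> b \<longrightarrow> m = b"
    using finite_has_maximal[OF assms(2,3)] by blast
  then show ?thesis
    using assms(1) unfolding chain_def by (metis Diff_iff antisym_conv2 insertCI)
qed

locale hilbert_lattice =
  fixes type_of_lattice :: "'a::complete_orthocomplemented_lattice itself"
  assumes atomistic: "atomistic TYPE('a)"
    and H1: "finite_covering_property TYPE('a)"
    and H2: "\<And>p q :: 'a. \<lbrakk>atom p; atom q; p \<noteq> q\<rbrakk> \<Longrightarrow>
        \<exists>r. atom r \<and> orthogonal r p \<and> sup p q = sup p r"
    and H3: "\<And>p q :: 'a. \<lbrakk>atom p; atom q; orthogonal p q\<rbrakk> \<Longrightarrow>
        \<exists>r. atom r \<and> r \<noteq> p \<and> r \<noteq> q \<and> r \<le> sup p q"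
    and H4: "height_at_least 4 TYPE('a)"
begin

lemma orthogonal_on_line:
  assumes "atom (p::'a)" "atom q" "p \<noteq> q"
  obtains r where "atom r" "r \<le> - p" "p \<squnion> q = p \<squnion> r"
  using H2[OF assms] unfolding orthogonal_def by blast

lemma le_if_atoms_le:
  assumes "\<And>p. \<lbrakk>atom p; p \<le> a\<rbrakk> \<Longrightarrow> p \<le> b" shows "(a::'a) \<le> b"
proof -
  obtain S where "\<forall>p\<in>S. atom p" "a = Sup S"
    using atomistic unfolding atomistic_def by blast
  then show ?thesis using assms by (metis Sup_least Sup_upper)
qed

lemma obtain_atom_not_le:
  assumes "\<not> (a::'a) \<le> b" obtains p where "atom p" "p \<le> a" "\<not> p \<le> b"
  using assms le_if_atoms_le by blast

section \<open>Exchange of atoms, lines in a plane, hyperplanes\<close>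

lemma exchange:
  assumes "finite_element (a::'a)" "atom p" "atom q" "q \<le> a \<squnion> p" "\<not> q \<le> a"
  shows "a \<squnion> q = a \<squnion> p"
proof -
  have "\<not> p \<le> a" using assms by (metis order.trans sup.absorb1 order_refl)
  then have c: "covers (a \<squnion> p) a"
    using H1 assms unfolding finite_covering_property_def by blast
  have "a < a \<squnion> q" "a \<squnion> q \<le> a \<squnion> p"
    using assms by (auto simp: less_le_not_le)
  then show ?thesis using c unfolding covers_def by (metis order.not_eq_order_implies_strict)
qed

lemma line_exchange:
  assumes "atom (p::'a)" "atom q" "atom r" "r \<le> p \<squnion> q" "r \<noteq> p"
  shows "p \<squnion> r = p \<squnion> q"
  using exchange[OF finite_element_atom] assms atom_le_atom_eq by blast

lemma plane_exchange:
  assumes "atom (p::'a)" "atom q" "atom r" "atom s" "s \<le> p \<squnion> q \<squnion> r" "\<not> s \<le> p \<squnion> q"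
  shows "p \<squnion> q \<squnion> s = p \<squnion> q \<squnion> r"
  using exchange[OF finite_element_sup_atom[OF finite_element_atom]] assms by blast

lemma line_eq:
  assumes "atom (p::'a)" "atom q" "atom r" "atom s" "r \<le> p \<squnion> q" "s \<le> p \<squnion> q" "r \<noteq> s"
  shows "r \<squnion> s = p \<squnion> q"
proof (cases "r = p")
  case True
  then show ?thesis using line_exchange[of p q s] assms by auto
next
  case False
  then have "p \<squnion> r = p \<squnion> q" using line_exchange assms by blast
  then show ?thesis using line_exchange[of r p s] assms by (metis sup_commute)
qed

text \<open>Gram-Schmidt with (H2): \<open>b\<close> and \<open>c\<close> are made orthogonal to
  \<open>a\<close> along lines through \<open>a\<close>, then \<open>r1\<close> is made orthogonal
  to \<open>b'\<close>. The result stays orthogonal to \<open>a\<close> because it lies on the line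
  \<open>b' \<squnion> r1\<close>.\<close>

lemma plane_orthogonal:
  assumes "atom (a::'a)" "atom b" "atom c" "a \<noteq> b" "\<not> c \<le> a \<squnion> b"
  obtains r where "atom r" "r \<le> - (a \<squnion> b)" "a \<squnion> b \<squnion> r = a \<squnion> b \<squnion> c"
proof -
  obtain b' where b': "atom b'" "b' \<le> - a" "a \<squnion> b = a \<squnion> b'"
    using orthogonal_on_line assms by blast
  have "a \<noteq> c" using assms by auto
  then obtain r1 where r1: "atom r1" "r1 \<le> - a" "a \<squnion> c = a \<squnion> r1"
    using orthogonal_on_line assms by blast
  have "b' \<noteq> r1" using assms b' r1 by (metis sup.cobounded2)
  then obtain r where r: "atom r" "r \<le> - b'" "b' \<squnion> r1 = b' \<squnion> r"
    using orthogonal_on_line b' r1 by blast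
  have "r \<le> - a" using r b' r1 by (metis le_sup_iff order_trans sup_ge2)
  then have "r \<le> - (a \<squnion> b)" using r b' by simp
  moreover have "a \<squnion> b \<squnion> r = a \<squnion> b \<squnion> c"
    using b' r1 r by (metis sup.assoc sup.commute)
  ultimately show thesis using that r by blast
qed

text \<open>If \<open>t\<close> were off the line, it would span the plane together with the line,
  and \<open>r\<close> would lie below a join of elements orthogonal to \<open>r\<close>.\<close>

lemma plane_inf_compl:
  assumes "atom (a::'a)" "atom b" "atom r" "r \<le> - (a \<squnion> b)"
    "t \<le> a \<squnion> b \<squnion> r" "t \<le> - r" "atom t"
  shows "t \<le> a \<squnion> b"
proof (rule ccontr)
  assume "\<not> t \<le> a \<squnion> b"
  then have "a \<squnion> b \<squnion> t = a \<squnion> b \<squnion> r" using plane_exchange assms by blast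
  moreover have "a \<squnion> b \<squnion> t \<le> - r" using assms orthogonal_sym by (metis le_sup_iff)
  ultimately show False using assms atom_not_le_compl by (metis le_sup_iff)
qed

text \<open>The Veblen-Young axiom. Within the common plane each line is the orthocomplement of a
  point, \<open>r\<close> and \<open>s\<close> respectively, so the intersection has to be a point
  orthogonal to both.\<close>

lemma coplanar_lines_meet:
  assumes A: "atom (a::'a)" "atom b" "atom c" "atom d"
    and "a \<noteq> b" "c \<noteq> d" "d \<le> a \<squnion> b \<squnion> c"
  obtains t where "atom t" "t \<le> a \<squnion> b" "t \<le> c \<squnion> d"
proof -
  \<comment> \<open>The main case needs \<open>a\<close> off the line \<open>c \<squnion> d\<close>.
    At least one of \<open>a\<close> and \<open>b\<close> is, so the claim is stated for variable
    \<open>a b\<close> and can be used with the two exchanged.\<close>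
  have aux: "\<exists>t. atom t \<and> t \<le> a \<squnion> b \<and> t \<le> c \<squnion> d"
    if A: "atom a" "atom b" and ab: "a \<noteq> b" and d: "d \<le> a \<squnion> b \<squnion> c" and n: "\<not> c \<le> a \<squnion> b" "\<not> d \<le> a \<squnion> b"
      and a: "\<not> a \<le> c \<squnion> d" for a b
  proof -
    note A = A assms(3,4)
    let ?P = "a \<squnion> b \<squnion> c"
    have "\<not> d \<le> a \<squnion> c"
      using a line_exchange[of c a d] A \<open>c \<noteq> d\<close> by (metis sup_commute sup_ge1)
    then have "a \<squnion> c \<squnion> d = a \<squnion> c \<squnion> b"
      using plane_exchange[of a c b d] A d by (metis sup.assoc sup.commute)
    then have P: "c \<squnion> d \<squnion> a = ?P" by (metis sup.assoc sup.commute)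
    obtain r where r: "atom r" "r \<le> - (a \<squnion> b)" "a \<squnion> b \<squnion> r = ?P"
      using plane_orthogonal[of a b c] A ab n by blast
    obtain s where s: "atom s" "s \<le> - (c \<squnion> d)" "c \<squnion> d \<squnion> s = ?P"
      using plane_orthogonal[of c d a] A \<open>c \<noteq> d\<close> a P by metis
    have "r \<noteq> s"
    proof
      assume "r = s"
      then have "c \<le> - r" using s(2) orthogonal_sym by (metis le_sup_iff)
      then have "c \<le> a \<squnion> b" using plane_inf_compl[of a b r c] A r by simp
      then show False using n by simp
    qed
    then obtain t where t: "atom t" "t \<le> - r" "r \<squnion> s = r \<squnion> t"
      using orthogonal_on_line r s by blast
    have "t \<le> ?P" using t r s by (metis le_sup_iff order_trans sup_ge2)
    then have tab: "t \<le> a \<squnion> b" using plane_inf_compl[of a b r t] A r t by simp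
    \<comment> \<open>(H2) needs a second point \<open>u\<close> of the line to produce
      \<open>t'\<close>, the point of \<open>a \<squnion> b\<close> orthogonal to \<open>t\<close>.
      Being orthogonal to \<open>r\<close> and \<open>t\<close>, it is orthogonal to
      \<open>s\<close> on their line, hence lies on \<open>c \<squnion> d\<close>.\<close>
    obtain u where u: "atom u" "u \<noteq> t" "u \<le> a \<squnion> b"
      using A ab by (metis sup_ge1 sup_ge2)
    obtain t' where t': "atom t'" "t' \<le> - t" "t \<squnion> u = t \<squnion> t'"
      using orthogonal_on_line t u by metis
    have t'ab: "t' \<le> a \<squnion> b"
      using t' tab u by (metis le_sup_iff order_trans sup_ge2)
    have "t' \<le> - (r \<squnion> t)"
      using t' t'ab orthogonal_sym[OF r(2)] by (simp add: order_trans[OF t'ab])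
    then have "t' \<le> - s" using t(3) by (metis compl_sup le_infE)
    moreover have "t' \<le> c \<squnion> d \<squnion> s" using s(3) t'ab by (metis le_supI1)
    ultimately have "t' \<le> c \<squnion> d" using plane_inf_compl[of c d s t'] A s t' by simp
    then show ?thesis using t' t'ab by blast
  qed
  show thesis
  proof (cases "c \<le> a \<squnion> b \<or> d \<le> a \<squnion> b")
    case True
    then show ?thesis using that A by (metis sup_ge1 sup_ge2)
  next
    case False
    have "\<not> a \<le> c \<squnion> d \<or> \<not> b \<le> c \<squnion> d"
      using line_eq[of c d a b] A \<open>a \<noteq> b\<close> False by (metis sup_ge1)
    then show ?thesis
      using aux[of a b] aux[of b a] A assms False that by (metis sup_commute)
  qed
qed

text \<open>For \<open>r\<close> off the line, \<open>p\<close> and \<open>q\<close> are projected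
  from \<open>r\<close> to points \<open>a\<close> and \<open>b\<close> of \<open>- r\<close>. The
  line \<open>a \<squnion> b\<close> lies in \<open>- r\<close> and in the plane of
  \<open>p\<close>, \<open>q\<close>, \<open>r\<close>, so it meets \<open>p \<squnion> q\<close>.
  For \<open>r\<close> on the line this is (H2).\<close>

lemma line_meets_compl:
  assumes A: "atom (p::'a)" "atom q" "atom r" and "p \<noteq> q"
  obtains t where "atom t" "t \<le> p \<squnion> q" "t \<le> - r"
proof (cases "r \<le> p \<squnion> q")
  case True
  obtain u where u: "atom u" "u \<noteq> r" "u \<le> p \<squnion> q" using A \<open>p \<noteq> q\<close> by (metis sup_ge1 sup_ge2)
  then obtain t where "atom t" "t \<le> - r" "r \<squnion> u = r \<squnion> t" using orthogonal_on_line A by metis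
  then show ?thesis using that u True by (metis le_sup_iff sup_ge2 order_trans)
next
  case False
  then obtain a where a: "atom a" "a \<le> - r" "r \<squnion> p = r \<squnion> a"
    using orthogonal_on_line[of r p] A by (metis sup_ge1)
  obtain b where b: "atom b" "b \<le> - r" "r \<squnion> q = r \<squnion> b"
    using orthogonal_on_line[of r q] A False by (metis sup_ge2)
  have "a \<noteq> b"
  proof
    assume "a = b"
    then have "q \<le> r \<squnion> p" using a b by (metis sup_ge2)
    moreover have "p \<le> r \<squnion> p" by simp
    ultimately have "p \<squnion> q = r \<squnion> p" using line_eq A \<open>p \<noteq> q\<close> by blast
    then show False using False by simp
  qed
  show ?thesis
  proof (cases "a = p")
    case True
    then show ?thesis using that A a by (metis sup_ge1)
  next
    case ap: False
    have "p \<squnion> a = p \<squnion> r" using line_exchange[of p r a] A a ap by (metis sup_commute sup_ge2)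
    then have "r \<le> p \<squnion> q \<squnion> a" by (metis sup.assoc sup.commute sup.coboundedI1 sup_ge2)
    then have "b \<le> p \<squnion> q \<squnion> a" using b by (metis le_sup_iff order_trans sup_ge1 sup_ge2)
    then obtain t where "atom t" "t \<le> p \<squnion> q" "t \<le> a \<squnion> b"
      using coplanar_lines_meet[of p q a b] A a b \<open>p \<noteq> q\<close> \<open>a \<noteq> b\<close> by metis
    then show ?thesis using that a b by (metis le_sup_iff order_trans)
  qed
qed

lemma third_atom:
  assumes "atom (p::'a)" "atom q" "p \<noteq> q"
  obtains r where "atom r" "r \<noteq> p" "r \<noteq> q" "r \<le> p \<squnion> q"
proof -
  obtain s where s: "atom s" "s \<le> - p" "p \<squnion> q = p \<squnion> s" using orthogonal_on_line assms by blast
  show thesis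
  proof (cases "s = q")
    case True
    then have "orthogonal p q" using s orthogonal_sym unfolding orthogonal_def by blast
    then show ?thesis using H3 that assms by metis
  next
    case False
    then show ?thesis using that s atom_not_le_compl assms by (metis sup_ge2)
  qed
qed

section \<open>Steinitz exchange and points outside a plane\<close>

lemma replace_one_of_two:
  assumes "finite_element (c::'a)" "atom p" "atom q" "atom a" "a \<le> c \<squnion> p \<squnion> q" "\<not> a \<le> c"
  shows "\<exists>u. atom u \<and> c \<squnion> a \<squnion> u = c \<squnion> p \<squnion> q"
proof (cases "a \<le> c \<squnion> p")
  case True
  then show ?thesis using exchange[of c p a] assms by auto
next
  case False
  then have "c \<squnion> p \<squnion> a = c \<squnion> p \<squnion> q" using exchange[of "c \<squnion> p" q a] assms finite_element_sup_atom by blast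
  then show ?thesis using assms by (metis sup.assoc sup.commute)
qed

lemma replace_one_of_three:
  assumes "atom (p::'a)" "atom q" "atom r" "atom a" "a \<le> p \<squnion> q \<squnion> r"
  shows "\<exists>u v. atom u \<and> atom v \<and> a \<squnion> u \<squnion> v = p \<squnion> q \<squnion> r"
proof (cases "a \<le> p \<squnion> q")
  case True
  then have "\<exists>u. atom u \<and> a \<squnion> u = p \<squnion> q"
    using replace_one_of_two[of bot p q a] assms atom_not_le_bot finite_element_bot by auto
  then show ?thesis using assms by (metis sup.assoc)
next
  case False
  then have "p \<squnion> q \<squnion> a = p \<squnion> q \<squnion> r" using plane_exchange assms by blast
  then show ?thesis using assms by (metis sup.assoc sup.commute)
qed

text \<open>A chain of five elements yields four atoms, none of them below the join of its
  predecessors. If all atoms were below \<open>?P\<close>, exchanging \<open>p\<close>,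
  \<open>q\<close>, \<open>r\<close> for the first three would leave no room for the fourth.\<close>

lemma obtain_atom_off_plane:
  assumes "atom (p::'a)" "atom q" "atom r"
  obtains s where "atom s" "\<not> s \<le> p \<squnion> q \<squnion> r"
proof -
  let ?P = "p \<squnion> q \<squnion> r"
  obtain C :: "'a set" where C: "Complete_Partial_Order.chain (\<le>) C" "infinite C \<or> 5 \<le> card C"
    using H4 unfolding height_at_least_def by auto
  \<comment> \<open>The chain may be infinite. Five of its elements are kept and sorted by removing
    the greatest one repeatedly.\<close>
  obtain D where D: "D \<subseteq> C" "finite D" "card D = 5"
    using C(2) obtain_subset_with_card_n[of 5 C] infinite_arbitrarily_large[of C 5] by metis
  have ch: "Complete_Partial_Order.chain (\<le>) E" if "E \<subseteq> D" for E
    using C(1) D(1) that unfolding chain_def by blast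
  have step: "\<exists>m. m \<in> E \<and> (\<forall>x\<in>E - {m}. x < m) \<and> E - {m} \<subseteq> D \<and> card (E - {m}) = n"
    if "E \<subseteq> D" "card E = Suc n" for E n
  proof -
    have "finite E" "E \<noteq> {}" using that D finite_subset by auto
    then show ?thesis using finite_chain_greatest[OF ch[OF that(1)]] that
      by (metis Diff_subset card_Diff_singleton diff_Suc_1 order_trans)
  qed
  obtain x4 where x4: "x4 \<in> D" "\<forall>x\<in>D - {x4}. x < x4" "D - {x4} \<subseteq> D" "card (D - {x4}) = 4"
    using step[of D 4] D by auto
  obtain x3 where x3: "x3 \<in> D - {x4}" "\<forall>x\<in>D - {x4} - {x3}. x < x3" "D - {x4} - {x3} \<subseteq> D"
    "card (D - {x4} - {x3}) = 3"
    using step[of "D - {x4}" 3] x4 by auto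
  obtain x2 where x2: "x2 \<in> D - {x4} - {x3}" "\<forall>x\<in>D - {x4} - {x3} - {x2}. x < x2"
    "D - {x4} - {x3} - {x2} \<subseteq> D" "card (D - {x4} - {x3} - {x2}) = 2"
    using step[of "D - {x4} - {x3}" 2] x3 by auto
  obtain x1 where x1: "x1 \<in> D - {x4} - {x3} - {x2}" "\<forall>x\<in>D - {x4} - {x3} - {x2} - {x1}. x < x1"
    "card (D - {x4} - {x3} - {x2} - {x1}) = 1"
    using step[of "D - {x4} - {x3} - {x2}" 1] x2 by auto
  obtain x0 where x0: "x0 \<in> D - {x4} - {x3} - {x2} - {x1}"
    using x1(3) by (metis card.empty ex_in_conv zero_neq_one)
  have lt: "x0 < x1" "x1 < x2" "x2 < x3" "x3 < x4" using x0 x1 x2 x3 x4 by blast+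
  obtain a1 where a1: "atom a1" "a1 \<le> x1" using obtain_atom_not_le[of x1 x0] lt by (metis leD)
  obtain a2 where a2: "atom a2" "a2 \<le> x2" "\<not> a2 \<le> x1" using obtain_atom_not_le[of x2 x1] lt by (metis leD)
  obtain a3 where a3: "atom a3" "a3 \<le> x3" "\<not> a3 \<le> x2" using obtain_atom_not_le[of x3 x2] lt by (metis leD)
  obtain a4 where a4: "atom a4" "\<not> a4 \<le> x3" using obtain_atom_not_le[of x4 x3] lt by (metis leD)
  have n2: "\<not> a2 \<le> a1" using a1 a2 by (meson order_trans)
  have n3: "\<not> a3 \<le> a1 \<squnion> a2" using a1 a2 a3 lt by (meson le_supI less_imp_le order_trans)
  have n4: "\<not> a4 \<le> a1 \<squnion> a2 \<squnion> a3" using a1 a2 a3 a4 lt by (meson le_supI less_imp_le order_trans)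
  show thesis
  proof (rule ccontr)
    assume "\<not> thesis"
    then have all: "atom s \<Longrightarrow> s \<le> ?P" for s using that by blast
    obtain u v where uv: "atom u" "atom v" "a1 \<squnion> u \<squnion> v = ?P"
      using replace_one_of_three[OF assms a1(1) all[OF a1(1)]] by blast
    obtain w where w: "atom w" "a1 \<squnion> a2 \<squnion> w = ?P"
      using replace_one_of_two[OF finite_element_atom[OF a1(1)] uv(1,2) a2(1)] all[OF a2(1)] n2 uv by auto
    have "a1 \<squnion> a2 \<squnion> a3 = ?P"
      using plane_exchange[OF a1(1) a2(1) w(1) a3(1)] all[OF a3(1)] w n3 by auto
    then show False using all[OF a4(1)] n4 by simp
  qed
qed

end

section \<open>Central collineations with axis \<open>- e\<close>\<close>

locale pointed_hilbert_lattice = hilbert_lattice type_of_lattice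
  for type_of_lattice :: "'a::complete_orthocomplemented_lattice itself" +
  fixes e :: 'a
  assumes atom_e: "atom e"
begin

text \<open>The hyperplane \<open>- e\<close> plays the role of the hyperplane at infinity, so that \<open>dir p q\<close> is
  the point at infinity of the line through \<open>p\<close> and \<open>q\<close>.\<close>

definition aff :: "'a \<Rightarrow> bool"
  where "aff p \<longleftrightarrow> atom p \<and> \<not> p \<le> - e"

definition dir :: "'a \<Rightarrow> 'a \<Rightarrow> 'a"
  where "dir p q = (p \<squnion> q) \<sqinter> - e"

lemma aff_atom: "aff p \<Longrightarrow> atom p"
  by (simp add: aff_def)

lemma aff_e: "aff e"
  using atom_e atom_not_le_compl by (auto simp: aff_def)

lemma dir_commute: "dir p q = dir q p"
  by (simp add: dir_def sup_commute)

lemma infinite_atom_unique: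
  assumes "atom p" "atom q" "aff r" "r \<le> p \<squnion> q"
    "atom d" "d \<le> p \<squnion> q" "d \<le> - e" "atom d'" "d' \<le> p \<squnion> q" "d' \<le> - e"
  shows "d = d'"
proof (rule ccontr)
  assume "d \<noteq> d'"
  then have "d \<squnion> d' = p \<squnion> q" using line_eq assms by blast
  then have "r \<le> - e" using assms by (metis le_sup_iff order_trans)
  then show False using assms by (simp add: aff_def)
qed

lemma dir_eqI:
  assumes "aff p" "atom q" "atom d" "d \<le> p \<squnion> q" "d \<le> - e"
  shows "dir p q = d"
proof (rule antisym)
  show "dir p q \<le> d"
  proof (rule le_if_atoms_le)
    fix t assume "atom t" "t \<le> dir p q"
    then show "t \<le> d"
      using infinite_atom_unique[of p q p t d] assms by (auto simp: dir_def aff_def)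
  qed
  show "d \<le> dir p q" using assms by (simp add: dir_def)
qed

lemma dir:
  assumes "aff p" "atom q" "p \<noteq> q"
  shows atom_dir: "atom (dir p q)" and dir_le: "dir p q \<le> p \<squnion> q" and dir_inf: "dir p q \<le> - e"
    and sup_dir: "p \<squnion> dir p q = p \<squnion> q"
proof -
  obtain t where t: "atom t" "t \<le> p \<squnion> q" "t \<le> - e"
    using line_meets_compl[of p q e] assms atom_e aff_atom by blast
  then have "dir p q = t" using dir_eqI assms by blast
  then show *: "atom (dir p q)" "dir p q \<le> p \<squnion> q" "dir p q \<le> - e" using t by auto
  then show "p \<squnion> dir p q = p \<squnion> q"
    using line_exchange[of p q] assms by (metis aff_def)
qed

lemma sup_dir': "\<lbrakk>aff p; aff q; p \<noteq> q\<rbrakk> \<Longrightarrow> q \<squnion> dir p q = p \<squnion> q"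
  using sup_dir[of q p] by (metis aff_atom dir_commute sup_commute)

lemma dir_eq_if_le:
  assumes "aff p" "aff q" "p \<noteq> q" "atom d" "d \<le> - e" "q \<le> p \<squnion> d"
  shows "dir p q = d"
proof -
  have "p \<noteq> d" using assms by (auto simp: aff_def)
  have "p \<squnion> q = p \<squnion> d" using line_exchange[of p d q] assms aff_atom by blast
  then show ?thesis using dir_eqI assms aff_atom by (metis sup_ge2)
qed

text \<open>An atom \<open>s\<close> off the plane may lie at infinity. It is then replaced by a
  third point of \<open>r \<squnion> s\<close>: on that line only \<open>s\<close> is at infinity
  and only \<open>r\<close> is in the plane.\<close>

lemma obtain_aff_off_plane:
  assumes "atom p" "atom q" "aff r"
  obtains s where "aff s" "\<not> s \<le> p \<squnion> q \<squnion> r"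
proof -
  obtain s where s: "atom s" "\<not> s \<le> p \<squnion> q \<squnion> r"
    using obtain_atom_off_plane assms aff_atom by blast
  show thesis
  proof (cases "s \<le> - e")
    case False
    then show ?thesis using that s aff_def by blast
  next
    case True
    have rs: "r \<noteq> s" using s by auto
    then obtain t where t: "atom t" "t \<noteq> r" "t \<noteq> s" "t \<le> r \<squnion> s"
      using third_atom assms s aff_atom by metis
    have "r \<squnion> t = r \<squnion> s" using line_exchange[of r s t] assms s t aff_atom by blast
    moreover have "s \<squnion> t = s \<squnion> r" using line_exchange[of s r t] assms s t aff_atom by (metis sup_commute)
    ultimately have "\<not> t \<le> - e" "\<not> t \<le> p \<squnion> q \<squnion> r"
      using assms s True by (metis aff_def le_sup_iff order_trans sup_ge2, metis le_sup_iff order_trans sup_ge2)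
    then show ?thesis using that t aff_def by blast
  qed
qed

text \<open>One step in the construction of a central collineation with center \<open>z\<close> and
  axis \<open>- e\<close>: once \<open>p\<close> goes to \<open>p'\<close>, the image of
  \<open>q\<close> lies on \<open>z \<squnion> q\<close> and on the parallel through
  \<open>p'\<close> to the line of \<open>p\<close> and \<open>q\<close>. Points \<open>q\<close> on
  \<open>z \<squnion> p\<close> are out of its reach. An affine center will give homotheties, a
  center at infinity translations.\<close>

definition persp :: "'a \<Rightarrow> 'a \<Rightarrow> 'a \<Rightarrow> 'a \<Rightarrow> 'a \<Rightarrow> bool"
  where "persp z p p' q q' \<longleftrightarrow> aff p \<and> aff p' \<and> aff q \<and> aff q' \<and>
    p \<noteq> z \<and> p' \<noteq> z \<and> q \<noteq> z \<and> q' \<noteq> z \<and>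
    p' \<le> z \<squnion> p \<and> q' \<le> z \<squnion> q \<and> \<not> q \<le> z \<squnion> p \<and> dir p q = dir p' q'"

section \<open>Desargues' theorem for triangles in perspective from \<open>z\<close>\<close>

context
  fixes z :: 'a
  assumes z: "atom z"
begin

lemma central_line_eq: "\<lbrakk>aff p; aff q; q \<noteq> z; q \<le> z \<squnion> p\<rbrakk> \<Longrightarrow> z \<squnion> q = z \<squnion> p"
  using line_exchange z aff_atom by blast

lemma persp_sym:
  assumes "persp z p p' q q'" shows "persp z q q' p p'"
proof -
  have "\<not> p \<le> z \<squnion> q" using assms central_line_eq[of q p] unfolding persp_def by auto
  then show ?thesis using assms unfolding persp_def by (metis dir_commute)
qed

lemma persp_neq: assumes "persp z p p' q q'" shows "p \<noteq> q" "p' \<noteq> q'"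
proof -
  show "p \<noteq> q" using assms unfolding persp_def by auto
  have "z \<squnion> p' = z \<squnion> p" "z \<squnion> q' = z \<squnion> q"
    using assms central_line_eq unfolding persp_def by blast+
  moreover have "\<not> q \<le> z \<squnion> p" using assms unfolding persp_def by auto
  ultimately show "p' \<noteq> q'" by (metis sup_ge2)
qed

lemma persp_refl:
  assumes "aff p" "aff q" "p \<noteq> z" "\<not> q \<le> z \<squnion> p" shows "persp z p p q q"
  using assms unfolding persp_def by auto

text \<open>The line \<open>z \<squnion> q\<close> and the parallel through \<open>p'\<close> are
  coplanar, so they meet in some \<open>q'\<close>. The rest excludes the degenerate positions:
  \<open>q'\<close> at infinity, at \<open>z\<close> or at \<open>p'\<close>.\<close>

lemma persp_exists:
  assumes "aff p" "aff p'" "aff q" "p \<noteq> z" "p' \<noteq> z" "p' \<le> z \<squnion> p" "\<not> q \<le> z \<squnion> p"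
  obtains q' where "persp z p p' q q'"
proof -
  note A = assms(1-3)[THEN aff_atom] z
  have pq: "p \<noteq> q" "q \<noteq> z" using assms by auto
  let ?d = "dir p q"
  have d: "atom ?d" "?d \<le> p \<squnion> q" "?d \<le> - e" "p \<squnion> ?d = p \<squnion> q" "q \<squnion> ?d = p \<squnion> q"
    using dir[OF assms(1) A(3) pq(1)] sup_dir' pq assms by auto
  have dp: "?d \<noteq> p" "?d \<noteq> q" "?d \<noteq> p'" using d assms by (auto simp: aff_def)
  have zp: "z \<squnion> p' = z \<squnion> p" using central_line_eq assms by blast
  have "?d \<le> z \<squnion> q \<squnion> p'"
    using d(2) zp by (metis le_sup_iff order_trans sup.assoc sup.commute sup_ge1 sup_ge2)
  then obtain q' where q': "atom q'" "q' \<le> z \<squnion> q" "q' \<le> p' \<squnion> ?d"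
    using coplanar_lines_meet[of z q p' ?d] A d pq dp by metis
  have ndzq: "\<not> ?d \<le> z \<squnion> q"
  proof
    assume "?d \<le> z \<squnion> q"
    then have "q \<squnion> ?d = q \<squnion> z" using line_exchange[of q z ?d] A d dp by (metis sup_commute)
    then have "p \<le> z \<squnion> q" using d by (metis sup_commute sup_ge1)
    then show False using central_line_eq[of q p] assms by auto
  qed
  have "\<not> q' \<le> - e"
    using infinite_atom_unique[of p' ?d p' q' ?d] A assms d q' ndzq by auto
  then have aq: "aff q'" using q' aff_def by blast
  have "q' \<noteq> z"
  proof
    assume "q' = z"
    then have "p' \<squnion> z = p' \<squnion> ?d" using line_exchange[of p' ?d z] A d q' assms by auto
    then have "?d \<le> z \<squnion> p" using zp by (metis sup_commute sup_ge2)
    then have "p \<squnion> ?d = p \<squnion> z" using line_exchange[of p z ?d] A d dp by (metis sup_commute)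
    then show False using d assms by (metis sup_commute sup_ge2)
  qed
  have "p' \<noteq> q'"
  proof
    assume "p' = q'"
    then have "z \<squnion> p = z \<squnion> q" using central_line_eq[of q q'] assms q' aq zp by auto
    then show False using assms by simp
  qed
  then have "dir p' q' = ?d" using dir_eq_if_le[of p' q' ?d] aq assms d q' by auto
  then have "persp z p p' q q'" using assms aq q' \<open>q' \<noteq> z\<close> pq by (simp add: persp_def)
  then show thesis by (rule that)
qed

text \<open>Two solutions would identify \<open>z \<squnion> q\<close> with the parallel through
  \<open>p'\<close>, which would put \<open>p'\<close> and hence \<open>p\<close> on the line
  \<open>z \<squnion> q\<close>.\<close>

lemma persp_unique:
  assumes "persp z p p' q q1" "persp z p p' q q2" shows "q1 = q2"
proof (rule ccontr)
  assume "q1 \<noteq> q2"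
  let ?d = "dir p q"
  have *: "aff p" "aff p'" "aff q" "aff q1" "aff q2" "p' \<noteq> z" "q1 \<le> z \<squnion> q" "q2 \<le> z \<squnion> q"
    "p' \<le> z \<squnion> p" "\<not> q \<le> z \<squnion> p" "dir p' q1 = ?d" "dir p' q2 = ?d" "p \<noteq> q"
    using assms persp_neq(1)[OF assms(1)] by (auto simp: persp_def)
  have "q1 \<le> p' \<squnion> ?d" "q2 \<le> p' \<squnion> ?d"
    using sup_dir[of p' q1] sup_dir[of p' q2] * persp_neq[OF assms(1)] persp_neq[OF assms(2)] aff_atom
    by (metis sup_ge2)+
  moreover have "atom ?d" using atom_dir * aff_atom by blast
  ultimately have "p' \<squnion> ?d = z \<squnion> q"
    using line_eq[of p' ?d q1 q2] line_eq[of z q q1 q2] * z aff_atom \<open>q1 \<noteq> q2\<close> by metis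
  then have "z \<squnion> p' = z \<squnion> q" using central_line_eq[of q p'] * by (metis sup_ge1)
  moreover have "z \<squnion> p' = z \<squnion> p" using central_line_eq * by blast
  ultimately show False using * by simp
qed

text \<open>The planes of the two triangles share the line at infinity
  \<open>?d1 \<squnion> ?d2\<close>. The sides through \<open>q\<close>, \<open>r\<close> and
  through \<open>q'\<close>, \<open>r'\<close> lie in the plane of \<open>z\<close>,
  \<open>q\<close>, \<open>r\<close> and therefore meet; their common point is in both planes, hence
  on that line.\<close>

lemma desargues_space:
  assumes pq: "persp z p p' q q'" and pr: "persp z p p' r r'" and r: "\<not> r \<le> z \<squnion> p \<squnion> q"
  shows "persp z q q' r r'"
proof -
  have F: "aff p" "aff p'" "aff q" "aff q'" "aff r" "aff r'" "p \<noteq> z" "p' \<noteq> z" "q \<noteq> z" "q' \<noteq> z"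
    "r \<noteq> z" "r' \<noteq> z" "p' \<le> z \<squnion> p" "q' \<le> z \<squnion> q" "r' \<le> z \<squnion> r" "\<not> q \<le> z \<squnion> p" "\<not> r \<le> z \<squnion> p"
    "dir p' q' = dir p q" "dir p' r' = dir p r"
    using pq pr unfolding persp_def by auto
  note A = F(1-6)[THEN aff_atom] z
  have N: "p \<noteq> q" "p' \<noteq> q'" "p \<noteq> r" "p' \<noteq> r'" using persp_neq pq pr by auto
  have rzq: "\<not> r \<le> z \<squnion> q" using r by (metis le_supI1 sup.assoc sup.commute)
  show ?thesis
  proof (cases "p = p'")
    case True
    have "q' = q" "r' = r"
      using persp_unique[of p p' q q' q] persp_unique[of p p' r r' r] pq pr True persp_refl F by auto
    then show ?thesis using persp_refl F rzq by auto
  next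
    case pp: False
    have qr': "q' \<noteq> r'" using central_line_eq[of q q'] central_line_eq[of r r'] F rzq by (metis sup_ge2)
    have qr: "q \<noteq> r" using rzq by auto
    have z_le: "z \<le> q \<squnion> q'" if "q \<noteq> q'"
      using line_eq[of z q q q'] A F that by (metis sup_ge1 sup_ge2)
    have "r' \<le> q \<squnion> r \<squnion> q'" if "q \<noteq> q'"
    proof -
      have "z \<squnion> r \<le> q \<squnion> r \<squnion> q'" using order_trans[OF z_le[OF that], of "q \<squnion> r \<squnion> q'"] by (simp add: le_supI1)
      then show ?thesis using F(15) by (rule order_trans[rotated])
    qed
    then obtain d where d: "atom d" "d \<le> q \<squnion> r" "d \<le> q' \<squnion> r'"
      using coplanar_lines_meet[of q r q' r'] A qr qr' by (cases "q = q'") (auto intro: that[of q])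
    let ?d1 = "dir p q" and ?d2 = "dir p r"
    have d1: "atom ?d1" "?d1 \<le> - e" "p \<squnion> ?d1 = p \<squnion> q" "p' \<squnion> ?d1 = p' \<squnion> q'"
      using dir[of p q] sup_dir[of p' q'] A F N by auto
    have d2: "atom ?d2" "?d2 \<le> - e" "p \<squnion> ?d2 = p \<squnion> r" "p' \<squnion> ?d2 = p' \<squnion> r'"
      using dir[of p r] sup_dir[of p' r'] A F N by auto
    have d12: "?d1 \<noteq> ?d2"
    proof
      assume "?d1 = ?d2"
      then have "r \<le> p \<squnion> q" using d1 d2 by (metis sup_ge2)
      then show False using r by (metis le_supI2 sup.assoc)
    qed
    have pl: "?d1 \<squnion> ?d2 \<squnion> p = p \<squnion> q \<squnion> r" "?d1 \<squnion> ?d2 \<squnion> p' = p' \<squnion> q' \<squnion> r'"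
      using d1 d2 by (metis sup.assoc sup.commute)+
    \<comment> \<open>Otherwise the two planes coincide. The plane then contains \<open>p\<close>
      and \<open>p'\<close>, hence \<open>z\<close>, and \<open>r\<close> falls into the plane of
      \<open>z\<close>, \<open>p\<close>, \<open>q\<close>.\<close>
    have "d \<le> ?d1 \<squnion> ?d2"
    proof (rule ccontr)
      assume n: "\<not> ?thesis"
      have "d \<le> ?d1 \<squnion> ?d2 \<squnion> p" "d \<le> ?d1 \<squnion> ?d2 \<squnion> p'"
        using pl d by (metis le_sup_iff order_trans sup.assoc sup.commute sup_ge1 sup_ge2)+
      then have "?d1 \<squnion> ?d2 \<squnion> p = ?d1 \<squnion> ?d2 \<squnion> p'"
        using plane_exchange[of ?d1 ?d2 _ d] A d d1 d2 n by metis
      then have "p' \<le> p \<squnion> q \<squnion> r" using pl by (metis sup_ge2)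
      moreover have "z \<le> p \<squnion> p'"
        using line_eq[of z p p p'] A F pp by (metis sup_ge1 sup_ge2)
      ultimately have z: "z \<le> p \<squnion> q \<squnion> r"
        by (metis le_sup_iff order_trans sup.assoc sup_ge1)
      have "\<not> z \<le> p \<squnion> q"
        using line_exchange[of p q z] A F N by (metis sup_commute sup_ge2)
      then have "p \<squnion> q \<squnion> z = p \<squnion> q \<squnion> r" using plane_exchange[of p q r z] A z by blast
      then show False using r by (metis sup.assoc sup.commute sup_ge2)
    qed
    then have "d \<le> - e" using d1 d2 by (meson le_supI order_trans)
    then have "dir q r = dir q' r'" using dir_eqI[of q r d] dir_eqI[of q' r' d] A F d by auto
    then show ?thesis using F rzq unfolding persp_def by auto
  qed
qed

text \<open>In the planar case a point \<open>s\<close> outside the plane and its image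
  \<open>s'\<close> are added. Three spatial instances, on \<open>p q s\<close>, on
  \<open>p r s\<close> and on \<open>s q r\<close>, then give the claim.\<close>

lemma desargues:
  assumes pq: "persp z p p' q q'" and pr: "persp z p p' r r'" and r: "\<not> r \<le> z \<squnion> q"
  shows "persp z q q' r r'"
proof (cases "r \<le> z \<squnion> p \<squnion> q")
  case False
  then show ?thesis using desargues_space pq pr by blast
next
  case True
  have F: "aff p" "aff p'" "aff q" "aff q'" "aff r" "aff r'" "p \<noteq> z" "p' \<noteq> z"
    "p' \<le> z \<squnion> p" "\<not> q \<le> z \<squnion> p" "\<not> r \<le> z \<squnion> p"
    using pq pr unfolding persp_def by auto
  note A = F(1-6)[THEN aff_atom] z
  obtain s where s: "aff s" "\<not> s \<le> z \<squnion> p \<squnion> q"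
    using obtain_aff_off_plane A F by metis
  then have "\<not> s \<le> z \<squnion> p" by (metis le_supI1)
  then obtain s' where ps: "persp z p p' s s'" using persp_exists F s by metis
  have qs: "persp z q q' s s'" using desargues_space[OF pq ps] s by blast
  have "z \<squnion> p \<squnion> r \<le> z \<squnion> p \<squnion> q" using True by (simp add: le_supI1)
  then have "\<not> s \<le> z \<squnion> p \<squnion> r" using s by (meson order_trans)
  then have rs: "persp z r r' s s'" using desargues_space[OF pr ps] by blast
  have "\<not> r \<le> z \<squnion> q \<squnion> s"
  proof
    assume "r \<le> z \<squnion> q \<squnion> s"
    then have "z \<squnion> q \<squnion> r = z \<squnion> q \<squnion> s"
      using plane_exchange[of z q s r] A s r aff_atom by blast
    then have "s \<le> z \<squnion> q \<squnion> r" by simp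
    moreover have "z \<squnion> q \<squnion> r \<le> z \<squnion> p \<squnion> q" using True by (simp add: le_supI1)
    ultimately show False using s by (meson order_trans)
  qed
  then have "\<not> r \<le> z \<squnion> s \<squnion> q" by (metis sup.assoc sup.commute)
  then show ?thesis using desargues_space[OF persp_sym[OF qs] persp_sym[OF rs]] by blast
qed

section \<open>Existence and uniqueness of central collineations\<close>

definition central :: "('a \<Rightarrow> 'a) \<Rightarrow> bool"
  where "central f \<longleftrightarrow> (aff z \<longrightarrow> f z = z) \<and>
    (\<forall>x. aff x \<and> x \<noteq> z \<longrightarrow> aff (f x) \<and> f x \<noteq> z \<and> f x \<le> z \<squnion> x) \<and>
    (\<forall>x y. aff x \<and> x \<noteq> z \<and> aff y \<and> \<not> y \<le> z \<squnion> x \<longrightarrow> persp z x (f x) y (f y))"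

text \<open>The pair \<open>p\<close>, \<open>p'\<close> does not determine images on the line
  \<open>z \<squnion> p\<close> by \<open>persp\<close>; there a second pair \<open>q\<close>,
  \<open>q'\<close> is used. The work lies in showing that the two halves fit together.\<close>

lemma central_exists:
  assumes p: "aff p" "aff p'" "p \<noteq> z" "p' \<noteq> z" "p' \<le> z \<squnion> p"
  obtains f where "central f" "f p = p'"
proof -
  obtain q where q: "aff q" "\<not> q \<le> z \<squnion> p"
    using obtain_aff_off_plane[of z z p] p z by auto
  obtain q' where pq: "persp z p p' q q'" using persp_exists p q by blast
  have qF: "aff q" "aff q'" "q \<noteq> z" "q' \<noteq> z" "q' \<le> z \<squnion> q" "\<not> p \<le> z \<squnion> q"
    using pq persp_sym[OF pq] unfolding persp_def by auto
  define f where "f x = (if x = z then z else if x \<le> z \<squnion> p then SOME y. persp z q q' x y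
    else SOME y. persp z p p' x y)" for x
  have off: "persp z p p' x (f x)" if "aff x" "\<not> x \<le> z \<squnion> p" for x
  proof -
    have "\<exists>y. persp z p p' x y" using persp_exists[OF p(1,2) that(1) p(3-5) that(2)] by blast
    moreover have "f x = (SOME y. persp z p p' x y)" using that by (auto simp: f_def)
    ultimately show ?thesis by (metis someI_ex)
  qed
  have on: "persp z q q' x (f x)" if x: "aff x" "x \<noteq> z" "x \<le> z \<squnion> p" for x
  proof -
    have "\<not> x \<le> z \<squnion> q"
      using central_line_eq[of p x] central_line_eq[of q x] p q x by auto
    then have "\<exists>y. persp z q q' x y" using persp_exists[of q q' x] qF x by blast
    moreover have "f x = (SOME y. persp z q q' x y)" using x by (auto simp: f_def)
    ultimately show ?thesis by (metis someI_ex)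
  qed
  \<comment> \<open>A point \<open>s\<close> outside the plane of \<open>z\<close>,
    \<open>p\<close>, \<open>q\<close> is within reach of both reference pairs and mediates between
    \<open>x\<close> and \<open>y\<close>.\<close>
  have mixed: "persp z x (f x) y (f y)"
    if x: "aff x" "x \<noteq> z" "x \<le> z \<squnion> p" and y: "aff y" "\<not> y \<le> z \<squnion> p" for x y
  proof -
    have xp: "z \<squnion> x = z \<squnion> p" using central_line_eq x p by blast
    have yz: "y \<noteq> z" using y by auto
    obtain s where s: "aff s" "\<not> s \<le> z \<squnion> p \<squnion> q" using obtain_aff_off_plane z p q aff_atom by metis
    then have sp: "\<not> s \<le> z \<squnion> p" and sq: "\<not> s \<le> z \<squnion> q"
      by (metis le_supI1, metis le_supI1 sup.assoc sup.commute)
    note ps = off[OF s(1) sp] and py = off[OF y] and qx = on[OF x]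
    have qs: "persp z q q' s (f s)" using desargues[OF pq ps sq] .
    have sx: "persp z s (f s) x (f x)"
    proof (rule desargues[OF qs qx])
      show "\<not> x \<le> z \<squnion> s" using central_line_eq[of s x] x s xp sp by auto
    qed
    show ?thesis
    proof (cases "y \<le> z \<squnion> s")
      \<comment> \<open>Here \<open>s\<close> is collinear with \<open>z\<close> and
        \<open>y\<close> and cannot mediate. But then \<open>y\<close> is off
        \<open>z \<squnion> q\<close>, so that \<open>q\<close> can.\<close>
      case True
      have "\<not> y \<le> z \<squnion> q"
        using central_line_eq[of s y] central_line_eq[of q y] True y yz s sq q by (metis sup_ge2)
      then have "persp z q q' y (f y)" using desargues[OF pq py] by blast
      then show ?thesis using desargues[of q q' x "f x" y "f y"] qx y xp by auto
    next
      case False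
      then have "persp z s (f s) y (f y)" using desargues[OF ps py] by blast
      then show ?thesis using desargues[OF sx] y xp by auto
    qed
  qed
  have "central f" unfolding central_def
  proof (intro conjI allI impI)
    show "f z = z" by (simp add: f_def)
    fix x
    show "aff (f x)" "f x \<noteq> z" "f x \<le> z \<squnion> x" if "aff x \<and> x \<noteq> z"
      using that on[of x] off[of x] unfolding persp_def by auto
    show "persp z x (f x) y (f y)" if "aff x \<and> x \<noteq> z \<and> aff y \<and> \<not> y \<le> z \<squnion> x" for y
    proof -
      have y: "y \<noteq> z" using that by auto
      consider "x \<le> z \<squnion> p" "y \<le> z \<squnion> p" | "x \<le> z \<squnion> p" "\<not> y \<le> z \<squnion> p" | "\<not> x \<le> z \<squnion> p" "y \<le> z \<squnion> p"
        | "\<not> x \<le> z \<squnion> p" "\<not> y \<le> z \<squnion> p" by blast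
      then show ?thesis
      proof cases
        case 1
        then show ?thesis using central_line_eq[of p x] that p by auto
      next
        case 2
        then show ?thesis using mixed that by blast
      next
        case 3
        then show ?thesis using mixed[of y x] persp_sym that y by blast
      next
        case 4
        then show ?thesis using desargues[OF off off] that by blast
      qed
    qed
  qed
  moreover have "f p = p'" using persp_unique[OF on[of p] persp_sym[OF pq]] p by auto
  ultimately show thesis using that by blast
qed

lemma centralD:
  assumes "central f" "aff x" "x \<noteq> z"
  shows central_aff: "aff (f x)" and central_neq: "f x \<noteq> z" and central_le: "f x \<le> z \<squnion> x"
  using assms unfolding central_def by auto

lemma central_persp:
  "\<lbrakk>central f; aff x; x \<noteq> z; aff y; \<not> y \<le> z \<squnion> x\<rbrakk> \<Longrightarrow> persp z x (f x) y (f y)"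
  unfolding central_def by blast

text \<open>The value at \<open>p\<close> forces the values off \<open>z \<squnion> p\<close> by
  \<open>persp_unique\<close>; one of those points, \<open>q\<close>, then forces the values on that
  line.\<close>

lemma central_unique:
  assumes f: "central f" and g: "central g" and p: "aff p" "p \<noteq> z" "f p = g p" and x: "aff x"
  shows "f x = g x"
proof (cases "x = z")
  case True
  then show ?thesis using f g x unfolding central_def by auto
next
  case xz: False
  have off: "f x = g x" if "aff p" "p \<noteq> z" "f p = g p" "aff x" "\<not> x \<le> z \<squnion> p" for p x
    using persp_unique[of p "f p" x "f x" "g x"] central_persp[OF f] central_persp[OF g] that by metis
  obtain q where q: "aff q" "\<not> q \<le> z \<squnion> p"
    using obtain_aff_off_plane[of z z p] p z by auto
  show ?thesis
  proof (cases "x \<le> z \<squnion> p")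
    case True
    then have "\<not> x \<le> z \<squnion> q"
      using central_line_eq[of p x] central_line_eq[of q x] p q x xz by auto
    moreover have "q \<noteq> z" using q by auto
    ultimately show ?thesis using off[of q x] off[of p q] p q x by auto
  next
    case False
    then show ?thesis using off p x by blast
  qed
qed

end

end

section \<open>The vector space of affine points\<close>

context pointed_hilbert_lattice
begin

section \<open>Dilatations and translations\<close>

lemma affine_meet_unique:
  assumes "aff a" "aff b" "atom d" "d \<le> - e" "atom d'" "d' \<le> - e" "d \<noteq> d'"
    and "atom x" "atom y" "x \<le> a \<squnion> d" "y \<le> a \<squnion> d" "x \<le> b \<squnion> d'" "y \<le> b \<squnion> d'"
  shows "x = y"
proof (rule ccontr)
  assume "x \<noteq> y"
  then have "a \<squnion> d = b \<squnion> d'" using line_eq[of a d x y] line_eq[of b d' x y] assms aff_atom by auto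
  then have "d = d'" using infinite_atom_unique[of a d a d d'] assms aff_atom by (metis sup_ge1 sup_ge2)
  then show False using assms by simp
qed

lemma dir_neq:
  assumes "aff a" "aff b" "aff x" "x \<noteq> a" "x \<noteq> b" "\<not> b \<le> a \<squnion> x"
  shows "dir a x \<noteq> dir b x"
proof
  assume "dir a x = dir b x"
  then have "a \<squnion> x = b \<squnion> x" using sup_dir'[of a x] sup_dir'[of b x] assms by metis
  then show False using assms by (metis sup_ge1)
qed

text \<open>These maps are described by directions and not by a center, because in this form they
  are visibly closed under composition.\<close>

definition dilatation :: "('a \<Rightarrow> 'a) \<Rightarrow> bool"
  where "dilatation f \<longleftrightarrow> (\<forall>x. aff x \<longrightarrow> aff (f x)) \<and>
    (\<forall>x y. aff x \<and> aff y \<and> x \<noteq> y \<longrightarrow> f x \<noteq> f y \<and> dir (f x) (f y) = dir x y)"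

definition translation :: "('a \<Rightarrow> 'a) \<Rightarrow> bool"
  where "translation f \<longleftrightarrow> dilatation f \<and>
    ((\<forall>x. aff x \<longrightarrow> f x = x) \<or> (\<forall>x. aff x \<longrightarrow> f x \<noteq> x))"

lemma dilatation_aff: "\<lbrakk>dilatation f; aff x\<rbrakk> \<Longrightarrow> aff (f x)"
  by (simp add: dilatation_def)

lemma dilatation_le:
  assumes "dilatation f" "aff a" "aff x" "a \<noteq> x" shows "f x \<le> f a \<squnion> dir a x"
  using sup_dir[of "f a" "f x"] assms unfolding dilatation_def by (metis aff_atom sup_ge2)

lemma dilatation_comp: "\<lbrakk>dilatation f; dilatation g\<rbrakk> \<Longrightarrow> dilatation (\<lambda>x. f (g x))"
  unfolding dilatation_def by auto

lemma dilatation_id: "dilatation (\<lambda>x. x)"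
  unfolding dilatation_def by auto

text \<open>For \<open>x\<close> off the line of \<open>a\<close> and \<open>b\<close>, the image is
  the intersection of the parallels through \<open>f a\<close> and \<open>f b\<close>. Points on the
  line are treated with a point \<open>c\<close> off it in place of \<open>b\<close>.\<close>

lemma dilatation_unique:
  assumes f: "dilatation f" and g: "dilatation g" and ab: "aff a" "aff b" "a \<noteq> b"
    and eq: "f a = g a" "f b = g b" and x: "aff x"
  shows "f x = g x"
proof -
  have off: "f x = g x"
    if ab: "aff a" "aff b" "a \<noteq> b" and eq: "f a = g a" "f b = g b" and x: "aff x" "\<not> x \<le> a \<squnion> b" for a b x
  proof -
    have N: "a \<noteq> x" "b \<noteq> x" using x by auto
    have "\<not> b \<le> a \<squnion> x" using line_exchange[of a x b] ab x aff_atom by (metis sup_ge2)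
    then have "dir a x \<noteq> dir b x" using dir_neq ab x N by blast
    moreover have "f x \<le> f a \<squnion> dir a x" "f x \<le> f b \<squnion> dir b x" "g x \<le> f a \<squnion> dir a x" "g x \<le> f b \<squnion> dir b x"
      using dilatation_le[OF f] dilatation_le[OF g] ab x N eq by metis+
    ultimately show ?thesis
      using affine_meet_unique[of "f a" "f b" "dir a x" "dir b x" "f x" "g x"]
        dir[of a x] dir[of b x] dilatation_aff[OF f] dilatation_aff[OF g] ab x N aff_atom by metis
  qed
  show ?thesis
  proof (cases "x \<le> a \<squnion> b")
    case False
    then show ?thesis using off assms by blast
  next
    case True
    obtain c where c: "aff c" "\<not> c \<le> a \<squnion> b" using obtain_aff_off_plane[of a a b] ab aff_atom by auto
    have fc: "f c = g c" using off[OF ab eq c] .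
    show ?thesis
    proof (cases "x = a")
      case True
      then show ?thesis using eq by simp
    next
      case False
      have "\<not> x \<le> a \<squnion> c"
        using line_exchange[of a b x] line_exchange[of a c x] True False ab c x aff_atom by (metis sup_ge2)
      moreover have "a \<noteq> c" using c by auto
      ultimately show ?thesis using off[of a c x] ab c x eq fc by blast
    qed
  qed
qed

lemma translation_dilatation: "translation f \<Longrightarrow> dilatation f"
  by (simp add: translation_def)

text \<open>The traces of \<open>x\<close> and \<open>y\<close> are coplanar. With different
  directions they would meet in an affine point \<open>t\<close>; then \<open>f t \<noteq> t\<close>
  would lie on both as well, so the traces would coincide.\<close>

lemma translation_dir:
  assumes f: "translation f" and x: "aff x" "f x \<noteq> x" and y: "aff y"
  shows "f y \<noteq> y" "dir y (f y) = dir x (f x)"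
proof -
  have nofix: "aff t \<Longrightarrow> f t \<noteq> t" for t using f x unfolding translation_def by blast
  then show "f y \<noteq> y" using y by blast
  note D = translation_dilatation[OF f]
  have fx: "aff (f x)" "aff (f y)" using D x y dilatation_aff by auto
  note A = x(1)[THEN aff_atom] y[THEN aff_atom] fx[THEN aff_atom]
  show "dir y (f y) = dir x (f x)"
  proof (rule ccontr)
    assume n: "dir y (f y) \<noteq> dir x (f x)"
    have "f y \<le> x \<squnion> f x \<squnion> y"
    proof -
      have "x \<noteq> y" using n by auto
      then have "f y \<le> f x \<squnion> dir x y" "dir x y \<le> x \<squnion> y" using dilatation_le[OF D x(1) y] dir_le x y A by auto
      then have "f y \<le> f x \<squnion> (x \<squnion> y)" by (meson order_trans sup_mono order_refl)
      then show ?thesis by (simp add: sup.assoc sup.left_commute)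
    qed
    then obtain t where t: "atom t" "t \<le> x \<squnion> f x" "t \<le> y \<squnion> f y"
      using coplanar_lines_meet[of x "f x" y "f y"] A nofix x y by metis
    have "aff t"
    proof (rule ccontr)
      assume "\<not> aff t"
      then have "t \<le> - e" using t by (simp add: aff_def)
      then show False using dir_eqI[of x "f x" t] dir_eqI[of y "f y" t] t x y fx A n by auto
    qed
    have tr: "f t \<le> x \<squnion> f x" if x: "aff x" "t \<le> x \<squnion> f x" for x
    proof (cases "t = x")
      case False
      then have "f t \<le> f x \<squnion> dir x t" "dir x t \<le> x \<squnion> t"
        using dilatation_le[OF D x(1) \<open>aff t\<close>] dir_le x t by auto
      moreover have "x \<squnion> t \<le> x \<squnion> f x" using x by simp
      ultimately show ?thesis by (meson le_sup_iff order_trans sup_ge2)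
    qed simp
    have "t \<noteq> f t" "atom (f t)" using nofix[OF \<open>aff t\<close>] dilatation_aff[OF D \<open>aff t\<close>] aff_atom by auto
    then have "x \<squnion> f x = y \<squnion> f y"
      using line_eq[of x "f x" t "f t"] line_eq[of y "f y" t "f t"] tr t x y A by metis
    then show False using n by (simp add: dir_def)
  qed
qed

lemma translation_le:
  assumes f: "translation f" and x: "aff x" "f x \<noteq> x" and y: "aff y"
  shows "f y \<le> y \<squnion> dir x (f x)"
  using sup_dir[of y "f y"] translation_dir[OF assms] y dilatation_aff[OF translation_dilatation[OF f]]
  by (metis aff_atom sup_ge2)

text \<open>For \<open>y\<close> off the trace of \<open>a\<close>, the image is the fourth vertex
  of the parallelogram on \<open>a\<close>, \<open>f a\<close>, \<open>y\<close>. Agreement at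
  \<open>a\<close> and \<open>y\<close> is enough for dilatations.\<close>

lemma translation_unique:
  assumes f: "translation f" and g: "translation g" and a: "aff a" "f a = g a" and x: "aff x"
  shows "f x = g x"
proof (cases "f a = a")
  case True
  then show ?thesis using assms unfolding translation_def by metis
next
  case False
  note D = translation_dilatation[OF f] translation_dilatation[OF g]
  have fa: "aff (f a)" using dilatation_aff D a by blast
  let ?z = "dir a (f a)"
  have z: "atom ?z" "?z \<le> - e" using dir[of a "f a"] a fa False aff_atom by auto
  obtain y where y: "aff y" "\<not> y \<le> a \<squnion> ?z"
    using obtain_aff_off_plane[of ?z ?z a] z a by (metis sup_commute sup_idem)
  then have N: "a \<noteq> y" by auto
  have dy: "atom (dir a y)" "dir a y \<le> - e" "a \<squnion> dir a y = a \<squnion> y" using dir[of a y] a y N aff_atom by auto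
  have "dir a y \<noteq> ?z" using dy y by (metis sup_ge2)
  moreover have "f y \<le> f a \<squnion> dir a y" "g y \<le> f a \<squnion> dir a y"
    using dilatation_le[OF D(1)] dilatation_le[OF D(2)] a y N by metis+
  moreover have "f y \<le> y \<squnion> ?z" "g y \<le> y \<squnion> ?z"
    using translation_le[OF f] translation_le[OF g] a y False by metis+
  ultimately have "f y = g y"
    using affine_meet_unique[of "f a" y "dir a y" ?z "f y" "g y"] fa y dy z dilatation_aff[OF D(1)]
      dilatation_aff[OF D(2)] aff_atom by blast
  then show ?thesis using dilatation_unique[OF D a(1) y(1) N] a x by blast
qed

text \<open>One fixed point \<open>a\<close> has to force the identity. If \<open>g\<close> moves
  \<open>a\<close> in direction \<open>?z\<close>, then \<open>f\<close> moves \<open>g a\<close>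
  back in the same direction, so the image of \<open>y\<close> stays on
  \<open>y \<squnion> ?z\<close>; it also stays on the line of \<open>a\<close> and
  \<open>y\<close>. Thus \<open>y\<close> is a second fixed point.\<close>

lemma translation_comp:
  assumes f: "translation f" and g: "translation g" shows "translation (\<lambda>x. f (g x))"
proof -
  note D = translation_dilatation[OF f] translation_dilatation[OF g]
  note DC = dilatation_comp[OF D]
  have "f (g x) = x" if a: "aff a" "f (g a) = a" and x: "aff x" for a x
  proof (cases "g a = a")
    case True
    then show ?thesis using assms a x unfolding translation_def by metis
  next
    case False
    have ga: "aff (g a)" using dilatation_aff D a by blast
    let ?z = "dir a (g a)"
    have z: "atom ?z" "?z \<le> - e" using dir[of a "g a"] a ga False aff_atom by auto
    obtain y where y: "aff y" "\<not> y \<le> a \<squnion> ?z"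
      using obtain_aff_off_plane[of ?z ?z a] z a by (metis sup_commute sup_idem)
    then have N: "a \<noteq> y" by auto
    have gy: "aff (g y)" "aff (f (g y))" using dilatation_aff D y by auto
    have dy: "atom (dir a y)" "dir a y \<le> - e" "a \<squnion> dir a y = a \<squnion> y" using dir[of a y] a y N aff_atom by auto
    have 1: "dir a y \<noteq> ?z" using dy y by (metis sup_ge2)
    have 2: "f (g y) \<le> a \<squnion> dir a y" using dilatation_le[OF DC a(1) y(1) N] a by simp
    have 3: "y \<le> a \<squnion> dir a y" using dy by simp
    have "f (g y) \<le> g y \<squnion> ?z"
      using translation_le[OF f ga _ gy(1)] a False by (metis dir_commute)
    moreover have "g y \<le> y \<squnion> ?z" using translation_le[OF g a(1) False y(1)] .
    ultimately have "f (g y) \<le> y \<squnion> ?z" by (meson le_sup_iff order_trans sup_ge2)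
    then have "f (g y) = y"
      using affine_meet_unique[of a y "dir a y" ?z "f (g y)" y] a gy y dy z 1 2 3 aff_atom by auto
    then show ?thesis using dilatation_unique[OF DC dilatation_id a(1) y(1) N] a x by auto
  qed
  then show ?thesis using DC unfolding translation_def by blast
qed

text \<open>\<open>central\<close> says nothing about pairs collinear with \<open>z\<close>. This
  recovers injectivity on such a line by comparison with a point \<open>s\<close> off it.\<close>

lemma persp_inj:
  assumes z: "atom z" and "persp z s s' x x'" "persp z s s' y x'" "y \<le> z \<squnion> x"
  shows "x = y"
proof (rule ccontr)
  assume "x \<noteq> y"
  have *: "aff s" "aff s'" "aff x" "aff y" "dir s x = dir s y" "\<not> x \<le> z \<squnion> s" "s \<noteq> z"
    using assms unfolding persp_def by auto
  have N: "s \<noteq> x" "s \<noteq> y" using persp_neq assms by blast+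
  let ?d = "dir s x"
  have "s \<squnion> ?d = s \<squnion> x" "s \<squnion> ?d = s \<squnion> y" "atom ?d"
    using sup_dir[of s x] sup_dir[of s y] atom_dir[of s x] * N aff_atom by auto
  then have "x \<le> s \<squnion> ?d" "y \<le> s \<squnion> ?d" "atom ?d" by (metis sup_ge2, metis sup_ge2, simp)
  then have "s \<squnion> ?d = z \<squnion> x"
    using line_eq[of s ?d x y] line_eq[of z x x y] * \<open>x \<noteq> y\<close> assms aff_atom by auto
  then have "s \<le> z \<squnion> x" by (metis sup_ge1)
  then show False using central_line_eq[OF z, of x s] * by auto
qed

text \<open>The translation is the central collineation whose center is the point at infinity of the
  line of \<open>a\<close> and \<open>b\<close>.\<close>

lemma translation_exists:
  assumes a: "aff a" and b: "aff b" obtains f where "translation f" "f a = b"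
proof (cases "a = b")
  case True
  have "translation (\<lambda>x. x)" unfolding translation_def using dilatation_id by auto
  then show ?thesis using that True by blast
next
  case False
  let ?z = "dir a b"
  have z: "atom ?z" "?z \<le> - e" "a \<squnion> ?z = a \<squnion> b" using dir[of a b] assms False aff_atom by auto
  have nz: "aff x \<Longrightarrow> x \<noteq> ?z" for x using z by (auto simp: aff_def)
  have "b \<le> ?z \<squnion> a" using z by (metis sup_commute sup_ge2)
  then obtain f where f: "central ?z f" "f a = b"
    using central_exists[OF z(1) a b] nz a b by metis
  note cD = centralD[OF z(1) f(1)]
  have "dilatation f" unfolding dilatation_def
  proof (intro conjI allI impI)
    fix x assume "aff x" then show "aff (f x)" using cD nz by blast
  next
    fix x y assume "aff x \<and> aff y \<and> x \<noteq> y"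
    then have xy: "aff x" "aff y" "x \<noteq> y" by auto
    have "f x \<noteq> f y \<and> dir (f x) (f y) = dir x y"
    proof (cases "y \<le> ?z \<squnion> x")
      case False
      then have "persp ?z x (f x) y (f y)" using central_persp[OF z(1) f(1)] xy nz by blast
      then show ?thesis using persp_neq[OF z(1)] unfolding persp_def by metis
    next
      case True
      obtain s where s: "aff s" "\<not> s \<le> ?z \<squnion> x"
        using obtain_aff_off_plane[of ?z ?z x] z xy by auto
      have zy: "?z \<squnion> y = ?z \<squnion> x" using central_line_eq[OF z(1)] xy nz True by blast
      have "persp ?z s (f s) x (f x)" "persp ?z s (f s) y (f y)"
        using persp_sym[OF z(1) central_persp[OF z(1) f(1), of x s]]
          persp_sym[OF z(1) central_persp[OF z(1) f(1), of y s]] xy nz s zy by auto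
      then have ne: "f x \<noteq> f y" using persp_inj[OF z(1), of s "f s" x "f x" y] True xy by auto
      have af: "aff (f x)" "aff (f y)" "f x \<le> ?z \<squnion> x" "f y \<le> ?z \<squnion> x"
        using cD[of x] cD[of y] xy nz zy by auto
      have "?z \<squnion> f x = ?z \<squnion> x" using central_line_eq[OF z(1)] af nz xy by blast
      then have "dir (f x) (f y) = ?z"
        using dir_eq_if_le[of "f x" "f y" ?z] af ne z by (metis sup_commute)
      moreover have "dir x y = ?z" using dir_eq_if_le[of x y ?z] xy z True by (metis sup_commute)
      ultimately show ?thesis using ne by simp
    qed
    then show "f x \<noteq> f y" "dir (f x) (f y) = dir x y" by auto
  qed
  \<comment> \<open>The identity is central with center \<open>?z\<close> too, so by
    \<open>central_unique\<close> a fixed point would make \<open>f\<close> the identity.\<close>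
  moreover have "f x \<noteq> x" if "aff x" for x
  proof
    assume "f x = x"
    have "central ?z (\<lambda>x. x)" unfolding central_def[OF z(1)] using persp_refl[OF z(1)] by auto
    then have "f a = a" using central_unique[OF z(1) f(1), of "\<lambda>x. x" x a] that a nz \<open>f x = x\<close> by auto
    then show False using f False by simp
  qed
  ultimately show ?thesis using that f unfolding translation_def by blast
qed

section \<open>Vector addition: \<open>tr x y\<close> is the sum \<open>x + y\<close> with origin
  \<open>e\<close>\<close>

definition tr :: "'a \<Rightarrow> 'a \<Rightarrow> 'a"
  where "tr x = (SOME f. translation f \<and> f e = x)"

lemma tr: assumes "aff x" shows translation_tr: "translation (tr x)" and tr_e: "tr x e = x"
proof -
  have "\<exists>f. translation f \<and> f e = x" using translation_exists[OF aff_e assms] by blast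
  then show "translation (tr x)" "tr x e = x" unfolding tr_def by (metis (mono_tags, lifting) someI_ex)+
qed

lemma tr_closed: "\<lbrakk>aff x; aff y\<rbrakk> \<Longrightarrow> aff (tr x y)"
  using tr dilatation_aff translation_dilatation by blast

lemma tr_assoc: "\<lbrakk>aff x; aff y; aff w\<rbrakk> \<Longrightarrow> tr (tr x y) w = tr x (tr y w)"
  using translation_unique[OF translation_tr translation_comp[OF translation_tr translation_tr] aff_e]
    tr_closed tr_e by simp

lemma tr_e_left: "aff x \<Longrightarrow> tr e x = x"
  using translation_tr[OF aff_e] tr_e[OF aff_e] aff_e unfolding translation_def by blast

text \<open>The inverse is \<open>f e\<close> for the translation \<open>f\<close> that takes
  \<open>x\<close> to \<open>e\<close>: the translation \<open>tr x\<close> after \<open>f\<close>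
  fixes \<open>x\<close>, so it is the identity.\<close>

lemma tr_right_inverse:
  assumes "aff x" obtains y where "aff y" "tr x y = e"
proof -
  obtain f where f: "translation f" "f x = e" using translation_exists[OF assms aff_e] by blast
  have "translation (\<lambda>y. tr x (f y))" using translation_comp translation_tr assms f by blast
  moreover have "tr x (f x) = x" using f tr_e assms by simp
  ultimately have "tr x (f e) = e" using assms aff_e unfolding translation_def by blast
  then show ?thesis using that f dilatation_aff translation_dilatation aff_e by blast
qed

lemma tr_right_cancel:
  assumes "aff x" "aff y" "aff w" "tr x w = tr y w" shows "x = y"
proof -
  obtain v where v: "aff v" "tr w v = e" using tr_right_inverse assms by blast
  have "tr (tr x w) v = x" "tr (tr y w) v = y"
    using tr_assoc[OF assms(1,3) v(1)] tr_assoc[OF assms(2,3) v(1)] v(2)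
      tr_e[OF assms(1)] tr_e[OF assms(2)] by metis+
  then show ?thesis using assms by metis
qed

lemma tr_neq: "\<lbrakk>aff x; x \<noteq> e; aff y\<rbrakk> \<Longrightarrow> tr x y \<noteq> y"
  using translation_tr[of x] tr_e[of x] aff_e unfolding translation_def by metis

lemma tr_le_left:
  assumes "aff x" "x \<noteq> e" "aff y" shows "tr x y \<le> y \<squnion> dir e x"
  using translation_le[OF translation_tr[OF assms(1)] aff_e] tr_e[OF assms(1)] assms by auto

lemma tr_le_right:
  assumes "aff x" "aff y" "y \<noteq> e" shows "tr x y \<le> x \<squnion> dir e y"
  using dilatation_le[OF translation_dilatation[OF translation_tr[OF assms(1)]] aff_e assms(2)]
    tr_e[OF assms(1)] assms by auto

lemma dir_e_neq:
  assumes "aff x" "x \<noteq> e" "aff y" "\<not> y \<le> e \<squnion> x" shows "dir e x \<noteq> dir e y" "y \<noteq> e"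
proof -
  show "y \<noteq> e" using assms by auto
  then show "dir e x \<noteq> dir e y"
    using sup_dir[OF aff_e aff_atom[of x]] sup_dir[OF aff_e aff_atom[of y]] assms by (metis sup_ge2)
qed

text \<open>Lines with distinct directions share at most one point, so the sum of independent
  vectors can be recognized by incidence alone.\<close>

lemma parallelogram:
  assumes x: "aff x" "x \<noteq> e" and y: "aff y" "\<not> y \<le> e \<squnion> x"
    and w: "aff w" "w \<le> y \<squnion> dir e x" "w \<le> x \<squnion> dir e y"
  shows "w = tr x y"
proof -
  note N = dir_e_neq[OF x y]
  show ?thesis
    using affine_meet_unique[of y x "dir e x" "dir e y" w "tr x y"] tr_le_left[OF x y(1)]
      tr_le_right[OF x(1) y(1) N(2)] dir[OF aff_e aff_atom[OF x(1)]] dir[OF aff_e aff_atom[OF y(1)]]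
      N x y w tr_closed aff_atom by metis
qed

lemma tr_off_line:
  assumes y: "aff y" "y \<noteq> e" and w: "aff w" "\<not> w \<le> e \<squnion> y"
  shows "\<not> tr y w \<le> e \<squnion> y"
proof
  assume *: "tr y w \<le> e \<squnion> y"
  let ?z = "dir e y"
  have z: "atom ?z" "?z \<le> - e" "e \<squnion> ?z = e \<squnion> y" using dir[OF aff_e aff_atom[OF y(1)]] y by auto
  have "aff (tr y w)" using tr_closed y w by blast
  then have N: "tr y w \<noteq> ?z" using z by (auto simp: aff_def)
  have "tr y w \<le> ?z \<squnion> w" using tr_le_left y w by (metis sup_commute)
  then have "?z \<squnion> tr y w = ?z \<squnion> w" using line_exchange[of ?z w] z N w tr_closed y aff_atom by blast
  moreover have "?z \<squnion> tr y w = ?z \<squnion> e"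
    using line_exchange[of ?z e "tr y w"] z N tr_closed y w aff_atom * atom_e by (metis sup_commute)
  ultimately show False using z w by (metis sup_commute sup_ge1)
qed

lemma tr_commute_off:
  assumes x: "aff x" "x \<noteq> e" and y: "aff y" "\<not> y \<le> e \<squnion> x" shows "tr x y = tr y x"
proof -
  have "y \<noteq> e" using y by auto
  then have "tr y x \<le> y \<squnion> dir e x" "tr y x \<le> x \<squnion> dir e y"
    using tr_le_left[of y x] tr_le_right[of y x] x y by auto
  then show ?thesis using parallelogram[OF x y, of "tr y x"] x y tr_closed by auto
qed

lemma obtain_aff_off_line:
  assumes "aff x" obtains w where "aff w" "\<not> w \<le> e \<squnion> x"
  using obtain_aff_off_plane[of e e x] atom_e assms by auto

lemma line_e_eq: "\<lbrakk>aff x; aff y; y \<noteq> e; y \<le> e \<squnion> x\<rbrakk> \<Longrightarrow> e \<squnion> y = e \<squnion> x"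
  using line_exchange[of e x y] atom_e aff_atom by blast

text \<open>On a common line the parallelogram degenerates. With \<open>w\<close> off the line,
  \<open>x + (y + w) = (y + w) + x = y + (w + x) = y + (x + w)\<close>, and \<open>w\<close> is
  cancelled.\<close>

lemma tr_commute:
  assumes x: "aff x" and y: "aff y" shows "tr x y = tr y x"
proof (cases "x = e \<or> y = e \<or> \<not> y \<le> e \<squnion> x")
  case True
  then show ?thesis using tr_commute_off[OF x _ y] tr_e[OF x] tr_e[OF y] tr_e_left[OF x] tr_e_left[OF y]
    by metis
next
  case False
  then have N: "x \<noteq> e" "y \<noteq> e" and yx: "e \<squnion> y = e \<squnion> x" using line_e_eq[OF x y] by blast+
  obtain w where w: "aff w" "\<not> w \<le> e \<squnion> x" using obtain_aff_off_line assms by blast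
  have "\<not> tr y w \<le> e \<squnion> x" using tr_off_line[of y w] y w N yx by simp
  then have "tr x (tr y w) = tr (tr y w) x" using tr_commute_off x y w N tr_closed by blast
  also have "\<dots> = tr y (tr x w)" using tr_assoc tr_commute_off[of x w] x y w N by auto
  finally have "tr (tr x y) w = tr (tr y x) w" using tr_assoc x y w by simp
  then show ?thesis using tr_right_cancel x y w tr_closed by blast
qed

end

section \<open>The scalars: uniqueness, operations, existence\<close>

context pointed_hilbert_lattice
begin

lemma tr_le_line:
  assumes "aff a" "aff b" "aff x" "a \<le> e \<squnion> x" "b \<le> e \<squnion> x" shows "tr a b \<le> e \<squnion> x"
proof (cases "a = e")
  case True
  then show ?thesis using assms tr_e_left by simp
next
  case False
  then have "e \<squnion> a = e \<squnion> x" using line_e_eq assms by blast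
  then have "dir e a \<le> e \<squnion> x" by (simp add: dir_def)
  then show ?thesis using tr_le_left[OF assms(1) False assms(2)] assms(5)
    by (meson le_sup_iff order_trans)
qed

text \<open>Following Artin, scalars are the additive maps that preserve every line through \<open>e\<close>.\<close>

definition scalar :: "('a \<Rightarrow> 'a) \<Rightarrow> bool"
  where "scalar \<alpha> \<longleftrightarrow> (\<forall>x. aff x \<longrightarrow> aff (\<alpha> x) \<and> \<alpha> x \<le> e \<squnion> x) \<and>
    (\<forall>x y. aff x \<and> aff y \<longrightarrow> \<alpha> (tr x y) = tr (\<alpha> x) (\<alpha> y))"

lemma scalarD:
  assumes "scalar \<alpha>" "aff x"
  shows scalar_aff: "aff (\<alpha> x)" and scalar_le: "\<alpha> x \<le> e \<squnion> x"
    and scalar_add: "aff y \<Longrightarrow> \<alpha> (tr x y) = tr (\<alpha> x) (\<alpha> y)"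
  using assms unfolding scalar_def by auto

lemma scalar_e: "scalar \<alpha> \<Longrightarrow> \<alpha> e = e"
  using scalar_le[OF _ aff_e] scalar_aff[OF _ aff_e] atom_le_atom_eq[OF _ atom_e] aff_atom by fastforce

text \<open>If \<open>\<alpha>\<close> kills \<open>v\<close> and \<open>x\<close> is off its line,
  then \<open>\<alpha> x = \<alpha> (v + x)\<close> lies on the lines from \<open>e\<close> through
  \<open>x\<close> and through \<open>v + x\<close>, which meet only in \<open>e\<close>. Points on
  the line of \<open>v\<close> are reached through a killed \<open>w\<close> off it.\<close>

lemma scalar_eq_e:
  assumes "scalar \<alpha>" "aff v" "v \<noteq> e" "\<alpha> v = e" "aff x"
  shows "\<alpha> x = e"
proof -
  have off: "\<alpha> x = e" if v: "aff v" "v \<noteq> e" "\<alpha> v = e" and x: "aff x" "\<not> x \<le> e \<squnion> v" for v x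
  proof (rule ccontr)
    assume n: "\<alpha> x \<noteq> e"
    have vx: "\<not> v \<le> e \<squnion> x" using line_e_eq[of x v] x v by auto
    have ax: "aff (\<alpha> x)" using scalar_aff assms x by blast
    have "\<alpha> (tr v x) = \<alpha> x" using scalar_add[OF assms(1) v(1) x(1)] v tr_e_left ax by simp
    then have "\<alpha> x \<le> e \<squnion> tr v x" "\<alpha> x \<le> e \<squnion> x"
      using scalar_le[OF assms(1)] tr_closed v x by metis+
    then have "e \<squnion> tr v x = e \<squnion> x" using line_e_eq[of _ "\<alpha> x"] n ax tr_closed v x by metis
    moreover have "\<not> tr v x \<le> e \<squnion> x"
      using tr_off_line[of x v] tr_commute[of v x] v x vx by (metis sup_ge1)
    ultimately show False by (metis sup_ge2)
  qed
  show ?thesis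
  proof (cases "x \<le> e \<squnion> v \<and> x \<noteq> e")
    case False
    then show ?thesis using off[of v x] assms scalar_e by auto
  next
    case True
    obtain w where w: "aff w" "\<not> w \<le> e \<squnion> v" using obtain_aff_off_line assms by blast
    have "\<not> x \<le> e \<squnion> w"
      using line_e_eq[of v x] line_e_eq[of w x] assms w True by (metis sup_ge2)
    moreover have "w \<noteq> e" using w by auto
    ultimately show ?thesis using off[of w x] off[of v w] assms w by blast
  qed
qed

lemma scalar_sum:
  assumes a: "scalar \<alpha>" and b: "scalar \<beta>" shows "scalar (\<lambda>x. tr (\<alpha> x) (\<beta> x))"
  unfolding scalar_def
proof (intro conjI allI impI)
  fix x assume x: "aff x"
  then show "aff (tr (\<alpha> x) (\<beta> x))" "tr (\<alpha> x) (\<beta> x) \<le> e \<squnion> x"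
    using scalarD[OF a x] scalarD[OF b x] tr_closed tr_le_line by auto
next
  fix x y assume "aff x \<and> aff y"
  then have xy: "aff x" "aff y" by auto
  note A = scalar_aff[OF a xy(1)] scalar_aff[OF a xy(2)] scalar_aff[OF b xy(1)] scalar_aff[OF b xy(2)]
  have "tr (\<alpha> (tr x y)) (\<beta> (tr x y)) = tr (tr (\<alpha> x) (\<alpha> y)) (tr (\<beta> x) (\<beta> y))"
    using scalar_add a b xy by simp
  also have "\<dots> = tr (\<alpha> x) (tr (tr (\<alpha> y) (\<beta> x)) (\<beta> y))" using tr_assoc A tr_closed by simp
  also have "\<dots> = tr (\<alpha> x) (tr (tr (\<beta> x) (\<alpha> y)) (\<beta> y))" using tr_commute[OF A(2,3)] by simp
  also have "\<dots> = tr (tr (\<alpha> x) (\<beta> x)) (tr (\<alpha> y) (\<beta> y))" using tr_assoc A tr_closed by simp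
  finally show "tr (\<alpha> (tr x y)) (\<beta> (tr x y)) = tr (tr (\<alpha> x) (\<beta> x)) (tr (\<alpha> y) (\<beta> y))" .
qed

definition neg :: "'a \<Rightarrow> 'a"
  where "neg x = (SOME y. aff y \<and> tr x y = e)"

lemma neg: assumes "aff x" shows neg_aff: "aff (neg x)" and tr_neg: "tr x (neg x) = e"
proof -
  have "\<exists>y. aff y \<and> tr x y = e" using tr_right_inverse assms by blast
  then show "aff (neg x)" "tr x (neg x) = e" unfolding neg_def by (metis (mono_tags, lifting) someI_ex)+
qed

lemma neg_unique: "\<lbrakk>aff x; aff y; tr x y = e\<rbrakk> \<Longrightarrow> y = neg x"
  using tr_right_cancel[of y "neg x" x] neg[of x] tr_commute[of x y] tr_commute[of x "neg x"] by simp

lemma scalar_neg: "scalar neg"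
  unfolding scalar_def
proof (intro conjI allI impI)
  fix x assume x: "aff x"
  show "aff (neg x)" using neg_aff x .
  show "neg x \<le> e \<squnion> x"
  proof (cases "x = e")
    case True
    have "e = neg e" using neg_unique[of e e] aff_e tr_e by simp
    then show ?thesis using True by simp
  next
    case False
    let ?z = "dir e x"
    have z: "atom ?z" "?z \<le> e \<squnion> x" "?z \<le> - e" using dir[OF aff_e aff_atom[OF x]] False by auto
    then have "?z \<noteq> e" using aff_e by (auto simp: aff_def)
    moreover have "e \<le> neg x \<squnion> ?z" using tr_le_left[OF x False neg_aff[OF x]] tr_neg x by simp
    ultimately have "?z \<squnion> e = ?z \<squnion> neg x"
      using line_exchange[of ?z "neg x" e] z atom_e neg_aff[OF x] aff_atom by (metis sup_commute)
    then have "neg x \<le> ?z \<squnion> e" by simp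
    then show ?thesis using z by (metis le_sup_iff order_trans sup_ge1)
  qed
next
  fix x y assume "aff x \<and> aff y"
  then have xy: "aff x" "aff y" by auto
  note A = xy neg_aff[OF xy(1)] neg_aff[OF xy(2)]
  have "tr (tr x y) (tr (neg x) (neg y)) = tr x (tr (tr y (neg x)) (neg y))"
    using tr_assoc A tr_closed by simp
  also have "\<dots> = tr x (tr (tr (neg x) y) (neg y))" using tr_commute[OF A(2,3)] by simp
  also have "\<dots> = tr (tr x (neg x)) (tr y (neg y))" using tr_assoc A tr_closed by simp
  also have "\<dots> = e" using tr_neg xy tr_e aff_e by simp
  finally show "neg (tr x y) = tr (neg x) (neg y)" using neg_unique A tr_closed by metis
qed

lemma scalar_comp:
  assumes a: "scalar \<alpha>" and b: "scalar \<beta>" shows "scalar (\<lambda>x. \<alpha> (\<beta> x))"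
  unfolding scalar_def
proof (intro conjI allI impI)
  fix x assume x: "aff x"
  note bx = scalarD[OF b x]
  show "aff (\<alpha> (\<beta> x))" using scalar_aff a bx by blast
  have "e \<squnion> \<beta> x \<le> e \<squnion> x" using bx by simp
  then show "\<alpha> (\<beta> x) \<le> e \<squnion> x" using scalar_le[OF a bx(1)] by (rule order_trans[rotated])
next
  fix x y assume "aff x \<and> aff y"
  then show "\<alpha> (\<beta> (tr x y)) = tr (\<alpha> (\<beta> x)) (\<alpha> (\<beta> y))"
    using scalar_add a b scalar_aff by simp
qed

lemma scalar_id: "scalar (\<lambda>x. x)"
  by (simp add: scalar_def)

lemma scalar_zero: "scalar (\<lambda>x. e)"
  using tr_e aff_e by (simp add: scalar_def)

text \<open>The difference of the two is a scalar that kills \<open>v\<close>.\<close>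

lemma scalar_unique:
  assumes a: "scalar \<alpha>" and b: "scalar \<beta>" and v: "aff v" "v \<noteq> e" "\<alpha> v = \<beta> v" and x: "aff x"
  shows "\<alpha> x = \<beta> x"
proof -
  let ?g = "\<lambda>x. tr (\<alpha> x) (neg (\<beta> x))"
  have g: "scalar ?g" using scalar_sum[OF a scalar_comp[OF scalar_neg b]] .
  have "?g v = e" using v tr_neg scalar_aff[OF b] by simp
  then have "?g x = e" using scalar_eq_e[OF g v(1,2)] x by blast
  then have "tr (neg (\<beta> x)) (\<alpha> x) = e" using tr_commute scalar_aff a b neg_aff x by metis
  moreover have "tr (neg (\<beta> x)) (\<beta> x) = e" using tr_commute tr_neg scalar_aff b neg_aff x by metis
  ultimately show ?thesis using neg_unique[of "neg (\<beta> x)"] scalar_aff a b neg_aff x by metis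
qed

text \<open>A central collineation preserves directions, so it maps the parallelogram on
  \<open>x\<close> and \<open>y\<close> to the one on their images.\<close>

lemma central_add_off:
  assumes d: "central e \<delta>" and x: "aff x" "x \<noteq> e" and y: "aff y" "\<not> y \<le> e \<squnion> x"
  shows "\<delta> (tr x y) = tr (\<delta> x) (\<delta> y)"
proof -
  have y_e: "y \<noteq> e" using y by auto
  have xy: "\<not> x \<le> e \<squnion> y" using line_e_eq[of y x] x y by auto
  note dx = centralD[OF atom_e d x] and dy = centralD[OF atom_e d y(1) y_e]
  have lx: "e \<squnion> \<delta> x = e \<squnion> x" and ly: "e \<squnion> \<delta> y = e \<squnion> y" using line_e_eq[OF x(1)] line_e_eq[OF y(1)] dx dy by blast+
  have le: "\<delta> (tr x y) \<le> \<delta> y \<squnion> dir e x" "aff (\<delta> (tr x y))"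
    if x: "aff x" "x \<noteq> e" and y: "aff y" "y \<noteq> e" and xy: "\<not> x \<le> e \<squnion> y" for x y
  proof -
    let ?w = "tr x y"
    have w: "aff ?w" "\<not> ?w \<le> e \<squnion> y"
      using tr_closed tr_off_line[of y x] tr_commute[of x y] x y xy by auto
    note pw = central_persp[OF atom_e d y w]
    have p: "dir y ?w = dir (\<delta> y) (\<delta> ?w)" "aff (\<delta> y)" "aff (\<delta> ?w)" "\<delta> y \<noteq> \<delta> ?w"
      using persp_neq(2)[OF atom_e pw] pw by (simp_all add: persp_def)
    have "dir y ?w = dir e x"
      using dir_eq_if_le[of y ?w "dir e x"] tr_le_left[OF x y(1)] dir[OF aff_e aff_atom[OF x(1)]]
        x y w tr_neq[OF x y(1)] by metis
    then show "\<delta> (tr x y) \<le> \<delta> y \<squnion> dir e x"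
      using sup_dir[of "\<delta> y" "\<delta> ?w"] p aff_atom by (metis sup_ge2)
    show "aff (\<delta> (tr x y))" using p by blast
  qed
  have "\<delta> (tr x y) \<le> \<delta> x \<squnion> dir e y" using le[of y x] x y y_e tr_commute[of x y] by simp
  moreover have "\<delta> (tr x y) \<le> \<delta> y \<squnion> dir e x" using le[of x y] x y y_e xy by simp
  moreover have "dir e (\<delta> x) = dir e x" "dir e (\<delta> y) = dir e y" using lx ly by (simp_all add: dir_def)
  moreover have "\<not> \<delta> y \<le> e \<squnion> \<delta> x"
    using lx ly line_e_eq[of x "\<delta> y"] dy x y by (metis sup_ge2)
  ultimately show ?thesis
    using parallelogram[of "\<delta> x" "\<delta> y" "\<delta> (tr x y)"] dx dy le(2)[of x y] x y y_e xy by auto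
qed

lemma central_scalar:
  assumes d: "central e \<delta>" shows "scalar \<delta>"
proof -
  have de: "\<delta> e = e" using d aff_e unfolding central_def[OF atom_e] by blast
  have D: "aff (\<delta> x)" "\<delta> x \<le> e \<squnion> x" if "aff x" for x
    using centralD[OF atom_e d that] de aff_e by (cases "x = e"; simp)+
  have "\<delta> (tr x y) = tr (\<delta> x) (\<delta> y)" if xy: "aff x" "aff y" for x y
  proof -
    have dx: "aff (\<delta> x)" "aff (\<delta> y)" using D xy by auto
    consider "x = e" | "y = e" | "x \<noteq> e" "\<not> y \<le> e \<squnion> x" | "x \<noteq> e" "y \<noteq> e" "y \<le> e \<squnion> x" by blast
    then show ?thesis
    proof cases
      case 1
      then show ?thesis using tr_e_left xy dx de by simp
    next
      case 2
      then show ?thesis using tr_e xy dx de by simp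
    next
      case 3
      then show ?thesis using central_add_off d xy by blast
    next
      case 4
      then have yx: "e \<squnion> y = e \<squnion> x" using line_e_eq xy by blast
      \<comment> \<open>For collinear \<open>x\<close> and \<open>y\<close> the equation is proved
        with \<open>w\<close> added on both sides, where the sums split into independent summands,
        and \<open>w\<close> is cancelled at the end.\<close>
      obtain w where w: "aff w" "\<not> w \<le> e \<squnion> x" using obtain_aff_off_line xy by blast
      have dw: "aff (\<delta> w)" using D w by blast
      have yw: "aff (tr y w)" "\<not> tr y w \<le> e \<squnion> x" using tr_off_line[of y w] xy w 4 yx tr_closed by auto
      have "tr (\<delta> (tr x y)) (\<delta> w) = \<delta> (tr (tr x y) w)"
      proof (cases "tr x y = e")
        case True
        then show ?thesis using de tr_e_left dw w by simp
      next
        case False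
        have "tr x y \<le> e \<squnion> x" using tr_le_line[of x y x] xy 4 by simp
        then have "e \<squnion> tr x y = e \<squnion> x" using line_e_eq[of x "tr x y"] False xy tr_closed by blast
        then show ?thesis using central_add_off[OF d tr_closed[OF xy] False w(1)] w by simp
      qed
      also have "\<dots> = \<delta> (tr x (tr y w))" using tr_assoc xy w by simp
      also have "\<dots> = tr (\<delta> x) (\<delta> (tr y w))" using central_add_off[OF d xy(1) 4(1) yw] .
      also have "\<dots> = tr (\<delta> x) (tr (\<delta> y) (\<delta> w))" using central_add_off[OF d xy(2) 4(2) w(1)] w yx by simp
      also have "\<dots> = tr (tr (\<delta> x) (\<delta> y)) (\<delta> w)" using tr_assoc dx dw by simp
      finally show ?thesis using tr_right_cancel[OF _ _ dw] D[OF tr_closed[OF xy]] tr_closed[OF dx] by blast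
    qed
  qed
  then show ?thesis using D unfolding scalar_def by blast
qed

lemma scalar_exists:
  assumes "aff v" "v \<noteq> e" "aff v'" "v' \<le> e \<squnion> v"
  obtains \<alpha> where "scalar \<alpha>" "\<alpha> v = v'"
proof (cases "v' = e")
  \<comment> \<open>No central collineation takes \<open>v\<close> to \<open>e\<close>; this value
    belongs to the zero scalar.\<close>
  case True
  then show ?thesis using that scalar_zero by blast
next
  case False
  then obtain \<delta> where "central e \<delta>" "\<delta> v = v'" using central_exists[OF atom_e] assms by metis
  then show ?thesis using that central_scalar by blast
qed

end

text \<open>A scalar is encoded by the image of \<open>i\<close>, so the scalars are the affine points of the line through
  \<open>e\<close> and \<open>i\<close>.\<close>

locale framed_hilbert_lattice = pointed_hilbert_lattice type_of_lattice e
  for type_of_lattice :: "'a::complete_orthocomplemented_lattice itself" and e :: 'a +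
  fixes i :: 'a
  assumes aff_i: "aff i" and i_neq_e: "i \<noteq> e"
begin

section \<open>The division ring \<open>K\<close> acting on \<open>V\<close>\<close>

definition scalars :: "'a set"
  where "scalars = {a. aff a \<and> a \<le> e \<squnion> i}"

text \<open>It has two roles: the product of \<open>K\<close> when both arguments are scalars, and
  the action on \<open>V\<close> for an arbitrary affine point. Both are composition of maps, seen
  through their values at \<open>i\<close>.\<close>

definition smul :: "'a \<Rightarrow> 'a \<Rightarrow> 'a"
  where "smul a = (SOME \<alpha>. scalar \<alpha> \<and> \<alpha> i = a)"

lemma smul: assumes "a \<in> scalars" shows scalar_smul: "scalar (smul a)" and smul_i: "smul a i = a"
proof -
  have "\<exists>\<alpha>. scalar \<alpha> \<and> \<alpha> i = a"
    using assms scalar_exists[OF aff_i i_neq_e] unfolding scalars_def by blast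
  then show "scalar (smul a)" "smul a i = a" unfolding smul_def by (metis (mono_tags, lifting) someI_ex)+
qed

lemma scalar_eq_smul:
  assumes "scalar \<alpha>" shows "\<alpha> i \<in> scalars" and "aff x \<Longrightarrow> smul (\<alpha> i) x = \<alpha> x"
proof -
  show s: "\<alpha> i \<in> scalars" using scalarD[OF assms aff_i] unfolding scalars_def by blast
  show "aff x \<Longrightarrow> smul (\<alpha> i) x = \<alpha> x"
    using scalar_unique[OF scalar_smul[OF s] assms aff_i i_neq_e smul_i[OF s]] .
qed

lemma scalars_aff: "a \<in> scalars \<Longrightarrow> aff a"
  by (simp add: scalars_def)

lemma i_scalars: "i \<in> scalars" and e_scalars: "e \<in> scalars"
  using aff_i aff_e by (auto simp: scalars_def)

lemma smul_aff: "\<lbrakk>a \<in> scalars; aff x\<rbrakk> \<Longrightarrow> aff (smul a x)"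
  using scalar_aff scalar_smul by blast

lemma smul_le: "\<lbrakk>a \<in> scalars; aff x\<rbrakk> \<Longrightarrow> smul a x \<le> e \<squnion> x"
  using scalar_le scalar_smul by blast

lemma tr_scalars: "\<lbrakk>a \<in> scalars; b \<in> scalars\<rbrakk> \<Longrightarrow> tr a b \<in> scalars"
  using tr_closed tr_le_line aff_i unfolding scalars_def by auto

lemma smul_scalars: assumes "a \<in> scalars" "b \<in> scalars" shows "smul a b \<in> scalars"
  using scalar_eq_smul(1)[OF scalar_comp[OF scalar_smul[OF assms(1)] scalar_smul[OF assms(2)]]]
    smul_i[OF assms(2)] by simp

lemma neg_scalars: "a \<in> scalars \<Longrightarrow> neg a \<in> scalars"
  using scalar_eq_smul(1)[OF scalar_comp[OF scalar_neg scalar_smul]] smul_i by force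

lemma smul_add_right:
  "\<lbrakk>a \<in> scalars; aff x; aff y\<rbrakk> \<Longrightarrow> smul a (tr x y) = tr (smul a x) (smul a y)"
  using scalar_add scalar_smul by blast

lemma smul_add_left:
  assumes "a \<in> scalars" "b \<in> scalars" "aff x"
  shows "smul (tr a b) x = tr (smul a x) (smul b x)"
  using scalar_eq_smul(2)[OF scalar_sum[OF scalar_smul[OF assms(1)] scalar_smul[OF assms(2)]] assms(3)]
    smul_i assms by simp

lemma smul_assoc:
  assumes "a \<in> scalars" "b \<in> scalars" "aff x"
  shows "smul (smul a b) x = smul a (smul b x)"
  using scalar_eq_smul(2)[OF scalar_comp[OF scalar_smul[OF assms(1)] scalar_smul[OF assms(2)]] assms(3)]
    smul_i assms by simp

lemma smul_i_left: "aff x \<Longrightarrow> smul i x = x"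
  using scalar_eq_smul(2)[OF scalar_id] by simp

lemma smul_e_left: "aff x \<Longrightarrow> smul e x = e"
  using scalar_eq_smul(2)[OF scalar_zero] by simp

lemma smul_e_right: "a \<in> scalars \<Longrightarrow> smul a e = e"
  using scalar_e scalar_smul by blast

lemma smul_transitive:
  assumes "aff x" "x \<noteq> e" "aff t" "t \<le> e \<squnion> x"
  obtains a where "a \<in> scalars" "smul a x = t"
proof -
  obtain \<alpha> where "scalar \<alpha>" "\<alpha> x = t" using scalar_exists assms by blast
  then show ?thesis using that scalar_eq_smul assms by metis
qed

text \<open>Transitivity on the line gives a left inverse \<open>b\<close>. From
  \<open>(a b) a = a\<close> the scalar \<open>a b\<close> agrees with the identity at
  \<open>a\<close>, hence everywhere.\<close>

lemma scalar_inverse: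
  assumes a: "a \<in> scalars" "a \<noteq> e"
  obtains b where "b \<in> scalars" "smul b a = i" "smul a b = i"
proof -
  have "e \<squnion> a = e \<squnion> i" using line_e_eq a aff_i by (auto simp: scalars_def)
  then have "i \<le> e \<squnion> a" by simp
  then obtain b where b: "b \<in> scalars" "smul b a = i"
    using smul_transitive[of a i] a aff_i scalars_aff by blast
  have ab: "smul a b \<in> scalars" using smul_scalars a b by blast
  have "smul (smul a b) a = a" using smul_assoc a b scalars_aff smul_i by simp
  then have "smul (smul a b) i = i"
    using scalar_unique[OF scalar_smul[OF ab] scalar_id, of a i] a scalars_aff aff_i by blast
  then show ?thesis using that b smul_i ab by simp
qed

lemma smul_eq_e: "\<lbrakk>a \<in> scalars; aff x; smul a x = e\<rbrakk> \<Longrightarrow> a = e \<or> x = e"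
  using scalar_eq_e[OF scalar_smul, of a x i] aff_i smul_i by auto

lemma dir_smul:
  assumes "a \<in> scalars" "a \<noteq> e" "aff x" "x \<noteq> e" shows "dir e (smul a x) = dir e x"
proof -
  have "smul a x \<noteq> e" using smul_eq_e assms by blast
  then have "e \<squnion> smul a x = e \<squnion> x" using line_e_eq[of x "smul a x"] smul_le smul_aff assms by blast
  then show ?thesis by (simp add: dir_def)
qed

definition K :: "'a ring"
  where "K = \<lparr>carrier = scalars, mult = smul, one = i, zero = e, add = tr\<rparr>"

definition V :: "('a, 'a) module"
  where "V = \<lparr>carrier = {x. aff x}, mult = smul, one = i, zero = e, add = tr, smult = smul\<rparr>"

lemma K_simps [simp]: "carrier K = scalars" "mult K = smul" "one K = i" "zero K = e" "add K = tr"
  by (simp_all add: K_def)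

lemma V_simps [simp]: "carrier V = {x. aff x}" "zero V = e" "add V = tr" "smult V = smul"
  by (simp_all add: V_def)

lemma abelian_group_K: "abelian_group K"
proof (rule abelian_groupI)
  fix x assume "x \<in> carrier K"
  then show "\<exists>y\<in>carrier K. y \<oplus>\<^bsub>K\<^esub> x = \<zero>\<^bsub>K\<^esub>"
    using neg_scalars[of x] tr_neg[of x] tr_commute[of x "neg x"] neg_aff[of x] scalars_aff by auto
qed (auto simp: tr_scalars e_scalars tr_assoc scalars_aff tr_e_left intro: tr_commute)

lemma ring_K: "ring K"
proof (rule ringI)
  show "abelian_group K" by (rule abelian_group_K)
  show "Group.monoid K"
    by (rule monoidI) (auto simp: smul_scalars i_scalars smul_assoc scalars_aff smul_i_left smul_i)
qed (auto simp: smul_add_left smul_add_right scalars_aff)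

lemma K_Units: "Units K = carrier K - {\<zero>\<^bsub>K\<^esub>}"
proof -
  have "a \<noteq> e" if "a \<in> Units K" for a
    using that i_neq_e smul_e_left scalars_aff by (auto simp: Units_def)
  moreover have "a \<in> Units K" if "a \<in> scalars" "a \<noteq> e" for a
    using scalar_inverse[OF that] that by (auto simp: Units_def)
  ultimately show ?thesis by (auto simp: Units_def)
qed

lemma abelian_group_V: "abelian_group V"
proof (rule abelian_groupI)
  fix x assume "x \<in> carrier V"
  then show "\<exists>y\<in>carrier V. y \<oplus>\<^bsub>V\<^esub> x = \<zero>\<^bsub>V\<^esub>"
    using tr_neg[of x] tr_commute[of x "neg x"] neg_aff[of x] by auto
qed (auto simp: tr_closed aff_e tr_assoc tr_e_left intro: tr_commute)

lemma left_linear_space_V: "left_linear_space K V"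
proof -
  interpret K: ring K by (rule ring_K)
  interpret V: abelian_group V by (rule abelian_group_V)
  show ?thesis
    by unfold_locales (auto simp: smul_aff smul_add_left smul_add_right smul_assoc smul_i_left)
qed

end

section \<open>Hermitian forms from affine orthogonality\<close>

context left_linear_space
begin

declare smult_closed [simp] smult_one [simp]

lemma smult_zero_left [simp]: "x \<in> carrier H \<Longrightarrow> \<zero>\<^bsub>K\<^esub> \<odot>\<^bsub>H\<^esub> x = \<zero>\<^bsub>H\<^esub>"
  using smult_l_distr[of "\<zero>\<^bsub>K\<^esub>" "\<zero>\<^bsub>K\<^esub>" x] H.add.l_cancel_one'[of "\<zero>\<^bsub>K\<^esub> \<odot>\<^bsub>H\<^esub> x" "\<zero>\<^bsub>K\<^esub> \<odot>\<^bsub>H\<^esub> x"] by simp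

lemma smult_zero_right [simp]: "a \<in> carrier K \<Longrightarrow> a \<odot>\<^bsub>H\<^esub> \<zero>\<^bsub>H\<^esub> = \<zero>\<^bsub>H\<^esub>"
  using smult_r_distr[of a "\<zero>\<^bsub>H\<^esub>" "\<zero>\<^bsub>H\<^esub>"] H.add.l_cancel_one'[of "a \<odot>\<^bsub>H\<^esub> \<zero>\<^bsub>H\<^esub>" "a \<odot>\<^bsub>H\<^esub> \<zero>\<^bsub>H\<^esub>"] by simp

lemma smult_minus_left: assumes "a \<in> carrier K" "x \<in> carrier H" shows "(\<ominus>\<^bsub>K\<^esub> a) \<odot>\<^bsub>H\<^esub> x = \<ominus>\<^bsub>H\<^esub> (a \<odot>\<^bsub>H\<^esub> x)"
proof -
  have "(\<ominus>\<^bsub>K\<^esub> a) \<odot>\<^bsub>H\<^esub> x \<oplus>\<^bsub>H\<^esub> a \<odot>\<^bsub>H\<^esub> x = \<zero>\<^bsub>H\<^esub>"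
    using smult_l_distr[of "\<ominus>\<^bsub>K\<^esub> a" a x] assms K.l_neg by simp
  then show ?thesis using assms H.minus_equality[of "(\<ominus>\<^bsub>K\<^esub> a) \<odot>\<^bsub>H\<^esub> x" "a \<odot>\<^bsub>H\<^esub> x"] by simp
qed

end

text \<open>Think of \<open>x\<close> in \<open>V\<close> as the vector \<open>(x, 1)\<close> of \<open>V \<times> K\<close>. Then \<open>orth x y\<close> stands for the
  orthogonality of \<open>(x, 1)\<close> and \<open>(y, 1)\<close>, and \<open>dorth x y\<close> for that of \<open>(x, 0)\<close> and \<open>(y, 1)\<close>.\<close>

locale affine_polarity = left_linear_space K V
  for K :: "'k ring" (structure) and V :: "('k, 'v) module" (structure) +
  fixes orth dorth :: "'v \<Rightarrow> 'v \<Rightarrow> bool"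
  assumes one_not_zero: "\<one>\<^bsub>K\<^esub> \<noteq> \<zero>\<^bsub>K\<^esub>"
    and Units_K: "Units K = carrier K - {\<zero>\<^bsub>K\<^esub>}"
    and orth_sym: "\<lbrakk>x \<in> carrier V; y \<in> carrier V; orth x y\<rbrakk> \<Longrightarrow> orth y x"
    and dorth_sym: "\<lbrakk>x \<in> carrier V; y \<in> carrier V; dorth x y\<rbrakk> \<Longrightarrow> dorth y x"
    and not_orth_self: "x \<in> carrier V \<Longrightarrow> \<not> orth x x"
    and not_orth_zero: "y \<in> carrier V \<Longrightarrow> \<not> orth \<zero>\<^bsub>V\<^esub> y"
    and dorth_zero: "x \<in> carrier V \<Longrightarrow> dorth x \<zero>\<^bsub>V\<^esub>"
    and not_dorth_self: "\<lbrakk>x \<in> carrier V; x \<noteq> \<zero>\<^bsub>V\<^esub>\<rbrakk> \<Longrightarrow> \<not> dorth x x"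
    and orth_shift: "\<lbrakk>z \<in> carrier V; w \<in> carrier V; y \<in> carrier V; orth z y\<rbrakk> \<Longrightarrow>
      orth (z \<oplus>\<^bsub>V\<^esub> w) y \<longleftrightarrow> dorth w y"
    and dorth_smult: "\<lbrakk>a \<in> carrier K; w \<in> carrier V; y \<in> carrier V; dorth w y\<rbrakk> \<Longrightarrow>
      dorth (a \<odot>\<^bsub>V\<^esub> w) y"
    and orth_smult_exists: "\<lbrakk>x \<in> carrier V; y \<in> carrier V; \<not> dorth x y\<rbrakk> \<Longrightarrow>
      \<exists>a\<in>carrier K. orth (a \<odot>\<^bsub>V\<^esub> x) y"
    and separate: "\<lbrakk>y \<in> carrier V; y' \<in> carrier V; y' \<noteq> \<zero>\<^bsub>V\<^esub>; \<forall>a\<in>carrier K. y \<noteq> a \<odot>\<^bsub>V\<^esub> y'\<rbrakk> \<Longrightarrow>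
      \<exists>x\<in>carrier V. orth x y \<and> dorth x y'"
    and off_line_exists: "y \<in> carrier V \<Longrightarrow> \<exists>w\<in>carrier V. \<forall>a\<in>carrier K. w \<noteq> a \<odot>\<^bsub>V\<^esub> y"
begin

abbreviation vadd (infixl "+\<^sub>v" 65) where "x +\<^sub>v y \<equiv> x \<oplus>\<^bsub>V\<^esub> y"
abbreviation vmul (infixr "\<cdot>" 75) where "a \<cdot> x \<equiv> a \<odot>\<^bsub>V\<^esub> x"
abbreviation VC where "VC \<equiv> carrier V"
abbreviation KC where "KC \<equiv> carrier K"
abbreviation vzero ("0\<^sub>v") where "0\<^sub>v \<equiv> \<zero>\<^bsub>V\<^esub>"

section \<open>Linear functionals from affine hyperplanes\<close>

lemma inverse_K:
  assumes "a \<in> KC" "a \<noteq> \<zero>\<^bsub>K\<^esub>" obtains b where "b \<in> KC" "b \<otimes>\<^bsub>K\<^esub> a = \<one>\<^bsub>K\<^esub>" "a \<otimes>\<^bsub>K\<^esub> b = \<one>\<^bsub>K\<^esub>"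
proof -
  have "a \<in> Units K" using assms Units_K by blast
  then show ?thesis using that unfolding Units_def by blast
qed

lemma orth_exists: assumes "y \<in> VC" "y \<noteq> 0\<^sub>v" obtains z where "z \<in> VC" "orth z y"
proof -
  obtain a where "a \<in> KC" "orth (a \<cdot> y) y"
    using orth_smult_exists[of y y] not_dorth_self[of y] assms by blast
  then show thesis using that[of "a \<cdot> y"] assms by simp
qed

text \<open>For a point \<open>z\<close> on the hyperplane of \<open>y\<close>,
  \<open>dorth w y\<close> means that shifting \<open>z\<close> by \<open>w\<close> does not leave
  the hyperplane, so a sum is two shifts in a row. For \<open>y = 0\<close> there is no such
  \<open>z\<close>.\<close>

lemma dorth_add:
  assumes "w \<in> VC" "w' \<in> VC" "y \<in> VC" "dorth w y" "dorth w' y" shows "dorth (w +\<^sub>v w') y"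
proof (cases "y = 0\<^sub>v")
  case True
  then show ?thesis using dorth_zero assms by simp
next
  case False
  then obtain z where z: "z \<in> VC" "orth z y" using orth_exists assms by blast
  have "orth (z +\<^sub>v w) y" using orth_shift z assms by blast
  then have "orth (z +\<^sub>v w +\<^sub>v w') y" using orth_shift z assms by simp
  then have "orth (z +\<^sub>v (w +\<^sub>v w')) y" using H.a_assoc z assms by simp
  then show ?thesis using orth_shift[of z "w +\<^sub>v w'" y] z assms by simp
qed

lemma orth_not_dorth: assumes "z \<in> VC" "y \<in> VC" "orth z y" shows "\<not> dorth z y"
proof
  assume "dorth z y"
  then have "dorth ((\<ominus>\<^bsub>K\<^esub> \<one>\<^bsub>K\<^esub>) \<cdot> z) y" using dorth_smult assms by simp
  then have "orth (z +\<^sub>v (\<ominus>\<^bsub>K\<^esub> \<one>\<^bsub>K\<^esub>) \<cdot> z) y" using orth_shift assms by simp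
  then have "orth 0\<^sub>v y" using assms smult_minus_left by (simp add: H.r_neg)
  then show False using not_orth_zero assms by blast
qed

text \<open>If \<open>x\<close> is not already a direction of the hyperplane of \<open>y\<close>,
  some multiple \<open>c x\<close> lies on the hyperplane. Then \<open>c x - z\<close> is a
  direction, and division by \<open>c\<close> gives the coefficient.\<close>

lemma coefficient_exists:
  assumes x: "x \<in> VC" and y: "y \<in> VC" and z: "z \<in> VC" "orth z y"
  shows "\<exists>a\<in>KC. dorth (x +\<^sub>v a \<cdot> z) y"
proof (cases "dorth x y")
  case True
  then show ?thesis using assms by (intro bexI[of _ "\<zero>\<^bsub>K\<^esub>"]) auto
next
  case False
  then obtain c where c: "c \<in> KC" "orth (c \<cdot> x) y" using orth_smult_exists assms by blast
  have "c \<noteq> \<zero>\<^bsub>K\<^esub>" using c not_orth_zero x y by auto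
  then obtain b where b: "b \<in> KC" "b \<otimes>\<^bsub>K\<^esub> c = \<one>\<^bsub>K\<^esub>" using inverse_K c by blast
  let ?w = "c \<cdot> x +\<^sub>v \<ominus>\<^bsub>V\<^esub> z"
  have "z +\<^sub>v ?w = c \<cdot> x" using H.a_lcomm[of z "c \<cdot> x" "\<ominus>\<^bsub>V\<^esub> z"] c x z by (simp add: H.r_neg)
  then have "dorth ?w y" using orth_shift[of z ?w y] c z x y by simp
  then have "dorth (b \<cdot> ?w) y" using dorth_smult b c x z y by simp
  moreover have "b \<cdot> ?w = x +\<^sub>v (\<ominus>\<^bsub>K\<^esub> b) \<cdot> z"
  proof -
    have "\<ominus>\<^bsub>V\<^esub> z = (\<ominus>\<^bsub>K\<^esub> \<one>\<^bsub>K\<^esub>) \<cdot> z" using smult_minus_left z by simp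
    then have "b \<cdot> ?w = (b \<otimes>\<^bsub>K\<^esub> c) \<cdot> x +\<^sub>v (b \<otimes>\<^bsub>K\<^esub> (\<ominus>\<^bsub>K\<^esub> \<one>\<^bsub>K\<^esub>)) \<cdot> z"
      using b(1) c x z by (simp add: smult_r_distr smult_assoc)
    then show ?thesis using b x by (simp add: K.r_minus)
  qed
  ultimately show ?thesis using b by (intro bexI[of _ "\<ominus>\<^bsub>K\<^esub> b"]) auto
qed

text \<open>Otherwise \<open>(a - b) z\<close> would be a direction of the hyperplane and so would
  \<open>z\<close>, against \<open>orth_not_dorth\<close>.\<close>

lemma coefficient_unique:
  assumes x: "x \<in> VC" and y: "y \<in> VC" and z: "z \<in> VC" "orth z y"
    and a: "a \<in> KC" "dorth (x +\<^sub>v a \<cdot> z) y" and b: "b \<in> KC" "dorth (x +\<^sub>v b \<cdot> z) y"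
  shows "a = b"
proof (rule ccontr)
  assume ab: "a \<noteq> b"
  let ?c = "a \<oplus>\<^bsub>K\<^esub> \<ominus>\<^bsub>K\<^esub> b"
  have c: "?c \<in> KC" "?c \<noteq> \<zero>\<^bsub>K\<^esub>" using a b ab K.minus_equality[of a "\<ominus>\<^bsub>K\<^esub> b"] by auto
  then obtain d where d: "d \<in> KC" "d \<otimes>\<^bsub>K\<^esub> ?c = \<one>\<^bsub>K\<^esub>" using inverse_K by blast
  have "dorth ((x +\<^sub>v a \<cdot> z) +\<^sub>v (\<ominus>\<^bsub>K\<^esub> \<one>\<^bsub>K\<^esub>) \<cdot> (x +\<^sub>v b \<cdot> z)) y"
    using dorth_add[of "x +\<^sub>v a \<cdot> z" "(\<ominus>\<^bsub>K\<^esub> \<one>\<^bsub>K\<^esub>) \<cdot> (x +\<^sub>v b \<cdot> z)" y]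
      dorth_smult[of "\<ominus>\<^bsub>K\<^esub> \<one>\<^bsub>K\<^esub>" "x +\<^sub>v b \<cdot> z" y] a b x y z by simp
  moreover have "(x +\<^sub>v a \<cdot> z) +\<^sub>v (\<ominus>\<^bsub>K\<^esub> \<one>\<^bsub>K\<^esub>) \<cdot> (x +\<^sub>v b \<cdot> z) = ?c \<cdot> z"
    using a b x z by (simp add: smult_l_distr smult_minus_left H.minus_add H.a_ac H.r_neg1 H.r_neg2)
  ultimately have "dorth (d \<cdot> ?c \<cdot> z) y" using dorth_smult c d z y by simp
  then have "dorth ((d \<otimes>\<^bsub>K\<^esub> ?c) \<cdot> z) y" using smult_assoc[OF d(1) c(1) z(1)] by simp
  then have "dorth z y" using d z by simp
  then show False using orth_not_dorth z y by blast
qed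

text \<open>Solving for \<open>x + a z\<close> with \<open>z\<close> on the hyperplane gives
  \<open>z\<close> itself the value \<open>- 1\<close>. For \<open>y = 0\<close> no such
  \<open>z\<close> exists, and the functional is set to zero.\<close>

definition g :: "'v \<Rightarrow> 'v \<Rightarrow> 'k"
  where "g x y = (if y = 0\<^sub>v then \<zero>\<^bsub>K\<^esub>
    else THE a. a \<in> KC \<and> dorth (x +\<^sub>v a \<cdot> (SOME z. z \<in> VC \<and> orth z y)) y)"

lemma g_char:
  assumes y: "y \<in> VC" "y \<noteq> 0\<^sub>v"
  obtains z where "z \<in> VC" "orth z y" "\<And>x. x \<in> VC \<Longrightarrow> g x y \<in> KC \<and> dorth (x +\<^sub>v g x y \<cdot> z) y"
    "\<And>x a. \<lbrakk>x \<in> VC; a \<in> KC; dorth (x +\<^sub>v a \<cdot> z) y\<rbrakk> \<Longrightarrow> g x y = a"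
proof -
  define z where "z = (SOME z. z \<in> VC \<and> orth z y)"
  have "\<exists>z. z \<in> VC \<and> orth z y" using orth_exists y by blast
  then have z: "z \<in> VC" "orth z y" unfolding z_def by (metis (mono_tags, lifting) someI_ex)+
  have g: "g x y = (THE a. a \<in> KC \<and> dorth (x +\<^sub>v a \<cdot> z) y)" for x
    using y by (simp add: g_def z_def)
  have ex1: "\<exists>!a. a \<in> KC \<and> dorth (x +\<^sub>v a \<cdot> z) y" if "x \<in> VC" for x
    using coefficient_exists[OF that y(1) z] coefficient_unique[OF that y(1) z] by blast
  show thesis
  proof (rule that[OF z])
    fix x assume "x \<in> VC"
    then show "g x y \<in> KC \<and> dorth (x +\<^sub>v g x y \<cdot> z) y" using theI'[OF ex1] g by simp
  next
    fix x a assume "x \<in> VC" "a \<in> KC" "dorth (x +\<^sub>v a \<cdot> z) y"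
    then show "g x y = a" using the1_equality[OF ex1] g by simp
  qed
qed

lemma g_zero_right [simp]: "g x 0\<^sub>v = \<zero>\<^bsub>K\<^esub>"
  by (simp add: g_def)

lemma g_closed [simp]: "\<lbrakk>x \<in> VC; y \<in> VC\<rbrakk> \<Longrightarrow> g x y \<in> KC"
  by (metis g_char g_zero_right K.zero_closed)

lemma g_add_left:
  assumes x: "x \<in> VC" "x' \<in> VC" and y: "y \<in> VC" shows "g (x +\<^sub>v x') y = g x y \<oplus>\<^bsub>K\<^esub> g x' y"
proof (cases "y = 0\<^sub>v")
  case False
  then obtain z where z: "z \<in> VC" "\<And>x. x \<in> VC \<Longrightarrow> g x y \<in> KC \<and> dorth (x +\<^sub>v g x y \<cdot> z) y"
    "\<And>x a. \<lbrakk>x \<in> VC; a \<in> KC; dorth (x +\<^sub>v a \<cdot> z) y\<rbrakk> \<Longrightarrow> g x y = a"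
    using g_char y by metis
  have "dorth ((x +\<^sub>v g x y \<cdot> z) +\<^sub>v (x' +\<^sub>v g x' y \<cdot> z)) y"
    using dorth_add[of "x +\<^sub>v g x y \<cdot> z" "x' +\<^sub>v g x' y \<cdot> z" y] z(2)[of x] z(2)[of x'] x y z(1) by simp
  moreover have "(x +\<^sub>v g x y \<cdot> z) +\<^sub>v (x' +\<^sub>v g x' y \<cdot> z) = (x +\<^sub>v x') +\<^sub>v (g x y \<oplus>\<^bsub>K\<^esub> g x' y) \<cdot> z"
    using x y z(1) by (simp add: smult_l_distr H.a_ac)
  ultimately show ?thesis using z(3)[of "x +\<^sub>v x'" "g x y \<oplus>\<^bsub>K\<^esub> g x' y"] x y by simp
qed simp

lemma g_smult_left:
  assumes x: "x \<in> VC" and c: "c \<in> KC" and y: "y \<in> VC" shows "g (c \<cdot> x) y = c \<otimes>\<^bsub>K\<^esub> g x y"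
proof (cases "y = 0\<^sub>v")
  case False
  then obtain z where z: "z \<in> VC" "\<And>x. x \<in> VC \<Longrightarrow> g x y \<in> KC \<and> dorth (x +\<^sub>v g x y \<cdot> z) y"
    "\<And>x a. \<lbrakk>x \<in> VC; a \<in> KC; dorth (x +\<^sub>v a \<cdot> z) y\<rbrakk> \<Longrightarrow> g x y = a"
    using g_char y by metis
  have "dorth (c \<cdot> (x +\<^sub>v g x y \<cdot> z)) y"
    using dorth_smult[of c "x +\<^sub>v g x y \<cdot> z" y] z(2)[of x] x y c z(1) by simp
  moreover have "c \<cdot> (x +\<^sub>v g x y \<cdot> z) = c \<cdot> x +\<^sub>v (c \<otimes>\<^bsub>K\<^esub> g x y) \<cdot> z"
    using x y c z(1) by (simp add: smult_r_distr smult_assoc)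
  ultimately show ?thesis using z(3)[of "c \<cdot> x" "c \<otimes>\<^bsub>K\<^esub> g x y"] x y c by simp
qed (use c in simp)

lemma g_eq_zero_iff:
  assumes "x \<in> VC" "y \<in> VC" shows "g x y = \<zero>\<^bsub>K\<^esub> \<longleftrightarrow> dorth x y"
proof (cases "y = 0\<^sub>v")
  case False
  then obtain z where z: "z \<in> VC" "\<And>x. x \<in> VC \<Longrightarrow> g x y \<in> KC \<and> dorth (x +\<^sub>v g x y \<cdot> z) y"
    "\<And>x a. \<lbrakk>x \<in> VC; a \<in> KC; dorth (x +\<^sub>v a \<cdot> z) y\<rbrakk> \<Longrightarrow> g x y = a"
    using g_char assms by metis
  show ?thesis using z(2)[of x] z(3)[of x "\<zero>\<^bsub>K\<^esub>"] z(1) assms by auto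
qed (use assms dorth_zero in auto)

text \<open>Since \<open>x\<close> is \<open>z\<close> shifted by \<open>x - z\<close>, it lies on
  the hyperplane of \<open>y\<close> iff \<open>x - z\<close> is a direction of it, that is, iff the
  coefficient is \<open>- 1\<close>.\<close>

lemma g_eq_minus_one_iff:
  assumes x: "x \<in> VC" and y: "y \<in> VC" shows "g x y = \<ominus>\<^bsub>K\<^esub> \<one>\<^bsub>K\<^esub> \<longleftrightarrow> orth x y"
proof (cases "y = 0\<^sub>v")
  case True
  have "\<ominus>\<^bsub>K\<^esub> \<one>\<^bsub>K\<^esub> \<noteq> \<zero>\<^bsub>K\<^esub>" using one_not_zero K.minus_minus[OF K.one_closed] K.minus_zero by metis
  then have "g x y \<noteq> \<ominus>\<^bsub>K\<^esub> \<one>\<^bsub>K\<^esub>" using True g_zero_right by metis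
  moreover have "\<not> orth x y" using True not_orth_zero[OF x] orth_sym[OF x y] by blast
  ultimately show ?thesis by blast
next
  case False
  then obtain z where z: "z \<in> VC" "orth z y" "\<And>x. x \<in> VC \<Longrightarrow> g x y \<in> KC \<and> dorth (x +\<^sub>v g x y \<cdot> z) y"
    "\<And>x a. \<lbrakk>x \<in> VC; a \<in> KC; dorth (x +\<^sub>v a \<cdot> z) y\<rbrakk> \<Longrightarrow> g x y = a"
    using g_char y by metis
  have "g x y = \<ominus>\<^bsub>K\<^esub> \<one>\<^bsub>K\<^esub> \<longleftrightarrow> dorth (x +\<^sub>v (\<ominus>\<^bsub>K\<^esub> \<one>\<^bsub>K\<^esub>) \<cdot> z) y"
    using z(3)[of x] z(4)[of x "\<ominus>\<^bsub>K\<^esub> \<one>\<^bsub>K\<^esub>"] x by auto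
  also have "\<dots> \<longleftrightarrow> orth (z +\<^sub>v (x +\<^sub>v (\<ominus>\<^bsub>K\<^esub> \<one>\<^bsub>K\<^esub>) \<cdot> z)) y" using orth_shift z x y by simp
  also have "z +\<^sub>v (x +\<^sub>v (\<ominus>\<^bsub>K\<^esub> \<one>\<^bsub>K\<^esub>) \<cdot> z) = x"
    using H.a_lcomm[of z x "\<ominus>\<^bsub>V\<^esub> z"] z(1) x by (simp add: smult_minus_left H.r_neg)
  finally show ?thesis .
qed

section \<open>Additivity in the second argument\<close>

definition off :: "'v \<Rightarrow> 'v \<Rightarrow> bool"
  where "off y w \<longleftrightarrow> (\<forall>a\<in>KC. w \<noteq> a \<cdot> y)"

lemma off_nonzero: "\<lbrakk>off y w; y \<in> VC\<rbrakk> \<Longrightarrow> w \<noteq> 0\<^sub>v"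
  unfolding off_def using smult_zero_left K.zero_closed by metis

lemma off_sym:
  assumes "off y w" "y \<in> VC" "w \<in> VC" "y \<noteq> 0\<^sub>v" shows "off w y"
  unfolding off_def
proof (intro ballI notI)
  fix a assume a: "a \<in> KC" "y = a \<cdot> w"
  then have "a \<noteq> \<zero>\<^bsub>K\<^esub>" using assms by auto
  then obtain b where b: "b \<in> KC" "b \<otimes>\<^bsub>K\<^esub> a = \<one>\<^bsub>K\<^esub>" using inverse_K a by blast
  have "b \<cdot> y = w" using a b assms smult_assoc[of b a w] by simp
  then show False using assms(1) b unfolding off_def by blast
qed

text \<open>In terms of \<open>g\<close> this is, up to sign, a dual basis for \<open>y\<close> and
  \<open>y'\<close>.\<close>

lemma dual_pair:
  assumes "y \<in> VC" "y' \<in> VC" "y \<noteq> 0\<^sub>v" "off y y'"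
  obtains x x' where "x \<in> VC" "x' \<in> VC" "orth x y" "dorth x y'" "orth x' y'" "dorth x' y"
proof -
  have "off y' y" "y' \<noteq> 0\<^sub>v"
    using off_sym[OF assms(4,1,2,3)] off_nonzero[OF assms(4,1)] by auto
  then show ?thesis
    using that separate[of y y'] separate[of y' y] assms unfolding off_def by blast
qed

text \<open>By symmetry and \<open>orth_shift\<close>, \<open>x\<close> and \<open>x'\<close> lie on
  the hyperplane of \<open>y + y'\<close> too; this is where the normalization pays off. A vector
  killed by \<open>g _ y\<close> and \<open>g _ y'\<close> is also killed by
  \<open>g _ (y + y')\<close>, and \<open>v\<close> is corrected to such a vector.\<close>

lemma g_add_right_off:
  assumes y: "y \<in> VC" "y' \<in> VC" "y \<noteq> 0\<^sub>v" "off y y'" and v: "v \<in> VC"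
  shows "g v (y +\<^sub>v y') = g v y \<oplus>\<^bsub>K\<^esub> g v y'"
proof -
  obtain x x' where x: "x \<in> VC" "x' \<in> VC" "orth x y" "dorth x y'" "orth x' y'" "dorth x' y"
    using dual_pair y by blast
  have "orth (y +\<^sub>v y') x" "orth (y' +\<^sub>v y) x'"
    using orth_shift[of y y' x] orth_shift[of y' y x'] orth_sym dorth_sym x y by blast+
  then have "orth x (y +\<^sub>v y')" "orth x' (y +\<^sub>v y')" using orth_sym x y H.a_comm by auto
  then have gx: "g x y = \<ominus>\<^bsub>K\<^esub> \<one>\<^bsub>K\<^esub>" "g x y' = \<zero>\<^bsub>K\<^esub>" "g x' y' = \<ominus>\<^bsub>K\<^esub> \<one>\<^bsub>K\<^esub>" "g x' y = \<zero>\<^bsub>K\<^esub>"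
    "g x (y +\<^sub>v y') = \<ominus>\<^bsub>K\<^esub> \<one>\<^bsub>K\<^esub>" "g x' (y +\<^sub>v y') = \<ominus>\<^bsub>K\<^esub> \<one>\<^bsub>K\<^esub>"
    using x y g_eq_zero_iff g_eq_minus_one_iff by auto
  \<comment> \<open>This removes the components of \<open>v\<close> along \<open>x\<close> and
    \<open>x'\<close>; the signs are positive because \<open>g x y\<close> and
    \<open>g x' y'\<close> are \<open>- 1\<close>.\<close>
  define w where "w = v +\<^sub>v g v y \<cdot> x +\<^sub>v g v y' \<cdot> x'"
  have w: "w \<in> VC" using v x y by (simp add: w_def)
  have gw: "g w u = g v u \<oplus>\<^bsub>K\<^esub> g v y \<otimes>\<^bsub>K\<^esub> g x u \<oplus>\<^bsub>K\<^esub> g v y' \<otimes>\<^bsub>K\<^esub> g x' u" if "u \<in> VC" for u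
    using that v x y by (simp add: w_def g_add_left g_smult_left)
  have "g w y = \<zero>\<^bsub>K\<^esub>" "g w y' = \<zero>\<^bsub>K\<^esub>"
    using gw gx v y by (simp_all add: K.r_minus K.r_neg)
  then have "dorth y w" "dorth y' w" using g_eq_zero_iff w y dorth_sym by auto
  then have "dorth w (y +\<^sub>v y')" using dorth_add dorth_sym w y by simp
  then have "\<zero>\<^bsub>K\<^esub> = g w (y +\<^sub>v y')" using g_eq_zero_iff[of w "y +\<^sub>v y'"] w y by simp
  also have "\<dots> = g v (y +\<^sub>v y') \<oplus>\<^bsub>K\<^esub> \<ominus>\<^bsub>K\<^esub> (g v y \<oplus>\<^bsub>K\<^esub> g v y')"
    using gw[of "y +\<^sub>v y'"] gx v y by (simp add: K.r_minus K.minus_add K.a_assoc)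
  finally have "g v (y +\<^sub>v y') \<oplus>\<^bsub>K\<^esub> \<ominus>\<^bsub>K\<^esub> (g v y \<oplus>\<^bsub>K\<^esub> g v y') = \<zero>\<^bsub>K\<^esub>" by simp
  then have "\<ominus>\<^bsub>K\<^esub> (\<ominus>\<^bsub>K\<^esub> (g v y \<oplus>\<^bsub>K\<^esub> g v y')) = g v (y +\<^sub>v y')"
    using v y by (intro K.minus_equality) auto
  then show ?thesis using v y by simp
qed

lemma obtain_off: assumes "y \<in> VC" obtains w where "w \<in> VC" "off y w"
  using off_line_exists[OF assms] unfolding off_def by blast

lemma off_smult_left: "\<lbrakk>off y w; b \<in> KC; y \<in> VC\<rbrakk> \<Longrightarrow> off (b \<cdot> y) w"
  unfolding off_def using smult_assoc by (metis K.m_closed)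

lemma off_add:
  assumes "off y w" "b \<in> KC" "y \<in> VC" "w \<in> VC" shows "off y (b \<cdot> y +\<^sub>v w)"
  unfolding off_def
proof (intro ballI notI)
  fix a assume a: "a \<in> KC" "b \<cdot> y +\<^sub>v w = a \<cdot> y"
  have "w = (\<ominus>\<^bsub>K\<^esub> b) \<cdot> y +\<^sub>v (b \<cdot> y +\<^sub>v w)"
    using assms by (simp add: smult_minus_left H.r_neg1)
  also have "\<dots> = (\<ominus>\<^bsub>K\<^esub> b \<oplus>\<^bsub>K\<^esub> a) \<cdot> y" using a assms by (simp add: smult_l_distr)
  finally show False using assms(1,2) a unfolding off_def by (metis K.a_inv_closed K.a_closed)
qed

text \<open>If \<open>y'\<close> is a multiple of \<open>y\<close>, the sum
  \<open>y + y' + w\<close> with \<open>w\<close> off the line is expanded in two ways, and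
  \<open>g v w\<close> is cancelled.\<close>

lemma g_add_right:
  assumes y: "y \<in> VC" "y' \<in> VC" and v: "v \<in> VC"
  shows "g v (y +\<^sub>v y') = g v y \<oplus>\<^bsub>K\<^esub> g v y'"
proof (cases "y = 0\<^sub>v \<or> off y y'")
  case True
  then show ?thesis using g_add_right_off assms by (cases "y = 0\<^sub>v") auto
next
  case False
  then obtain b where b: "b \<in> KC" "y' = b \<cdot> y" unfolding off_def by blast
  obtain w where w: "w \<in> VC" "off y w" using obtain_off y by blast
  have 1: "g v (y +\<^sub>v (y' +\<^sub>v w)) = g v y \<oplus>\<^bsub>K\<^esub> g v (y' +\<^sub>v w)"
    using g_add_right_off[of y "y' +\<^sub>v w" v] off_add[of y w b] b w y v False by simp
  have 2: "g v (y' +\<^sub>v w) = g v y' \<oplus>\<^bsub>K\<^esub> g v w"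
  proof (cases "y' = 0\<^sub>v")
    case True
    then show ?thesis using w v by simp
  next
    case False
    have "off y' w" using off_smult_left[of y w b] b w y by simp
    then show ?thesis using g_add_right_off[of y' w v] False w y v by simp
  qed
  have s: "y +\<^sub>v y' = (\<one>\<^bsub>K\<^esub> \<oplus>\<^bsub>K\<^esub> b) \<cdot> y" using b y by (simp add: smult_l_distr)
  have "off (y +\<^sub>v y') w" unfolding s using off_smult_left[OF w(2)] b y by simp
  then have 3: "g v ((y +\<^sub>v y') +\<^sub>v w) = g v (y +\<^sub>v y') \<oplus>\<^bsub>K\<^esub> g v w"
    using g_add_right_off[of "y +\<^sub>v y'" w v] w y v by (cases "y +\<^sub>v y' = 0\<^sub>v") auto
  have "g v (y +\<^sub>v y') \<oplus>\<^bsub>K\<^esub> g v w = g v y \<oplus>\<^bsub>K\<^esub> g v y' \<oplus>\<^bsub>K\<^esub> g v w"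
    using 1 2 3 y w v by (simp add: H.a_assoc K.a_assoc)
  then show ?thesis using y w v by simp
qed

section \<open>The antiautomorphism and the Hermitian symmetry\<close>

lemma ratio_exists:
  assumes y: "y \<in> VC" "y \<noteq> 0\<^sub>v" and m: "m \<in> KC"
  shows "\<exists>c\<in>KC. \<forall>x\<in>VC. g x (m \<cdot> y) = g x y \<otimes>\<^bsub>K\<^esub> c"
proof -
  obtain z where z: "z \<in> VC" "orth z y" using orth_exists y by blast
  then have gz: "g z y = \<ominus>\<^bsub>K\<^esub> \<one>\<^bsub>K\<^esub>" using g_eq_minus_one_iff y by blast
  \<comment> \<open>The functional of \<open>m y\<close> vanishes on the kernel of that of
    \<open>y\<close>, hence is a right multiple of it. The factor is read off at \<open>z\<close>,
    where \<open>g z y = - 1\<close>.\<close>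
  let ?c = "\<ominus>\<^bsub>K\<^esub> (g z (m \<cdot> y))"
  have "g x (m \<cdot> y) = g x y \<otimes>\<^bsub>K\<^esub> ?c" if x: "x \<in> VC" for x
  proof -
    let ?w = "x +\<^sub>v g x y \<cdot> z"
    have w: "?w \<in> VC" using x y z by simp
    have "g ?w y = \<zero>\<^bsub>K\<^esub>" using x y z gz by (simp add: g_add_left g_smult_left K.r_minus K.r_neg)
    then have "dorth (m \<cdot> y) ?w" using g_eq_zero_iff[OF w y(1)] dorth_sym[OF w y(1)] dorth_smult m w y by blast
    then have "g ?w (m \<cdot> y) = \<zero>\<^bsub>K\<^esub>" using dorth_sym g_eq_zero_iff m w y by simp
    then have "g x (m \<cdot> y) \<oplus>\<^bsub>K\<^esub> g x y \<otimes>\<^bsub>K\<^esub> g z (m \<cdot> y) = \<zero>\<^bsub>K\<^esub>"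
      using x y z m by (simp add: g_add_left g_smult_left)
    then have "\<ominus>\<^bsub>K\<^esub> (g x y \<otimes>\<^bsub>K\<^esub> g z (m \<cdot> y)) = g x (m \<cdot> y)"
      using x y z m by (intro K.minus_equality) auto
    then show ?thesis using x y z m by (simp add: K.r_minus)
  qed
  moreover have "?c \<in> KC" using y z m by simp
  ultimately show ?thesis by blast
qed

lemma ratio_unique:
  assumes y: "y \<in> VC" "y \<noteq> 0\<^sub>v" and c: "c \<in> KC" "d \<in> KC"
    and eq: "\<forall>x\<in>VC. g x y \<otimes>\<^bsub>K\<^esub> c = g x y \<otimes>\<^bsub>K\<^esub> d"
  shows "c = d"
proof -
  obtain z where z: "z \<in> VC" "orth z y" using orth_exists y by blast
  then have "g z y = \<ominus>\<^bsub>K\<^esub> \<one>\<^bsub>K\<^esub>" using g_eq_minus_one_iff y by blast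
  then have "\<ominus>\<^bsub>K\<^esub> c = \<ominus>\<^bsub>K\<^esub> d" using eq z c by (metis K.l_minus K.l_one K.one_closed)
  then show ?thesis using c by (metis K.minus_minus)
qed

text \<open>Both factors are compared with the factor \<open>d\<close> of \<open>y + y'\<close>:
  evaluation at \<open>x\<close> gives \<open>d = c\<close>, at \<open>x'\<close> it gives
  \<open>d = c'\<close>.\<close>

lemma ratio_eq_off:
  assumes y: "y \<in> VC" "y' \<in> VC" "y \<noteq> 0\<^sub>v" "off y y'" and m: "m \<in> KC" and c: "c \<in> KC" "c' \<in> KC"
    and gc: "\<forall>x\<in>VC. g x (m \<cdot> y) = g x y \<otimes>\<^bsub>K\<^esub> c" "\<forall>x\<in>VC. g x (m \<cdot> y') = g x y' \<otimes>\<^bsub>K\<^esub> c'"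
  shows "c = c'"
proof -
  obtain x x' where x: "x \<in> VC" "x' \<in> VC" "orth x y" "dorth x y'" "orth x' y'" "dorth x' y"
    using dual_pair y by blast
  then have gx: "g x y = \<ominus>\<^bsub>K\<^esub> \<one>\<^bsub>K\<^esub>" "g x y' = \<zero>\<^bsub>K\<^esub>" "g x' y' = \<ominus>\<^bsub>K\<^esub> \<one>\<^bsub>K\<^esub>" "g x' y = \<zero>\<^bsub>K\<^esub>"
    using y g_eq_zero_iff g_eq_minus_one_iff by auto
  have "off y (\<one>\<^bsub>K\<^esub> \<cdot> y +\<^sub>v y')" using off_add[OF y(4) K.one_closed y(1,2)] .
  then have "y +\<^sub>v y' \<noteq> 0\<^sub>v" using off_nonzero y by auto
  then obtain d where d: "d \<in> KC" "\<forall>x\<in>VC. g x (m \<cdot> (y +\<^sub>v y')) = g x (y +\<^sub>v y') \<otimes>\<^bsub>K\<^esub> d"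
    using ratio_exists[of "y +\<^sub>v y'" m] y m by auto
  have *: "(g x y \<oplus>\<^bsub>K\<^esub> g x y') \<otimes>\<^bsub>K\<^esub> d = g x y \<otimes>\<^bsub>K\<^esub> c \<oplus>\<^bsub>K\<^esub> g x y' \<otimes>\<^bsub>K\<^esub> c'" if "x \<in> VC" for x
  proof -
    have "g x (m \<cdot> (y +\<^sub>v y')) = g x (m \<cdot> y) \<oplus>\<^bsub>K\<^esub> g x (m \<cdot> y')"
      using that m y by (simp add: smult_r_distr g_add_right)
    then show ?thesis using d(2) gc that y by (simp add: g_add_right)
  qed
  have "\<ominus>\<^bsub>K\<^esub> d = \<ominus>\<^bsub>K\<^esub> c" "\<ominus>\<^bsub>K\<^esub> d = \<ominus>\<^bsub>K\<^esub> c'"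
    using *[of x] *[of x'] gx x c d by (simp_all add: K.l_minus)
  then show ?thesis using c by (metis K.minus_minus)
qed

definition \<sigma> :: "'k \<Rightarrow> 'k"
  where "\<sigma> m = (SOME c. c \<in> KC \<and> (\<forall>x\<in>VC. \<forall>y\<in>VC. g x (m \<cdot> y) = g x y \<otimes>\<^bsub>K\<^esub> c))"

lemma nonzero_exists: obtains y where "y \<in> VC" "y \<noteq> 0\<^sub>v"
  using obtain_off[of "0\<^sub>v"] off_nonzero by blast

lemma \<sigma>:
  assumes m: "m \<in> KC"
  shows \<sigma>_closed [simp]: "\<sigma> m \<in> KC"
    and g_smult_right: "\<lbrakk>x \<in> VC; y \<in> VC\<rbrakk> \<Longrightarrow> g x (m \<cdot> y) = g x y \<otimes>\<^bsub>K\<^esub> \<sigma> m"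
proof -
  obtain y0 where y0: "y0 \<in> VC" "y0 \<noteq> 0\<^sub>v" by (rule nonzero_exists)
  obtain c where c: "c \<in> KC" "\<forall>x\<in>VC. g x (m \<cdot> y0) = g x y0 \<otimes>\<^bsub>K\<^esub> c"
    using ratio_exists y0 m by blast
  have "\<forall>x\<in>VC. g x (m \<cdot> y) = g x y \<otimes>\<^bsub>K\<^esub> c" if y: "y \<in> VC" for y
  proof (cases "y = 0\<^sub>v")
    case True
    then show ?thesis using c m by simp
  next
    case False
    obtain d where d: "d \<in> KC" "\<forall>x\<in>VC. g x (m \<cdot> y) = g x y \<otimes>\<^bsub>K\<^esub> d"
      using ratio_exists y False m by blast
    have "c = d"
    proof (cases "off y0 y")
      case True
      then show ?thesis using ratio_eq_off y0 y m c d by blast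
    next
      \<comment> \<open>Dependent vectors cannot be compared directly; \<open>w\<close> is off the
        lines of both \<open>y0\<close> and \<open>y\<close>.\<close>
      case not_off: False
      then obtain b where b: "b \<in> KC" "y = b \<cdot> y0" unfolding off_def by blast
      obtain w where w: "w \<in> VC" "off y0 w" using obtain_off y0 by blast
      have "off y w" using off_smult_left b w y0 by simp
      obtain f where f: "f \<in> KC" "\<forall>x\<in>VC. g x (m \<cdot> w) = g x w \<otimes>\<^bsub>K\<^esub> f"
        using ratio_exists[of w m] w off_nonzero y0 m by blast
      have "c = f" using ratio_eq_off[OF y0(1) w(1) y0(2) w(2) m c(1) f(1)] c f by blast
      moreover have "d = f" using ratio_eq_off[OF y w(1) False \<open>off y w\<close> m d(1) f(1)] d f by blast
      ultimately show ?thesis by simp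
    qed
    then show ?thesis using d by simp
  qed
  then have "\<exists>c. c \<in> KC \<and> (\<forall>x\<in>VC. \<forall>y\<in>VC. g x (m \<cdot> y) = g x y \<otimes>\<^bsub>K\<^esub> c)" using c by blast
  then have "\<sigma> m \<in> KC \<and> (\<forall>x\<in>VC. \<forall>y\<in>VC. g x (m \<cdot> y) = g x y \<otimes>\<^bsub>K\<^esub> \<sigma> m)"
    unfolding \<sigma>_def by (rule someI_ex)
  then show "\<sigma> m \<in> KC" "\<lbrakk>x \<in> VC; y \<in> VC\<rbrakk> \<Longrightarrow> g x (m \<cdot> y) = g x y \<otimes>\<^bsub>K\<^esub> \<sigma> m" by auto
qed

lemma \<sigma>_eqI:
  assumes m: "m \<in> KC" "c \<in> KC"
    and eq: "\<And>x y. \<lbrakk>x \<in> VC; y \<in> VC\<rbrakk> \<Longrightarrow> g x (m \<cdot> y) = g x y \<otimes>\<^bsub>K\<^esub> c"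
  shows "\<sigma> m = c"
proof -
  obtain y where y: "y \<in> VC" "y \<noteq> 0\<^sub>v" by (rule nonzero_exists)
  show ?thesis using ratio_unique[OF y \<sigma>_closed[OF m(1)] m(2)] eq g_smult_right m y by metis
qed

lemma \<sigma>_add:
  assumes "a \<in> KC" "b \<in> KC" shows "\<sigma> (a \<oplus>\<^bsub>K\<^esub> b) = \<sigma> a \<oplus>\<^bsub>K\<^esub> \<sigma> b"
  using assms by (intro \<sigma>_eqI) (simp_all add: smult_l_distr g_add_right g_smult_right K.r_distr)

lemma \<sigma>_mult:
  assumes "a \<in> KC" "b \<in> KC" shows "\<sigma> (a \<otimes>\<^bsub>K\<^esub> b) = \<sigma> b \<otimes>\<^bsub>K\<^esub> \<sigma> a"
  using assms by (intro \<sigma>_eqI) (simp_all add: smult_assoc g_smult_right K.m_assoc)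

lemma \<sigma>_one: "\<sigma> \<one>\<^bsub>K\<^esub> = \<one>\<^bsub>K\<^esub>"
  by (intro \<sigma>_eqI) simp_all

lemma \<sigma>_zero: "\<sigma> \<zero>\<^bsub>K\<^esub> = \<zero>\<^bsub>K\<^esub>"
  by (intro \<sigma>_eqI) simp_all

lemma \<sigma>_minus: assumes "a \<in> KC" shows "\<sigma> (\<ominus>\<^bsub>K\<^esub> a) = \<ominus>\<^bsub>K\<^esub> \<sigma> a"
proof -
  have "\<sigma> (\<ominus>\<^bsub>K\<^esub> a) \<oplus>\<^bsub>K\<^esub> \<sigma> a = \<zero>\<^bsub>K\<^esub>" using \<sigma>_add[of "\<ominus>\<^bsub>K\<^esub> a" a] assms by (simp add: K.l_neg \<sigma>_zero)
  then show ?thesis using K.minus_equality[of "\<sigma> (\<ominus>\<^bsub>K\<^esub> a)" "\<sigma> a"] assms by simp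
qed

text \<open>Symmetry is only known for \<open>orth\<close>, that is, for the value
  \<open>- 1\<close>. So \<open>x\<close> is scaled by minus the inverse \<open>b\<close> of
  \<open>g x y\<close>; exchanging the arguments then yields \<open>g y x * \<sigma> b = 1\<close>,
  and \<open>\<sigma> b\<close> is inverse to \<open>\<sigma> (g x y)\<close>.\<close>

lemma g_hermitian:
  assumes x: "x \<in> VC" and y: "y \<in> VC" shows "g y x = \<sigma> (g x y)"
proof (cases "g x y = \<zero>\<^bsub>K\<^esub>")
  case True
  then have "g y x = \<zero>\<^bsub>K\<^esub>" using g_eq_zero_iff x y dorth_sym by blast
  then show ?thesis using True \<sigma>_zero by simp
next
  case False
  let ?l = "g x y"
  have l: "?l \<in> KC" using x y by simp
  obtain b where b: "b \<in> KC" "b \<otimes>\<^bsub>K\<^esub> ?l = \<one>\<^bsub>K\<^esub>" "?l \<otimes>\<^bsub>K\<^esub> b = \<one>\<^bsub>K\<^esub>" using inverse_K[OF l False] by blast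
  have "g ((\<ominus>\<^bsub>K\<^esub> b) \<cdot> x) y = \<ominus>\<^bsub>K\<^esub> \<one>\<^bsub>K\<^esub>" using x y b by (simp add: g_smult_left K.l_minus)
  then have "orth y ((\<ominus>\<^bsub>K\<^esub> b) \<cdot> x)" using g_eq_minus_one_iff orth_sym x y b by simp
  then have "g y ((\<ominus>\<^bsub>K\<^esub> b) \<cdot> x) = \<ominus>\<^bsub>K\<^esub> \<one>\<^bsub>K\<^esub>" using g_eq_minus_one_iff x y b by simp
  then have "\<ominus>\<^bsub>K\<^esub> (g y x \<otimes>\<^bsub>K\<^esub> \<sigma> b) = \<ominus>\<^bsub>K\<^esub> \<one>\<^bsub>K\<^esub>" using x y b by (simp add: g_smult_right \<sigma>_minus K.r_minus)
  then have 1: "g y x \<otimes>\<^bsub>K\<^esub> \<sigma> b = \<one>\<^bsub>K\<^esub>" using x y b by (metis K.minus_minus K.m_closed K.one_closed \<sigma>_closed g_closed)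
  have 2: "\<sigma> b \<otimes>\<^bsub>K\<^esub> \<sigma> ?l = \<one>\<^bsub>K\<^esub>" using \<sigma>_mult[of ?l b] b l \<sigma>_one by simp
  have "g y x = g y x \<otimes>\<^bsub>K\<^esub> (\<sigma> b \<otimes>\<^bsub>K\<^esub> \<sigma> ?l)" using 2 x y by simp
  also have "\<dots> = \<sigma> ?l" using 1 x y b l by (simp add: K.m_assoc[symmetric])
  finally show ?thesis .
qed

text \<open>Every \<open>m\<close> is a value of \<open>g\<close>, and exchanging the arguments
  twice restores it.\<close>

lemma \<sigma>_\<sigma>: assumes m: "m \<in> KC" shows "\<sigma> (\<sigma> m) = m"
proof -
  obtain y where y: "y \<in> VC" "y \<noteq> 0\<^sub>v" by (rule nonzero_exists)
  obtain z where z: "z \<in> VC" "orth z y" using orth_exists y by blast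
  then have "g z y = \<ominus>\<^bsub>K\<^esub> \<one>\<^bsub>K\<^esub>" using g_eq_minus_one_iff y by blast
  then have gx: "g ((\<ominus>\<^bsub>K\<^esub> m) \<cdot> z) y = m" using z y m by (simp add: g_smult_left K.r_minus K.l_minus)
  let ?x = "(\<ominus>\<^bsub>K\<^esub> m) \<cdot> z"
  have x: "?x \<in> VC" using m z by simp
  have "g y ?x = \<sigma> m" using g_hermitian[OF x y(1)] gx by simp
  then show ?thesis using g_hermitian[OF y(1) x] gx by simp
qed

text \<open>The form is normalized by \<open>(e, e) = 1\<close> for the vector \<open>e = (0, 1)\<close>.\<close>

definition H :: "('k, 'v \<times> 'k) module"
  where "H = \<lparr>carrier = VC \<times> KC, mult = undefined, one = undefined, zero = (0\<^sub>v, \<zero>\<^bsub>K\<^esub>),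
    add = (\<lambda>u v. (fst u +\<^sub>v fst v, snd u \<oplus>\<^bsub>K\<^esub> snd v)), smult = (\<lambda>c u. (c \<cdot> fst u, c \<otimes>\<^bsub>K\<^esub> snd u))\<rparr>"

definition form :: "'v \<times> 'k \<Rightarrow> 'v \<times> 'k \<Rightarrow> 'k"
  where "form u v = g (fst u) (fst v) \<oplus>\<^bsub>K\<^esub> snd u \<otimes>\<^bsub>K\<^esub> \<sigma> (snd v)"

lemma H_simps [simp]: "carrier H = VC \<times> KC" "zero H = (0\<^sub>v, \<zero>\<^bsub>K\<^esub>)"
  "u \<oplus>\<^bsub>H\<^esub> v = (fst u +\<^sub>v fst v, snd u \<oplus>\<^bsub>K\<^esub> snd v)" "c \<odot>\<^bsub>H\<^esub> u = (c \<cdot> fst u, c \<otimes>\<^bsub>K\<^esub> snd u)"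
  by (simp_all add: H_def)

lemma abelian_group_H: "abelian_group H"
proof (rule abelian_groupI)
  fix u assume "u \<in> carrier H"
  then show "\<exists>v\<in>carrier H. v \<oplus>\<^bsub>H\<^esub> u = \<zero>\<^bsub>H\<^esub>"
    by (intro bexI[of _ "(\<ominus>\<^bsub>V\<^esub> fst u, \<ominus>\<^bsub>K\<^esub> snd u)"]) (auto simp: H.l_neg K.l_neg)
qed (auto simp: H.a_ac K.a_ac)

lemma left_linear_space_H: "left_linear_space K H"
proof -
  interpret HH: abelian_group H by (rule abelian_group_H)
  show ?thesis
    by unfold_locales (auto simp: smult_l_distr smult_r_distr smult_assoc K.l_distr K.r_distr K.m_assoc)
qed

lemma smult_eq_zero:
  assumes "a \<in> KC" "x \<in> VC" "a \<cdot> x = 0\<^sub>v" "x \<noteq> 0\<^sub>v" shows "a = \<zero>\<^bsub>K\<^esub>"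
proof (rule ccontr)
  assume "a \<noteq> \<zero>\<^bsub>K\<^esub>"
  then obtain b where "b \<in> KC" "b \<otimes>\<^bsub>K\<^esub> a = \<one>\<^bsub>K\<^esub>" using inverse_K assms by blast
  then show False using smult_assoc[of b a x] assms by simp
qed

lemma dim_H: "dim_at_least 3 K H"
proof -
  interpret HH: abelian_group H by (rule abelian_group_H)
  obtain y where y: "y \<in> VC" "y \<noteq> 0\<^sub>v" by (rule nonzero_exists)
  obtain w where w: "w \<in> VC" "off y w" using obtain_off y by blast
  have w0: "w \<noteq> 0\<^sub>v" "w \<noteq> y" using off_nonzero[OF w(2) y(1)] w(2) smult_one[OF y(1)] unfolding off_def by (blast, metis K.one_closed)
  define b1 b2 b3 where b: "b1 = (y, \<zero>\<^bsub>K\<^esub>)" "b2 = (w, \<zero>\<^bsub>K\<^esub>)" "b3 = (0\<^sub>v, \<one>\<^bsub>K\<^esub>)"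
  let ?B = "{b1, b2, b3}"
  have d: "b1 \<noteq> b2" "b1 \<noteq> b3" "b2 \<noteq> b3" using w0 one_not_zero by (auto simp: b)
  have B: "?B \<subseteq> carrier H" using y w by (auto simp: b)
  have "\<forall>v\<in>F. c v = \<zero>\<^bsub>K\<^esub>"
    if F: "finite F" "F \<subseteq> ?B" "c \<in> F \<rightarrow> KC" "finsum H (\<lambda>v. c v \<odot>\<^bsub>H\<^esub> v) F = \<zero>\<^bsub>H\<^esub>" for F c
  proof -
    \<comment> \<open>The coefficients are given on \<open>F\<close> only; extended by zero they
      allow summation over all of \<open>?B\<close>.\<close>
    define c' where "c' v = (if v \<in> F then c v else \<zero>\<^bsub>K\<^esub>)" for v
    have c': "c' v \<in> KC" for v using F by (auto simp: c'_def)
    have cl: "c' v \<odot>\<^bsub>H\<^esub> v \<in> carrier H" if "v \<in> ?B" for v using c' B that by auto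
    have "\<zero>\<^bsub>H\<^esub> = finsum H (\<lambda>v. c' v \<odot>\<^bsub>H\<^esub> v) F"
      unfolding F(4)[symmetric]
      by (rule HH.finsum_cong') (use F cl in \<open>auto simp: c'_def\<close>)
    also have "\<dots> = finsum H (\<lambda>v. c' v \<odot>\<^bsub>H\<^esub> v) ?B"
    proof (rule HH.add.finprod_mono_neutral_cong_left)
      show "c' v \<odot>\<^bsub>H\<^esub> v = \<zero>\<^bsub>H\<^esub>" if "v \<in> ?B - F" for v using B that by (auto simp: c'_def)
    qed (use F cl in auto)
    also have "\<dots> = c' b1 \<odot>\<^bsub>H\<^esub> b1 \<oplus>\<^bsub>H\<^esub> (c' b2 \<odot>\<^bsub>H\<^esub> b2 \<oplus>\<^bsub>H\<^esub> (c' b3 \<odot>\<^bsub>H\<^esub> b3 \<oplus>\<^bsub>H\<^esub> \<zero>\<^bsub>H\<^esub>))"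
    proof -
      have three: "finsum H h ?B = h b1 \<oplus>\<^bsub>H\<^esub> (h b2 \<oplus>\<^bsub>H\<^esub> (h b3 \<oplus>\<^bsub>H\<^esub> \<zero>\<^bsub>H\<^esub>))"
        if "h b1 \<in> carrier H" "h b2 \<in> carrier H" "h b3 \<in> carrier H" for h
        using HH.finsum_insert[of "{b2, b3}" b1 h] HH.finsum_insert[of "{b3}" b2 h]
          HH.finsum_insert[of "{}" b3 h] that d by (simp del: H_simps)
      show ?thesis by (rule three) (rule cl, simp)+
    qed
    also have "\<dots> = (c' b1 \<cdot> y +\<^sub>v c' b2 \<cdot> w, c' b3)"
    proof -
      have "a1 \<odot>\<^bsub>H\<^esub> b1 \<oplus>\<^bsub>H\<^esub> (a2 \<odot>\<^bsub>H\<^esub> b2 \<oplus>\<^bsub>H\<^esub> (a3 \<odot>\<^bsub>H\<^esub> b3 \<oplus>\<^bsub>H\<^esub> \<zero>\<^bsub>H\<^esub>)) = (a1 \<cdot> y +\<^sub>v a2 \<cdot> w, a3)"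
        if "a1 \<in> KC" "a2 \<in> KC" "a3 \<in> KC" for a1 a2 a3
        using that y w by (simp add: b)
      then show ?thesis using c' by blast
    qed
    finally have s: "c' b1 \<cdot> y +\<^sub>v c' b2 \<cdot> w = 0\<^sub>v" and c3: "c' b3 = \<zero>\<^bsub>K\<^esub>"
      unfolding H_simps(2) by (metis prod.inject)+
    have c2: "c' b2 = \<zero>\<^bsub>K\<^esub>"
    proof (rule ccontr)
      assume "c' b2 \<noteq> \<zero>\<^bsub>K\<^esub>"
      then obtain a where a: "a \<in> KC" "a \<otimes>\<^bsub>K\<^esub> c' b2 = \<one>\<^bsub>K\<^esub>" using inverse_K c' by blast
      have "a \<cdot> (c' b1 \<cdot> y +\<^sub>v c' b2 \<cdot> w) = (a \<otimes>\<^bsub>K\<^esub> c' b1) \<cdot> y +\<^sub>v (a \<otimes>\<^bsub>K\<^esub> c' b2) \<cdot> w"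
        using a(1) c' y w by (simp add: smult_r_distr smult_assoc)
      also have "\<dots> = (a \<otimes>\<^bsub>K\<^esub> c' b1) \<cdot> y +\<^sub>v w" using a w by simp
      finally have "(a \<otimes>\<^bsub>K\<^esub> c' b1) \<cdot> y +\<^sub>v w = 0\<^sub>v" using s a by simp
      then show False
        using off_nonzero[OF off_add[OF w(2), of "a \<otimes>\<^bsub>K\<^esub> c' b1"] y(1)] a c' y w by simp
    qed
    then have "c' b1 = \<zero>\<^bsub>K\<^esub>" using smult_eq_zero[of "c' b1" y] s c' y w by simp
    then show ?thesis using c2 c3 F(2) by (auto simp: c'_def split: if_splits)
  qed
  then have "lin_indep K H ?B" unfolding lin_indep_def using B by blast
  moreover have "card ?B = 3" using d by simp
  ultimately show ?thesis unfolding dim_at_least_def by blast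
qed

text \<open>If the last coordinate \<open>a\<close> is nonzero, dividing an isotropic vector by it
  produces an affine point \<open>b x\<close> orthogonal to itself. If it is zero, \<open>x\<close>
  would satisfy \<open>dorth x x\<close>.\<close>

lemma form_nonzero:
  assumes "u \<in> carrier H" "form u u = \<zero>\<^bsub>K\<^esub>" shows "u = \<zero>\<^bsub>H\<^esub>"
proof -
  obtain x a where u: "u = (x, a)" "x \<in> VC" "a \<in> KC" using assms by auto
  have f: "g x x \<oplus>\<^bsub>K\<^esub> a \<otimes>\<^bsub>K\<^esub> \<sigma> a = \<zero>\<^bsub>K\<^esub>" using assms by (simp add: u form_def)
  show ?thesis
  proof (cases "a = \<zero>\<^bsub>K\<^esub>")
    case True
    then have "g x x = \<zero>\<^bsub>K\<^esub>" using f u by (simp add: \<sigma>_zero)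
    then show ?thesis using g_eq_zero_iff not_dorth_self u True by auto
  next
    case False
    then obtain b where b: "b \<in> KC" "b \<otimes>\<^bsub>K\<^esub> a = \<one>\<^bsub>K\<^esub>" using inverse_K u by blast
    have ab: "\<sigma> a \<otimes>\<^bsub>K\<^esub> \<sigma> b = \<one>\<^bsub>K\<^esub>" using \<sigma>_mult[of b a] b u \<sigma>_one by simp
    have gxx: "g x x = \<ominus>\<^bsub>K\<^esub> (a \<otimes>\<^bsub>K\<^esub> \<sigma> a)" using f u by (metis K.minus_equality K.m_closed \<sigma>_closed g_closed)
    have "g (b \<cdot> x) (b \<cdot> x) = b \<otimes>\<^bsub>K\<^esub> (g x x \<otimes>\<^bsub>K\<^esub> \<sigma> b)" using b u by (simp add: g_smult_left g_smult_right K.m_assoc)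
    also have "\<dots> = \<ominus>\<^bsub>K\<^esub> (b \<otimes>\<^bsub>K\<^esub> (a \<otimes>\<^bsub>K\<^esub> (\<sigma> a \<otimes>\<^bsub>K\<^esub> \<sigma> b)))"
      using gxx b(1) u by (simp add: K.l_minus K.r_minus K.m_assoc)
    also have "\<dots> = \<ominus>\<^bsub>K\<^esub> \<one>\<^bsub>K\<^esub>" using ab b u by simp
    finally have "orth (b \<cdot> x) (b \<cdot> x)" using g_eq_minus_one_iff b u by simp
    then show ?thesis using not_orth_self b u by simp
  qed
qed

lemma hermitian_space_H: "hermitian_space K \<sigma> H form"
proof -
  interpret L: left_linear_space K H by (rule left_linear_space_H)
  show ?thesis
  proof unfold_locales
    show "dim_at_least 3 K H" by (rule dim_H)
    show "\<And>u. \<lbrakk>u \<in> carrier H; form u u = \<zero>\<^bsub>K\<^esub>\<rbrakk> \<Longrightarrow> u = \<zero>\<^bsub>H\<^esub>" by (rule form_nonzero)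
    show "form u v = \<sigma> (form v u)" if "u \<in> carrier H" "v \<in> carrier H" for u v
      using that g_hermitian[of "fst v" "fst u"] by (auto simp: form_def \<sigma>_add \<sigma>_mult \<sigma>_\<sigma>)
  qed (auto simp: form_def one_not_zero Units_K \<sigma>_add \<sigma>_mult \<sigma>_\<sigma> g_add_left g_add_right g_smult_left
      g_smult_right K.l_distr K.r_distr K.m_assoc K.a_ac)
qed

end

section \<open>The lattice as the lattice of closed subspaces\<close>

context hermitian_space
begin

lemma form_add_left:
  "\<lbrakk>u \<in> carrier H; v \<in> carrier H; w \<in> carrier H\<rbrakk> \<Longrightarrow> form (u \<oplus>\<^bsub>H\<^esub> v) w = form u w \<oplus>\<^bsub>K\<^esub> form v w"
  using form_left[of "\<one>\<^bsub>K\<^esub>" "\<one>\<^bsub>K\<^esub>" u v w] form_closed by simp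

lemma form_smult_left:
  assumes "a \<in> carrier K" "u \<in> carrier H" "w \<in> carrier H" shows "form (a \<odot>\<^bsub>H\<^esub> u) w = a \<otimes>\<^bsub>K\<^esub> form u w"
  using form_left[of a "\<zero>\<^bsub>K\<^esub>" u u w] form_closed assms by simp

lemma form_zero_left: "w \<in> carrier H \<Longrightarrow> form \<zero>\<^bsub>H\<^esub> w = \<zero>\<^bsub>K\<^esub>"
  using form_smult_left[of "\<zero>\<^bsub>K\<^esub>" "\<zero>\<^bsub>H\<^esub>" w] form_closed by simp

lemma star_zero: "star \<zero>\<^bsub>K\<^esub> = \<zero>\<^bsub>K\<^esub>"
  using form_hermitian[of "\<zero>\<^bsub>H\<^esub>" "\<zero>\<^bsub>H\<^esub>"] form_zero_left by simp

lemma form_eq_zero_commute: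
  "\<lbrakk>u \<in> carrier H; v \<in> carrier H\<rbrakk> \<Longrightarrow> form u v = \<zero>\<^bsub>K\<^esub> \<longleftrightarrow> form v u = \<zero>\<^bsub>K\<^esub>"
  using form_hermitian star_zero by metis

lemma form_zero_right: "w \<in> carrier H \<Longrightarrow> form w \<zero>\<^bsub>H\<^esub> = \<zero>\<^bsub>K\<^esub>"
  using form_eq_zero_commute form_zero_left by simp

lemma form_smult_left_eq_zero:
  assumes "a \<in> carrier K" "a \<noteq> \<zero>\<^bsub>K\<^esub>" "u \<in> carrier H" "w \<in> carrier H"
  shows "form (a \<odot>\<^bsub>H\<^esub> u) w = \<zero>\<^bsub>K\<^esub> \<longleftrightarrow> form u w = \<zero>\<^bsub>K\<^esub>"
proof -
  have "a \<in> Units K" using assms sfield_Units by blast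
  then obtain b where b: "b \<in> carrier K" "b \<otimes>\<^bsub>K\<^esub> a = \<one>\<^bsub>K\<^esub>" unfolding Units_def by blast
  have "form u w = b \<otimes>\<^bsub>K\<^esub> form (a \<odot>\<^bsub>H\<^esub> u) w"
    using b assms form_closed m_assoc[of b a "form u w"] by (simp add: form_smult_left)
  then show ?thesis using assms b form_smult_left by auto
qed

lemma submodule_perp:
  assumes "E \<subseteq> carrier H" shows "submodule (perp K H form E) K H"
proof -
  have E: "w \<in> E \<Longrightarrow> w \<in> carrier H" for w using assms by blast
  have "\<ominus>\<^bsub>H\<^esub> u \<in> perp K H form E" if "u \<in> perp K H form E" for u
  proof -
    have u: "u \<in> carrier H" using that by (simp add: perp_def)
    have "\<ominus>\<^bsub>H\<^esub> u = (\<ominus>\<^bsub>K\<^esub> \<one>\<^bsub>K\<^esub>) \<odot>\<^bsub>H\<^esub> u" using smult_minus_left[of "\<one>\<^bsub>K\<^esub>" u] u by simp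
    then show ?thesis using that u E form_smult_left[of "\<ominus>\<^bsub>K\<^esub> \<one>\<^bsub>K\<^esub>" u] by (auto simp: perp_def)
  qed
  then have "subgroup (perp K H form E) (add_monoid H)"
    by (intro H.add.subgroupI)
      (use E form_zero_left in \<open>auto simp: perp_def form_add_left a_inv_def intro!: exI[of _ "\<zero>\<^bsub>H\<^esub>"]\<close>)
  then show ?thesis
    by (rule submodule.intro, unfold submodule_axioms_def)
      (use E in \<open>auto simp: perp_def form_smult_left\<close>)
qed

end

text \<open>Here \<open>rep p u\<close> is to be read as: the vector \<open>u\<close> spans the atom
  \<open>p\<close>. The two sides are compared through orthogonality only, and the central fact is
  \<open>?perp (f l) = f (- l)\<close>.\<close>

lemma (in hilbert_lattice) iso_of_representation:
  fixes C :: "'k ring" and H :: "('k, 'v) module" and rep :: "'a \<Rightarrow> 'v \<Rightarrow> bool"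
  assumes herm: "hermitian_space C star H form"
    and rep_closed: "\<And>p u. rep p u \<Longrightarrow> u \<in> carrier H \<and> u \<noteq> \<zero>\<^bsub>H\<^esub>"
    and rep_exists: "\<And>u. \<lbrakk>u \<in> carrier H; u \<noteq> \<zero>\<^bsub>H\<^esub>\<rbrakk> \<Longrightarrow> \<exists>p. rep p u"
    and rep_surj: "\<And>p. atom p \<Longrightarrow> \<exists>u. rep p u"
    and rep_form: "\<And>p q u v. \<lbrakk>rep p u; rep q v\<rbrakk> \<Longrightarrow> form u v = \<zero>\<^bsub>C\<^esub> \<longleftrightarrow> p \<le> - q"
  shows "\<exists>f :: 'a \<Rightarrow> 'v set. ortholattice_iso f (closed_subspaces C H form) (perp C H form)"
proof -
  interpret hermitian_space C star H form by (rule herm)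
  define f where "f l = {u \<in> carrier H. u = \<zero>\<^bsub>H\<^esub> \<or> (\<exists>p. rep p u \<and> p \<le> l)}" for l
  let ?perp = "perp C H form"
  have f_sub: "f l \<subseteq> carrier H" for l by (auto simp: f_def)
  have perp_f: "?perp (f l) = f (- l)" for l
  proof (intro equalityI subsetI)
    fix u assume u: "u \<in> ?perp (f l)"
    then have uH: "u \<in> carrier H" by (simp add: perp_def)
    show "u \<in> f (- l)"
    proof (cases "u = \<zero>\<^bsub>H\<^esub>")
      case True
      then show ?thesis by (simp add: f_def)
    next
      case False
      then obtain p where p: "rep p u" using rep_exists uH by blast
      have "l \<le> - p"
      proof (rule le_if_atoms_le)
        fix q assume q: "atom q" "q \<le> l"
        then obtain v where v: "rep q v" using rep_surj by blast
        then have "v \<in> f l" using q rep_closed by (auto simp: f_def)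
        then have "form u v = \<zero>\<^bsub>C\<^esub>" using u by (simp add: perp_def)
        then show "q \<le> - p" using rep_form[OF p v] orthogonal_sym by blast
      qed
      then show ?thesis using p uH orthogonal_sym by (auto simp: f_def)
    qed
  next
    fix u assume u: "u \<in> f (- l)"
    then have uH: "u \<in> carrier H" by (simp add: f_def)
    have "form u v = \<zero>\<^bsub>C\<^esub>" if v: "v \<in> f l" for v
    proof (cases "u = \<zero>\<^bsub>H\<^esub> \<or> v = \<zero>\<^bsub>H\<^esub>")
      case True
      then show ?thesis using form_zero_left form_zero_right uH v f_sub by blast
    next
      case False
      then obtain p q where "rep p u" "p \<le> - l" "rep q v" "q \<le> l" using u v by (auto simp: f_def)
      moreover from this have "p \<le> - q" by (meson compl_le_compl_iff order_trans)
      ultimately show ?thesis using rep_form by blast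
    qed
    then show "u \<in> ?perp (f l)" using uH by (simp add: perp_def)
  qed
  have le_iff: "x \<le> y \<longleftrightarrow> f x \<subseteq> f y" for x y
  proof
    show "x \<le> y \<Longrightarrow> f x \<subseteq> f y" by (auto simp: f_def intro: order_trans)
    assume sub: "f x \<subseteq> f y"
    show "x \<le> y"
    proof (rule le_if_atoms_le)
      fix p assume p: "atom p" "p \<le> x"
      then obtain u where u: "rep p u" using rep_surj by blast
      then have "u \<in> f x" using p rep_closed by (auto simp: f_def)
      then have uy: "u \<in> ?perp (f (- y))" using sub perp_f[of "- y"] by auto
      \<comment> \<open>That \<open>u\<close> is in \<open>f y\<close> provides some element below
        \<open>y\<close> represented by \<open>u\<close>, a priori not \<open>p\<close> itself.
        Hence the detour through the orthocomplement.\<close>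
      have "- y \<le> - p"
      proof (rule le_if_atoms_le)
        fix q assume q: "atom q" "q \<le> - y"
        then obtain v where v: "rep q v" using rep_surj by blast
        then have "v \<in> f (- y)" using q rep_closed by (auto simp: f_def)
        then have "form u v = \<zero>\<^bsub>C\<^esub>" using uy by (simp add: perp_def)
        then show "q \<le> - p" using rep_form[OF u v] orthogonal_sym by blast
      qed
      then show "p \<le> y" by simp
    qed
  qed
  have inj: "inj f" by (rule injI) (metis le_iff antisym order_refl)
  have closed: "f x \<in> closed_subspaces C H form" for x
    using submodule_perp[OF f_sub, of "- x"] perp_f[of "- x"] perp_f[of x]
    by (simp add: closed_subspaces_def)
  have surj: "\<exists>x. E = f x" if "E \<in> closed_subspaces C H form" for E
  proof -
    have E: "submodule E C H" "?perp (?perp E) = E" using that by (auto simp: closed_subspaces_def)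
    then have EH: "E \<subseteq> carrier H" by (auto simp: perp_def)
    define l where "l = Sup {p. \<exists>u\<in>E. rep p u}"
    \<comment> \<open>An atom below the supremum \<open>l\<close> need not come from
      \<open>E\<close> a priori, so \<open>E = f l\<close> is derived from orthocomplements, for
      which a supremum can be tested on its generators.\<close>
    have "?perp E = f (- l)"
    proof (intro equalityI subsetI)
      fix u assume u: "u \<in> ?perp E"
      then have uH: "u \<in> carrier H" by (simp add: perp_def)
      show "u \<in> f (- l)"
      proof (cases "u = \<zero>\<^bsub>H\<^esub>")
        case True
        then show ?thesis by (simp add: f_def)
      next
        case False
        then obtain p where p: "rep p u" using rep_exists uH by blast
        have "l \<le> - p" unfolding l_def
        proof (rule Sup_least)
          fix q assume "q \<in> {p. \<exists>u\<in>E. rep p u}"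
          then obtain v where v: "v \<in> E" "rep q v" by blast
          then have "form u v = \<zero>\<^bsub>C\<^esub>" using u by (simp add: perp_def)
          then show "q \<le> - p" using rep_form[OF p v(2)] orthogonal_sym by blast
        qed
        then show ?thesis using p uH orthogonal_sym by (auto simp: f_def)
      qed
    next
      fix u assume "u \<in> f (- l)"
      then have u: "u \<in> ?perp (f l)" using perp_f by simp
      have "E \<subseteq> f l"
      proof
        fix v assume v: "v \<in> E"
        show "v \<in> f l"
        proof (cases "v = \<zero>\<^bsub>H\<^esub>")
          case False
          then obtain q where q: "rep q v" using rep_exists v EH by blast
          then have "q \<le> l" unfolding l_def using v by (intro Sup_upper) blast
          then show ?thesis using q v EH by (auto simp: f_def)
        qed (simp add: f_def)
      qed
      then show "u \<in> ?perp E" using u by (auto simp: perp_def)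
    qed
    then have "E = f l" using E(2) perp_f[of "- l"] by simp
    then show ?thesis by blast
  qed
  have "bij_betw f UNIV (closed_subspaces C H form)"
  proof (intro bij_betw_imageI inj equalityI subsetI)
    show "E \<in> closed_subspaces C H form" if "E \<in> range f" for E using that closed by auto
    show "E \<in> range f" if "E \<in> closed_subspaces C H form" for E using surj[OF that] by auto
  qed
  then have "ortholattice_iso f (closed_subspaces C H form) ?perp"
    unfolding ortholattice_iso_def by (intro conjI allI le_iff perp_f[symmetric])
  then show ?thesis by blast
qed

section \<open>Orthogonality of atoms in coordinates\<close>

context framed_hilbert_lattice
begin

text \<open>The atom to be spanned by the vector \<open>(x, 0)\<close> is \<open>dir e x\<close>,
  and \<open>e\<close> is the zero vector of \<open>V\<close>.\<close>

definition dorth :: "'a \<Rightarrow> 'a \<Rightarrow> bool"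
  where "dorth x y \<longleftrightarrow> x = e \<or> y = e \<or> dir e x \<le> - y"

lemma dir_e:
  assumes "aff x" "x \<noteq> e"
  shows "atom (dir e x)" "dir e x \<le> e \<squnion> x" "dir e x \<le> - e" "e \<squnion> dir e x = e \<squnion> x"
  using dir[OF aff_e aff_atom[OF assms(1)]] assms by auto

text \<open>A point of \<open>- e\<close> that is orthogonal to \<open>y\<close> is orthogonal to
  the whole line \<open>e \<squnion> y\<close>. This replaces \<open>(y, 1)\<close> by
  \<open>(y, 0)\<close> and so makes \<open>dorth\<close> symmetric.\<close>

lemma le_compl_line:
  assumes "aff y" "y \<noteq> e" "p \<le> - e" shows "p \<le> - y \<longleftrightarrow> p \<le> - dir e y"
proof -
  have "p \<le> - y \<longleftrightarrow> p \<le> - (e \<squnion> y)" using assms by simp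
  also have "\<dots> \<longleftrightarrow> p \<le> - (e \<squnion> dir e y)" using dir_e assms by metis
  also have "\<dots> \<longleftrightarrow> p \<le> - dir e y" using assms by simp
  finally show ?thesis .
qed

lemma dorth_commute: assumes "aff x" "aff y" "dorth x y" shows "dorth y x"
proof (cases "x = e \<or> y = e")
  case False
  then have "dir e x \<le> - y" using assms by (simp add: dorth_def)
  then have "dir e x \<le> - dir e y" using le_compl_line[of y "dir e x"] dir_e[of x] assms False by blast
  then have "dir e y \<le> - dir e x" by (rule orthogonal_sym)
  then have "dir e y \<le> - x" using le_compl_line[of x "dir e y"] dir_e[of y] assms False by blast
  then show ?thesis by (simp add: dorth_def)
qed (auto simp: dorth_def)

lemma affine_polarity: "affine_polarity K V (\<lambda>x y. x \<le> - y) dorth"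
proof -
  interpret left_linear_space K V by (rule left_linear_space_V)
  show ?thesis
  proof unfold_locales
    show "\<one>\<^bsub>K\<^esub> \<noteq> \<zero>\<^bsub>K\<^esub>" using i_neq_e by simp
    show "Units K = carrier K - {\<zero>\<^bsub>K\<^esub>}" by (rule K_Units)
    show "y \<le> - x" if "x \<le> - y" for x y :: 'a using orthogonal_sym that .
    show "dorth y x" if "x \<in> carrier V" "y \<in> carrier V" "dorth x y" for x y
      using dorth_commute that by simp
    show "\<not> x \<le> - x" if "x \<in> carrier V" for x using atom_not_le_compl aff_atom that by auto
    show "\<not> \<zero>\<^bsub>V\<^esub> \<le> - y" if "y \<in> carrier V" for y using that orthogonal_sym by (auto simp: aff_def)
    show "dorth x \<zero>\<^bsub>V\<^esub>" for x by (simp add: dorth_def)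
    show "\<not> dorth x x" if "x \<in> carrier V" "x \<noteq> \<zero>\<^bsub>V\<^esub>" for x
      using le_compl_line[of x "dir e x"] dir_e[of x] atom_not_le_compl that by (auto simp: dorth_def)
    show "z \<oplus>\<^bsub>V\<^esub> w \<le> - y \<longleftrightarrow> dorth w y"
      if h: "z \<in> carrier V" "w \<in> carrier V" "y \<in> carrier V" "z \<le> - y" for z w y
    proof (cases "w = e")
      case True
      then show ?thesis using h tr_e by (simp add: dorth_def)
    next
      case False
      have A: "aff z" "aff w" "aff y" using h by auto
      have "y \<noteq> e" using A h by (auto simp: aff_def)
      then have d: "dorth w y \<longleftrightarrow> dir e w \<le> - y" using False by (simp add: dorth_def)
      have n: "tr z w \<noteq> z" using tr_neq[of w z] tr_commute[of z w] A False by simp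
      have le: "tr z w \<le> z \<squnion> dir e w" using tr_le_left[of w z] tr_commute[of z w] A False by simp
      \<comment> \<open>The points \<open>z\<close>, \<open>z + w\<close> and \<open>dir e w\<close>
        are collinear and \<open>z\<close> is below \<open>- y\<close>, so the other two are below
        \<open>- y\<close> together or not at all.\<close>
      have "z \<squnion> tr z w = z \<squnion> dir e w"
        using line_exchange[OF aff_atom _ aff_atom le n] A dir_e[OF A(2) False] tr_closed by blast
      then have "tr z w \<le> - y \<longleftrightarrow> dir e w \<le> - y" using h by (metis le_sup_iff)
      then show ?thesis using d by simp
    qed
    show "dorth (a \<odot>\<^bsub>V\<^esub> w) y" if "a \<in> carrier K" "w \<in> carrier V" "y \<in> carrier V" "dorth w y" for a w y
    proof (cases "a = e \<or> w = e")
      case True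
      then have "smul a w = e" using that smul_e_left smul_e_right by auto
      then show ?thesis by (simp add: dorth_def)
    next
      case False
      then show ?thesis using that dir_smul[of a w] by (auto simp: dorth_def)
    qed
    show "\<exists>a\<in>carrier K. a \<odot>\<^bsub>V\<^esub> x \<le> - y" if h: "x \<in> carrier V" "y \<in> carrier V" "\<not> dorth x y" for x y
    proof -
      have A: "aff x" "aff y" "x \<noteq> e" "y \<noteq> e" "\<not> dir e x \<le> - y" using h by (auto simp: dorth_def)
      obtain t where t: "atom t" "t \<le> e \<squnion> x" "t \<le> - y"
        using line_meets_compl[of e x y] A atom_e aff_atom by metis
      have "aff t"
      proof (rule ccontr)
        assume "\<not> aff t"
        then have "t \<le> - e" using t by (simp add: aff_def)
        then have "dir e x = t" using dir_eqI[OF aff_e] A t aff_atom by blast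
        then show False using A t by simp
      qed
      then show ?thesis using smul_transitive[of x t] A t by auto
    qed
    show "\<exists>x\<in>carrier V. x \<le> - y \<and> dorth x y'"
      if h: "y \<in> carrier V" "y' \<in> carrier V" "y' \<noteq> \<zero>\<^bsub>V\<^esub>" "\<forall>a\<in>carrier K. y \<noteq> a \<odot>\<^bsub>V\<^esub> y'" for y y'
    proof -
      have A: "aff y" "aff y'" "y' \<noteq> e" using h by auto
      have n: "\<not> y \<le> e \<squnion> y'" using smul_transitive[of y' y] A h by fastforce
      let ?d = "dir e y'"
      note d = dir_e[OF A(2,3)]
      \<comment> \<open>The point wanted is orthogonal to \<open>y\<close> and \<open>?d\<close> but
        not to \<open>e\<close>. It exists as soon as \<open>e\<close> is off the line
        \<open>y \<squnion> ?d\<close>.\<close>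
      have "\<not> e \<le> y \<squnion> ?d"
      proof
        assume "e \<le> y \<squnion> ?d"
        moreover have "e \<noteq> ?d" using d aff_e by (auto simp: aff_def)
        ultimately have "?d \<squnion> e = ?d \<squnion> y"
          using line_exchange[of ?d y e] d A aff_atom atom_e by (metis sup_commute)
        then show False using n d by (metis sup_commute sup_ge2)
      qed
      then have "\<not> - (y \<squnion> ?d) \<le> - e" by (metis compl_le_compl_iff)
      then obtain x where x: "atom x" "x \<le> - (y \<squnion> ?d)" "\<not> x \<le> - e" by (rule obtain_atom_not_le)
      then have ax: "aff x" by (simp add: aff_def)
      have "x \<le> - y" "x \<le> - ?d" using x(2) by auto
      then have "dorth y' x" using orthogonal_sym by (auto simp: dorth_def)
      then show ?thesis using dorth_commute ax A \<open>x \<le> - y\<close> by auto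
    qed
    show "\<exists>w\<in>carrier V. \<forall>a\<in>carrier K. w \<noteq> a \<odot>\<^bsub>V\<^esub> y" if h: "y \<in> carrier V" for y
    proof -
      obtain w where w: "aff w" "\<not> w \<le> e \<squnion> y" using obtain_aff_off_line h by auto
      then show ?thesis using smul_le h by (intro bexI[of _ w]) auto
    qed
  qed
qed

lemma coordinatization:
  "\<exists>(C :: 'a ring) star (H :: ('a, 'a \<times> 'a) module) form. hermitian_space C star H form \<and>
    (\<exists>f :: 'a \<Rightarrow> ('a \<times> 'a) set. ortholattice_iso f (closed_subspaces C H form) (perp C H form))"
proof -
  interpret P: affine_polarity K V "\<lambda>x y. x \<le> - y" dorth by (rule affine_polarity)
  interpret Q: hermitian_space K P.\<sigma> P.H P.form by (rule P.hermitian_space_H)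
  \<comment> \<open>With \<open>i\<close> as one and \<open>e\<close> as zero of \<open>K\<close>,
    an affine atom \<open>p\<close> is spanned by \<open>(p, 1)\<close>, an atom at infinity by
    \<open>(x, 0)\<close>. The second kind has no scalar factor because \<open>x\<close> already
    runs through all affine points except \<open>e\<close> on the line from \<open>e\<close> to
    \<open>p\<close>.\<close>
  define rep where "rep p u \<longleftrightarrow> (\<exists>a. a \<in> scalars \<and> a \<noteq> e \<and> aff p \<and> u = a \<odot>\<^bsub>P.H\<^esub> (p, i)) \<or>
    (\<exists>x. aff x \<and> x \<noteq> e \<and> u = (x, e) \<and> p = dir e x)" for p u
  have ff: "P.form (x, i) (y, i) = e \<longleftrightarrow> x \<le> - y" if "aff x" "aff y" for x y
  proof -
    have V: "x \<in> carrier V" "y \<in> carrier V" using that by auto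
    have "P.form (x, i) (y, i) = P.g x y \<oplus>\<^bsub>K\<^esub> \<one>\<^bsub>K\<^esub>"
      using P.\<sigma>_one i_scalars smul_i by (simp add: P.form_def)
    moreover have "P.g x y \<oplus>\<^bsub>K\<^esub> \<one>\<^bsub>K\<^esub> = \<zero>\<^bsub>K\<^esub> \<longleftrightarrow> P.g x y = \<ominus>\<^bsub>K\<^esub> \<one>\<^bsub>K\<^esub>"
    proof
      assume "P.g x y \<oplus>\<^bsub>K\<^esub> \<one>\<^bsub>K\<^esub> = \<zero>\<^bsub>K\<^esub>"
      then show "P.g x y = \<ominus>\<^bsub>K\<^esub> \<one>\<^bsub>K\<^esub>"
        by (rule P.K.minus_equality[symmetric]) (rule P.K.one_closed P.g_closed[OF V])+
    next
      assume "P.g x y = \<ominus>\<^bsub>K\<^esub> \<one>\<^bsub>K\<^esub>"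
      then show "P.g x y \<oplus>\<^bsub>K\<^esub> \<one>\<^bsub>K\<^esub> = \<zero>\<^bsub>K\<^esub>" using P.K.l_neg[OF P.K.one_closed] by argo
    qed
    ultimately show ?thesis using P.g_eq_minus_one_iff[OF V] by simp
  qed
  have fi: "P.form (x, e) (y, a) = e \<longleftrightarrow> dorth x y" if "aff x" "aff y" "a \<in> scalars" for x y a
  proof -
    have V: "x \<in> carrier V" "y \<in> carrier V" "a \<in> carrier K" using that by auto
    have "P.form (x, \<zero>\<^bsub>K\<^esub>) (y, a) = P.g x y \<oplus>\<^bsub>K\<^esub> \<zero>\<^bsub>K\<^esub> \<otimes>\<^bsub>K\<^esub> P.\<sigma> a" by (simp add: P.form_def)
    also have "\<dots> = P.g x y"
      using P.K.l_null[OF P.\<sigma>_closed[OF V(3)]] P.K.r_zero[OF P.g_closed[OF V(1,2)]] by metis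
    finally show ?thesis using P.g_eq_zero_iff[OF V(1,2)] by simp
  qed
  have "\<exists>f :: 'a \<Rightarrow> ('a \<times> 'a) set. ortholattice_iso f (closed_subspaces K P.H P.form) (perp K P.H P.form)"
  proof (rule iso_of_representation)
    show "hermitian_space K P.\<sigma> P.H P.form" by (rule P.hermitian_space_H)
  next
    fix p u assume "rep p u"
    then show "u \<in> carrier P.H \<and> u \<noteq> \<zero>\<^bsub>P.H\<^esub>"
      unfolding rep_def
    proof (elim disjE exE conjE)
      fix a assume a: "a \<in> scalars" "a \<noteq> e" "aff p" "u = a \<odot>\<^bsub>P.H\<^esub> (p, i)"
      then have "u = (smul a p, a)" using smul_i by simp
      then show ?thesis using a smul_aff by simp
    next
      fix x assume "aff x" "x \<noteq> e" "u = (x, e)"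
      then show ?thesis using e_scalars by simp
    qed
  next
    fix u assume u: "u \<in> carrier P.H" "u \<noteq> \<zero>\<^bsub>P.H\<^esub>"
    then obtain x a where xa: "u = (x, a)" "aff x" "a \<in> scalars" by auto
    show "\<exists>p. rep p u"
    proof (cases "a = e")
      case True
      then show ?thesis using xa u unfolding rep_def by auto
    next
      case False
      then obtain b where b: "b \<in> scalars" "smul a b = i" using scalar_inverse xa by blast
      have "smul a (smul b x) = x" using smul_assoc[of a b x] b xa smul_i_left by simp
      then have "u = a \<odot>\<^bsub>P.H\<^esub> (smul b x, i)" using xa smul_i by simp
      then have "rep (smul b x) u" unfolding rep_def using xa b False smul_aff by blast
      then show ?thesis ..
    qed
  next
    fix p :: 'a assume p: "atom p"
    show "\<exists>u. rep p u"
    proof (cases "aff p")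
      case True
      then have "rep p (i \<odot>\<^bsub>P.H\<^esub> (p, i))" unfolding rep_def using i_scalars i_neq_e by blast
      then show ?thesis ..
    next
      case False
      then have pe: "p \<le> - e" "p \<noteq> e" using p aff_e by (auto simp: aff_def)
      \<comment> \<open>A vector for an atom at infinity comes from a third point on its line with
        \<open>e\<close>; as \<open>p\<close> is orthogonal to \<open>e\<close>, this rests on
        (H3).\<close>
      obtain x where x: "atom x" "x \<noteq> e" "x \<noteq> p" "x \<le> e \<squnion> p" using third_atom[of e p] atom_e p pe by metis
      have ax: "aff x"
        using infinite_atom_unique[of e p e x p] x p pe atom_e aff_e by (auto simp: aff_def)
      have "dir e x = p" using dir_eq_if_le[OF aff_e ax] x p pe by blast
      then have "rep p (x, e)" unfolding rep_def using ax x by auto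
      then show ?thesis ..
    qed
  next
    \<comment> \<open>Scaling does not affect orthogonality, so only vectors with last coordinate
      \<open>i\<close> or \<open>e\<close> are compared; the four combinations are
      \<open>ff\<close>, \<open>io\<close>, \<open>oi\<close> and \<open>ii\<close>.\<close>
    have base: "P.form u v = \<zero>\<^bsub>K\<^esub> \<longleftrightarrow> p \<le> - q"
      if u: "(aff p \<and> u = (p, i)) \<or> (\<exists>x. aff x \<and> x \<noteq> e \<and> u = (x, e) \<and> p = dir e x)"
        and v: "(aff q \<and> v = (q, i)) \<or> (\<exists>x. aff x \<and> x \<noteq> e \<and> v = (x, e) \<and> q = dir e x)" for p q u v
    proof -
      have io: "P.form (x, e) (q, i) = e \<longleftrightarrow> dir e x \<le> - q" if "aff x" "x \<noteq> e" "aff q" for x q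
        using fi[of x q i] that i_scalars dir_e[of x] by (auto simp: dorth_def)
      have ii: "P.form (x, e) (y, e) = e \<longleftrightarrow> dir e x \<le> - dir e y" if "aff x" "x \<noteq> e" "aff y" "y \<noteq> e" for x y
        using fi[of x y e] that e_scalars le_compl_line[of y "dir e x"] dir_e[of x] by (auto simp: dorth_def)
      have oi: "P.form (p, i) (y, e) = e \<longleftrightarrow> p \<le> - dir e y" if "aff p" "aff y" "y \<noteq> e" for p y
      proof -
        have "(p, i) \<in> carrier P.H" "(y, e) \<in> carrier P.H" using that i_scalars e_scalars by auto
        then have "P.form (p, i) (y, e) = e \<longleftrightarrow> P.form (y, e) (p, i) = e"
          using Q.form_eq_zero_commute by simp
        then show ?thesis using io[of y p] that orthogonal_sym by blast
      qed
      show ?thesis using u v ff io ii oi by auto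
    qed
    fix p q u v assume "rep p u" "rep q v"
    then obtain a u' b v' where
      a: "a \<in> carrier K" "a \<noteq> \<zero>\<^bsub>K\<^esub>" "u = a \<odot>\<^bsub>P.H\<^esub> u'" "u' \<in> carrier P.H"
        "(aff p \<and> u' = (p, i)) \<or> (\<exists>x. aff x \<and> x \<noteq> e \<and> u' = (x, e) \<and> p = dir e x)" and
      b: "b \<in> carrier K" "b \<noteq> \<zero>\<^bsub>K\<^esub>" "v = b \<odot>\<^bsub>P.H\<^esub> v'" "v' \<in> carrier P.H"
        "(aff q \<and> v' = (q, i)) \<or> (\<exists>x. aff x \<and> x \<noteq> e \<and> v' = (x, e) \<and> q = dir e x)"
    proof -
      have "\<exists>a u'. a \<in> carrier K \<and> a \<noteq> \<zero>\<^bsub>K\<^esub> \<and> u = a \<odot>\<^bsub>P.H\<^esub> u' \<and> u' \<in> carrier P.H \<and>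
        ((aff p \<and> u' = (p, i)) \<or> (\<exists>x. aff x \<and> x \<noteq> e \<and> u' = (x, e) \<and> p = dir e x))" if "rep p u" for p u
        using that unfolding rep_def
      proof (elim disjE exE conjE)
        fix a assume "a \<in> scalars" "a \<noteq> e" "aff p" "u = a \<odot>\<^bsub>P.H\<^esub> (p, i)"
        then show ?thesis using i_scalars by (intro exI[of _ a] exI[of _ "(p, i)"]) auto
      next
        fix x assume "aff x" "x \<noteq> e" "u = (x, e)" "p = dir e x"
        then show ?thesis using i_scalars i_neq_e e_scalars smul_i_left smul_e_right
          by (intro exI[of _ i] exI[of _ "(x, e)"]) auto
      qed
      from this[OF \<open>rep p u\<close>] this[OF \<open>rep q v\<close>] that show thesis by blast
    qed
    have uv: "u \<in> carrier P.H" "v \<in> carrier P.H" using a b Q.smult_closed by blast+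
    have "P.form u v = \<zero>\<^bsub>K\<^esub> \<longleftrightarrow> P.form u' v = \<zero>\<^bsub>K\<^esub>"
      unfolding a(3) by (rule Q.form_smult_left_eq_zero[OF a(1,2,4) uv(2)])
    also have "\<dots> \<longleftrightarrow> P.form v u' = \<zero>\<^bsub>K\<^esub>" by (rule Q.form_eq_zero_commute[OF a(4) uv(2)])
    also have "\<dots> \<longleftrightarrow> P.form v' u' = \<zero>\<^bsub>K\<^esub>"
      unfolding b(3) by (rule Q.form_smult_left_eq_zero[OF b(1,2,4) a(4)])
    also have "\<dots> \<longleftrightarrow> P.form u' v' = \<zero>\<^bsub>K\<^esub>" by (rule Q.form_eq_zero_commute[OF b(4) a(4)])
    also have "\<dots> \<longleftrightarrow> p \<le> - q" by (rule base[OF a(5) b(5)])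
    finally show "P.form u v = \<zero>\<^bsub>K\<^esub> \<longleftrightarrow> p \<le> - q" .
  qed
  then show ?thesis using P.hermitian_space_H by blast
qed

end

theorem theorem3p10:
  assumes atomistic: "atomistic TYPE('a::complete_orthocomplemented_lattice)"
    and H1: "finite_covering_property TYPE('a)"
    and H2: "\<And>p q :: 'a. \<lbrakk>atom p; atom q; p \<noteq> q\<rbrakk> \<Longrightarrow>
        \<exists>r. atom r \<and> orthogonal r p \<and> sup p q = sup p r"
    and H3: "\<And>p q :: 'a. \<lbrakk>atom p; atom q; orthogonal p q\<rbrakk> \<Longrightarrow>
        \<exists>r. atom r \<and> r \<noteq> p \<and> r \<noteq> q \<and> r \<le> sup p q"
    and H4: "height_at_least 4 TYPE('a)"
  shows "\<exists>(K :: 'a ring) star (H :: ('a, 'a \<times> 'a) module) form.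
      hermitian_space K star H form \<and>
      (\<exists>f :: 'a \<Rightarrow> ('a \<times> 'a) set.
        ortholattice_iso f (closed_subspaces K H form) (perp K H form))"
proof -
  interpret hilbert_lattice "TYPE('a)"
    using assms by (rule hilbert_lattice.intro)
  \<comment> \<open>Five elements force one different from \<open>bot\<close>, and below it there is
    an atom to serve as origin.\<close>
  obtain C :: "'a set" where C: "infinite C \<or> 5 \<le> card C"
    using H4 unfolding height_at_least_def by auto
  have "\<exists>x::'a. x \<noteq> bot"
  proof (rule ccontr)
    assume "\<not> ?thesis"
    then have "C \<subseteq> {bot}" by auto
    then have "finite C" "card C \<le> 1" using finite_subset card_mono[of "{bot}" C] by auto
    then show False using C by simp
  qed
  then obtain e :: 'a where e: "atom e" using obtain_atom_not_le[of _ bot] by (metis bot.extremum_uniqueI)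
  interpret pointed_hilbert_lattice "TYPE('a)" e by unfold_locales (rule e)
  \<comment> \<open>The join \<open>e \<squnion> e\<close> is just \<open>e\<close>, so this
    provides an affine point \<open>i \<noteq> e\<close> to serve as the unit.\<close>
  obtain i where i: "aff i" "\<not> i \<le> e \<squnion> e" using obtain_aff_off_line[OF aff_e] by blast
  interpret framed_hilbert_lattice "TYPE('a)" e i by unfold_locales (use i in auto)
  show ?thesis by (rule coordinatization)
qed

end
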